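(* Let $A$ and $B$ be autonomous map pseudomonoids in a Gray monoid $\mathscr M$, and let $(w,\psi,\psi_0)\colon A\to B$ be a strong monoidal map. Then the induced comonad $L(w)=w\cdot\overline w$ on $B$ is a Hopf monoidal comonad.
   Context: A Gray monoid is a 2-category that is a monoid for the Gray tensor product; $f\otimes g:=A'g\cdot fB$ for $f\colon A\to A'$, $g\colon B\to B'$. A map is a 1-cell $f$ with chosen right adjoint $\overline f$, unit and counit. A pseudomonoid $(B,m,u)$ is a monoid up to coherent invertible 2-cells; it is a map pseudomonoid if $m\colon BB\to B$ and $u\colon I\to B$ are maps. A strong monoidal map $(w,\psi,\psi_0)\colon(A,p,j)\to(B,m,u)$ is a map $w$ with coherent invertible 2-cells $\psi\colon m(w\otimes w)\Rightarrow wp$ and $\psi_0\colon u\Rightarrow wj$. Autonomous pseudomonoids: the lax slice $\mathscr M/_\ell B$ has objects the 1-cells $f\colon X\to B$; 1-cells $f\to f'$ are pairs $(a,\alpha)$ with $\alpha\colon f'a\Rightarrow f$; 2-cells $(a,\alpha)\Rightarrow(b,\beta)$ are 2-cells $\phi\colon a\Rightarrow b$ with $\beta\circ f'\phi=\alpha$. It is a monoidal 2-category with $f\bullet g=m\cdot(f\otimes g)$ and unit $u$ (coherence 1-cells have identity underlying 1-cell and 2-cell part induced by the coherence 2-cells of $B$). In a monoidal 2-category, $Y$ is a right bidual of $X$ if there are 1-cells $n\colon I\to YX$, $e\colon XY\to I$ and invertible 2-cells $\mathrm{id}_Y\cong Ye\cdot nY$ and $eX\cdot Xn\cong\mathrm{id}_X$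 satisfying the two swallowtail coherence equations. $B$ is left autonomous if $\mathrm{id}_B\colon B\to B$ has a right bidual $d\colon B^\circ\to B$ in $\mathscr M/_\ell B$; right autonomous if it is left autonomous in the Gray monoid $\mathscr M^{\mathrm{rev}}$ with reversed tensor product; autonomous if both. $L(w)=w\overline w$ is a comonad with comultiplication $w\eta\overline w$ and counit $\varepsilon$; it is a monoidal comonad, with monoidal structure the composite of the strong monoidal structure of $w$ and the induced (mate) monoidal structure of $\overline w$. A monoidal comonad $(c,\phi\colon m(c\otimes c)\Rightarrow cm,\phi_0\colon u\Rightarrow cu)$ on $(B,m,u)$ (comultiplication $\delta$ and counit being monoidal 2-cells) is Hopf if it is both left and right Hopf, i.e. both fusion 2-cells $$m(c\otimes c)\xrightarrow{\,m(c\otimes\delta)\,}m(c\otimes cc)\cong m(c\otimes c)(1\otimes c)\xrightarrow{\,\phi(1\otimes c)\,}cm(1\otimes c),$$ $$m(c\otimes c)\xrightarrow{\,m(\delta\otimes c)\,}m(cc\otimes c)\cong m(c\otimes c)(c\otimes1)\xrightarrow{\,\phi(c\otimes1)\,}cm(c\otimes1)$$ are invertible. *)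

theory Defs
  imports Main
begin

section \<open>Strict 2-categories\<close>

text \<open>Operations are total functions; they are only constrained on composable arguments.
  Compositions are written in the order of function application.\<close>

record ('o, 'm, 'c) two_cat =
  Obj :: "'o set"
  Arr :: "'m set"
  Cell :: "'c set"
  dom :: "'m \<Rightarrow> 'o"
  cod :: "'m \<Rightarrow> 'o"
  src :: "'c \<Rightarrow> 'm"
  trg :: "'c \<Rightarrow> 'm"
  id1 :: "'o \<Rightarrow> 'm"
  id2 :: "'m \<Rightarrow> 'c"
  comp1 :: "'m \<Rightarrow> 'm \<Rightarrow> 'm" (infixl \<open>\<cdot>\<index>\<close> 70)
  vcomp :: "'c \<Rightarrow> 'c \<Rightarrow> 'c" (infixl \<open>\<bullet>\<index>\<close> 55)
  hcomp :: "'c \<Rightarrow> 'c \<Rightarrow> 'c" (infixl \<open>\<star>\<index>\<close> 68)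

definition hom1 :: "('o, 'm, 'c, 'z) two_cat_scheme \<Rightarrow> 'o \<Rightarrow> 'o \<Rightarrow> 'm set"
  where "hom1 C X Y = {f \<in> Arr C. dom C f = X \<and> cod C f = Y}"

definition hom2 :: "('o, 'm, 'c, 'z) two_cat_scheme \<Rightarrow> 'm \<Rightarrow> 'm \<Rightarrow> 'c set"
  where "hom2 C f g = {a \<in> Cell C. src C a = f \<and> trg C a = g}"

definition lwhisk :: "('o, 'm, 'c, 'z) two_cat_scheme \<Rightarrow> 'm \<Rightarrow> 'c \<Rightarrow> 'c" (infixr \<open>\<rhd>\<index>\<close> 65)
  where "lwhisk C g a = hcomp C (id2 C g) a"

definition rwhisk :: "('o, 'm, 'c, 'z) two_cat_scheme \<Rightarrow> 'c \<Rightarrow> 'm \<Rightarrow> 'c" (infixl \<open>\<lhd>\<index>\<close> 66)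
  where "rwhisk C a f = hcomp C a (id2 C f)"

locale two_category =
  fixes C :: "('o, 'm, 'c, 'z) two_cat_scheme" (structure)
  assumes arr_obj: "f \<in> hom1 C X Y \<Longrightarrow> X \<in> Obj C \<and> Y \<in> Obj C"
    and cell_arr: "a \<in> hom2 C f g \<Longrightarrow>
      f \<in> Arr C \<and> g \<in> Arr C \<and> dom C f = dom C g \<and> cod C f = cod C g"
    and id1_hom: "X \<in> Obj C \<Longrightarrow> id1 C X \<in> hom1 C X X"
    and comp1_hom: "\<lbrakk>f \<in> hom1 C X Y; g \<in> hom1 C Y Z\<rbrakk> \<Longrightarrow> g \<cdot> f \<in> hom1 C X Z"
    and comp1_assoc: "\<lbrakk>f \<in> hom1 C W X; g \<in> hom1 C X Y; h \<in> hom1 C Y Z\<rbrakk> \<Longrightarrow>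
      h \<cdot> g \<cdot> f = h \<cdot> (g \<cdot> f)"
    and comp1_id: "f \<in> hom1 C X Y \<Longrightarrow> f \<cdot> id1 C X = f \<and> id1 C Y \<cdot> f = f"
    and id2_hom: "f \<in> Arr C \<Longrightarrow> id2 C f \<in> hom2 C f f"
    and vcomp_hom: "\<lbrakk>a \<in> hom2 C f g; b \<in> hom2 C g h\<rbrakk> \<Longrightarrow> b \<bullet> a \<in> hom2 C f h"
    and vcomp_assoc: "\<lbrakk>a \<in> hom2 C f g; b \<in> hom2 C g h; c \<in> hom2 C h k\<rbrakk> \<Longrightarrow>
      c \<bullet> b \<bullet> a = c \<bullet> (b \<bullet> a)"
    and vcomp_id: "a \<in> hom2 C f g \<Longrightarrow> a \<bullet> id2 C f = a \<and> id2 C g \<bullet> a = a"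
    and hcomp_hom: "\<lbrakk>a \<in> hom2 C f f'; b \<in> hom2 C g g'; cod C f = dom C g\<rbrakk> \<Longrightarrow>
      b \<star> a \<in> hom2 C (g \<cdot> f) (g' \<cdot> f')"
    and hcomp_assoc: "\<lbrakk>a \<in> hom2 C f f'; b \<in> hom2 C g g'; c \<in> hom2 C h h';
        cod C f = dom C g; cod C g = dom C h\<rbrakk> \<Longrightarrow> c \<star> b \<star> a = c \<star> (b \<star> a)"
    and hcomp_id: "a \<in> hom2 C f g \<Longrightarrow>
      a \<star> id2 C (id1 C (dom C f)) = a \<and> id2 C (id1 C (cod C f)) \<star> a = a"
    and hcomp_id2: "\<lbrakk>f \<in> hom1 C X Y; g \<in> hom1 C Y Z\<rbrakk> \<Longrightarrow>
      id2 C g \<star> id2 C f = id2 C (g \<cdot> f)"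
    and interchange: "\<lbrakk>a \<in> hom2 C f f'; a' \<in> hom2 C f' f''; b \<in> hom2 C g g'; b' \<in> hom2 C g' g'';
        cod C f = dom C g\<rbrakk> \<Longrightarrow> (b' \<bullet> b) \<star> (a' \<bullet> a) = (b' \<star> a') \<bullet> (b \<star> a)"

definition inverse_cells :: "('o, 'm, 'c, 'z) two_cat_scheme \<Rightarrow> 'c \<Rightarrow> 'c \<Rightarrow> bool"
  where "inverse_cells C a b \<longleftrightarrow>
    a \<in> hom2 C (src C a) (trg C a) \<and> b \<in> hom2 C (trg C a) (src C a) \<and>
    vcomp C b a = id2 C (src C a) \<and> vcomp C a b = id2 C (trg C a)"

definition invertible :: "('o, 'm, 'c, 'z) two_cat_scheme \<Rightarrow> 'c \<Rightarrow> bool"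
  where "invertible C a \<longleftrightarrow> (\<exists>b. inverse_cells C a b)"

definition vinv :: "('o, 'm, 'c, 'z) two_cat_scheme \<Rightarrow> 'c \<Rightarrow> 'c"
  where "vinv C a = (THE b. inverse_cells C a b)"

definition iso2 :: "('o, 'm, 'c, 'z) two_cat_scheme \<Rightarrow> 'm \<Rightarrow> 'm \<Rightarrow> 'c set"
  where "iso2 C f g = {a \<in> hom2 C f g. invertible C a}"

definition adjunction ::
    "('o, 'm, 'c, 'z) two_cat_scheme \<Rightarrow> 'o \<Rightarrow> 'o \<Rightarrow> 'm \<Rightarrow> 'm \<Rightarrow> 'c \<Rightarrow> 'c \<Rightarrow> bool"
  where "adjunction C X Y f r \<eta> \<epsilon> \<longleftrightarrow>
    f \<in> hom1 C X Y \<and> r \<in> hom1 C Y X \<and>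
    \<eta> \<in> hom2 C (id1 C X) (r \<cdot> f) \<and> \<epsilon> \<in> hom2 C (f \<cdot> r) (id1 C Y) \<and>
    (\<epsilon> \<lhd> f) \<bullet> (f \<rhd> \<eta>) = id2 C f \<and> (r \<rhd> \<epsilon>) \<bullet> (\<eta> \<lhd> r) = id2 C r"
  for C (structure)

text \<open>Which right adjoint is chosen matters only where it is used; there it is given explicitly.\<close>

definition is_map :: "('o, 'm, 'c, 'z) two_cat_scheme \<Rightarrow> 'o \<Rightarrow> 'o \<Rightarrow> 'm \<Rightarrow> bool"
  where "is_map C X Y f \<longleftrightarrow> (\<exists>r \<eta> \<epsilon>. adjunction C X Y f r \<eta> \<epsilon>)"


section \<open>Gray monoids\<close>

text \<open>A monoid for the Gray tensor product is a 2-category with a strictly associative and unital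
  tensor of objects, strict 2-functors \<open>X \<otimes> -\<close> and \<open>- \<otimes> X\<close>, and invertible interchange cells
  \<open>gi f g : A'g \<cdot> fB \<Rightarrow> fB' \<cdot> Ag\<close> for \<open>f : A \<rightarrow> A'\<close>, \<open>g : B \<rightarrow> B'\<close>.\<close>

record ('o, 'm, 'c) gray = "('o, 'm, 'c) two_cat" +
  unit_obj :: 'o
  tens0 :: "'o \<Rightarrow> 'o \<Rightarrow> 'o" (infixl \<open>\<otimes>\<^sub>0\<index>\<close> 75)
  lact1 :: "'o \<Rightarrow> 'm \<Rightarrow> 'm" (infixr \<open>\<otimes>\<^sub>L\<index>\<close> 75)
  ract1 :: "'m \<Rightarrow> 'o \<Rightarrow> 'm" (infixl \<open>\<otimes>\<^sub>R\<index>\<close> 76)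
  lact2 :: "'o \<Rightarrow> 'c \<Rightarrow> 'c" (infixr \<open>\<otimes>\<^sub>L\<^sub>2\<index>\<close> 75)
  ract2 :: "'c \<Rightarrow> 'o \<Rightarrow> 'c" (infixl \<open>\<otimes>\<^sub>R\<^sub>2\<index>\<close> 76)
  gi :: "'m \<Rightarrow> 'm \<Rightarrow> 'c"

locale gray_monoid = two_category G
  for G :: "('o, 'm, 'c) gray" (structure) +
  assumes unit_obj: "unit_obj G \<in> Obj G"
    and tens0_obj: "\<lbrakk>X \<in> Obj G; Y \<in> Obj G\<rbrakk> \<Longrightarrow> X \<otimes>\<^sub>0 Y \<in> Obj G"
    and tens0_assoc: "\<lbrakk>X \<in> Obj G; Y \<in> Obj G; Z \<in> Obj G\<rbrakk> \<Longrightarrow>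
      X \<otimes>\<^sub>0 Y \<otimes>\<^sub>0 Z = X \<otimes>\<^sub>0 (Y \<otimes>\<^sub>0 Z)"
    and tens0_unit: "X \<in> Obj G \<Longrightarrow> unit_obj G \<otimes>\<^sub>0 X = X \<and> X \<otimes>\<^sub>0 unit_obj G = X"
    and lact1_hom: "\<lbrakk>Z \<in> Obj G; f \<in> hom1 G X Y\<rbrakk> \<Longrightarrow> Z \<otimes>\<^sub>L f \<in> hom1 G (Z \<otimes>\<^sub>0 X) (Z \<otimes>\<^sub>0 Y)"
    and lact1_id: "\<lbrakk>Z \<in> Obj G; X \<in> Obj G\<rbrakk> \<Longrightarrow> Z \<otimes>\<^sub>L id1 G X = id1 G (Z \<otimes>\<^sub>0 X)"
    and lact1_comp: "\<lbrakk>Z \<in> Obj G; f \<in> hom1 G W X; g \<in> hom1 G X Y\<rbrakk> \<Longrightarrow>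
      Z \<otimes>\<^sub>L (g \<cdot> f) = (Z \<otimes>\<^sub>L g) \<cdot> (Z \<otimes>\<^sub>L f)"
    and lact2_hom: "\<lbrakk>Z \<in> Obj G; a \<in> hom2 G f g\<rbrakk> \<Longrightarrow> Z \<otimes>\<^sub>L\<^sub>2 a \<in> hom2 G (Z \<otimes>\<^sub>L f) (Z \<otimes>\<^sub>L g)"
    and lact2_id: "\<lbrakk>Z \<in> Obj G; f \<in> Arr G\<rbrakk> \<Longrightarrow> Z \<otimes>\<^sub>L\<^sub>2 id2 G f = id2 G (Z \<otimes>\<^sub>L f)"
    and lact2_vcomp: "\<lbrakk>Z \<in> Obj G; a \<in> hom2 G f g; b \<in> hom2 G g h\<rbrakk> \<Longrightarrow>
      Z \<otimes>\<^sub>L\<^sub>2 (b \<bullet> a) = (Z \<otimes>\<^sub>L\<^sub>2 b) \<bullet> (Z \<otimes>\<^sub>L\<^sub>2 a)"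
    and lact2_hcomp: "\<lbrakk>Z \<in> Obj G; a \<in> hom2 G f f'; b \<in> hom2 G g g'; cod G f = dom G g\<rbrakk> \<Longrightarrow>
      Z \<otimes>\<^sub>L\<^sub>2 (b \<star> a) = (Z \<otimes>\<^sub>L\<^sub>2 b) \<star> (Z \<otimes>\<^sub>L\<^sub>2 a)"
    and ract1_hom: "\<lbrakk>Z \<in> Obj G; f \<in> hom1 G X Y\<rbrakk> \<Longrightarrow> f \<otimes>\<^sub>R Z \<in> hom1 G (X \<otimes>\<^sub>0 Z) (Y \<otimes>\<^sub>0 Z)"
    and ract1_id: "\<lbrakk>Z \<in> Obj G; X \<in> Obj G\<rbrakk> \<Longrightarrow> id1 G X \<otimes>\<^sub>R Z = id1 G (X \<otimes>\<^sub>0 Z)"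
    and ract1_comp: "\<lbrakk>Z \<in> Obj G; f \<in> hom1 G W X; g \<in> hom1 G X Y\<rbrakk> \<Longrightarrow>
      (g \<cdot> f) \<otimes>\<^sub>R Z = (g \<otimes>\<^sub>R Z) \<cdot> (f \<otimes>\<^sub>R Z)"
    and ract2_hom: "\<lbrakk>Z \<in> Obj G; a \<in> hom2 G f g\<rbrakk> \<Longrightarrow> a \<otimes>\<^sub>R\<^sub>2 Z \<in> hom2 G (f \<otimes>\<^sub>R Z) (g \<otimes>\<^sub>R Z)"
    and ract2_id: "\<lbrakk>Z \<in> Obj G; f \<in> Arr G\<rbrakk> \<Longrightarrow> id2 G f \<otimes>\<^sub>R\<^sub>2 Z = id2 G (f \<otimes>\<^sub>R Z)"
    and ract2_vcomp: "\<lbrakk>Z \<in> Obj G; a \<in> hom2 G f g; b \<in> hom2 G g h\<rbrakk> \<Longrightarrow>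
      (b \<bullet> a) \<otimes>\<^sub>R\<^sub>2 Z = (b \<otimes>\<^sub>R\<^sub>2 Z) \<bullet> (a \<otimes>\<^sub>R\<^sub>2 Z)"
    and ract2_hcomp: "\<lbrakk>Z \<in> Obj G; a \<in> hom2 G f f'; b \<in> hom2 G g g'; cod G f = dom G g\<rbrakk> \<Longrightarrow>
      (b \<star> a) \<otimes>\<^sub>R\<^sub>2 Z = (b \<otimes>\<^sub>R\<^sub>2 Z) \<star> (a \<otimes>\<^sub>R\<^sub>2 Z)"
    and act1_unit: "f \<in> Arr G \<Longrightarrow> unit_obj G \<otimes>\<^sub>L f = f \<and> f \<otimes>\<^sub>R unit_obj G = f"
    and act2_unit: "a \<in> Cell G \<Longrightarrow> unit_obj G \<otimes>\<^sub>L\<^sub>2 a = a \<and> a \<otimes>\<^sub>R\<^sub>2 unit_obj G = a"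
    and act1_assoc: "\<lbrakk>X \<in> Obj G; Y \<in> Obj G; f \<in> Arr G\<rbrakk> \<Longrightarrow>
      (X \<otimes>\<^sub>0 Y) \<otimes>\<^sub>L f = X \<otimes>\<^sub>L (Y \<otimes>\<^sub>L f) \<and> f \<otimes>\<^sub>R (X \<otimes>\<^sub>0 Y) = (f \<otimes>\<^sub>R X) \<otimes>\<^sub>R Y \<and>
      X \<otimes>\<^sub>L (f \<otimes>\<^sub>R Y) = (X \<otimes>\<^sub>L f) \<otimes>\<^sub>R Y"
    and act2_assoc: "\<lbrakk>X \<in> Obj G; Y \<in> Obj G; a \<in> Cell G\<rbrakk> \<Longrightarrow>
      (X \<otimes>\<^sub>0 Y) \<otimes>\<^sub>L\<^sub>2 a = X \<otimes>\<^sub>L\<^sub>2 (Y \<otimes>\<^sub>L\<^sub>2 a) \<and> a \<otimes>\<^sub>R\<^sub>2 (X \<otimes>\<^sub>0 Y) = (a \<otimes>\<^sub>R\<^sub>2 X) \<otimes>\<^sub>R\<^sub>2 Y \<and>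
      X \<otimes>\<^sub>L\<^sub>2 (a \<otimes>\<^sub>R\<^sub>2 Y) = (X \<otimes>\<^sub>L\<^sub>2 a) \<otimes>\<^sub>R\<^sub>2 Y"
    and gi_iso: "\<lbrakk>f \<in> hom1 G A A'; g \<in> hom1 G B B'\<rbrakk> \<Longrightarrow>
      gi G f g \<in> iso2 G ((A' \<otimes>\<^sub>L g) \<cdot> (f \<otimes>\<^sub>R B)) ((f \<otimes>\<^sub>R B') \<cdot> (A \<otimes>\<^sub>L g))"
    and gi_natural: "\<lbrakk>f \<in> hom1 G A A'; g \<in> hom1 G B B'; a \<in> hom2 G f f'; b \<in> hom2 G g g'\<rbrakk> \<Longrightarrow>
      gi G f' g' \<bullet> ((A' \<otimes>\<^sub>L\<^sub>2 b) \<star> (a \<otimes>\<^sub>R\<^sub>2 B)) = ((a \<otimes>\<^sub>R\<^sub>2 B') \<star> (A \<otimes>\<^sub>L\<^sub>2 b)) \<bullet> gi G f g"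
    and gi_id: "\<lbrakk>X \<in> Obj G; f \<in> Arr G\<rbrakk> \<Longrightarrow>
      gi G (id1 G X) f = id2 G (X \<otimes>\<^sub>L f) \<and> gi G f (id1 G X) = id2 G (f \<otimes>\<^sub>R X)"
    and gi_comp_left: "\<lbrakk>f \<in> hom1 G A A'; f' \<in> hom1 G A' A''; g \<in> hom1 G B B'\<rbrakk> \<Longrightarrow>
      gi G (f' \<cdot> f) g = ((f' \<otimes>\<^sub>R B') \<rhd> gi G f g) \<bullet> (gi G f' g \<lhd> (f \<otimes>\<^sub>R B))"
    and gi_comp_right: "\<lbrakk>f \<in> hom1 G A A'; g \<in> hom1 G B B'; g' \<in> hom1 G B' B''\<rbrakk> \<Longrightarrow>
      gi G f (g' \<cdot> g) = (gi G f g' \<lhd> (A \<otimes>\<^sub>L g)) \<bullet> ((A' \<otimes>\<^sub>L g') \<rhd> gi G f g)"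
    and gi_act: "\<lbrakk>X \<in> Obj G; f \<in> Arr G; g \<in> Arr G\<rbrakk> \<Longrightarrow>
      gi G (X \<otimes>\<^sub>L f) g = X \<otimes>\<^sub>L\<^sub>2 gi G f g \<and> gi G (f \<otimes>\<^sub>R X) g = gi G f (X \<otimes>\<^sub>L g) \<and>
      gi G f (g \<otimes>\<^sub>R X) = gi G f g \<otimes>\<^sub>R\<^sub>2 X"

definition tens1 :: "('o, 'm, 'c) gray \<Rightarrow> 'm \<Rightarrow> 'm \<Rightarrow> 'm" (infixl \<open>\<otimes>\<^sub>1\<index>\<close> 75)
  where "f \<otimes>\<^sub>1 g = (cod G f \<otimes>\<^sub>L g) \<cdot> (f \<otimes>\<^sub>R dom G g)"
  for G (structure)

definition tens2 :: "('o, 'm, 'c) gray \<Rightarrow> 'c \<Rightarrow> 'c \<Rightarrow> 'c" (infixl \<open>\<otimes>\<^sub>2\<index>\<close> 75)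
  where "a \<otimes>\<^sub>2 b = (cod G (src G a) \<otimes>\<^sub>L\<^sub>2 b) \<star> (a \<otimes>\<^sub>R\<^sub>2 dom G (src G b))"
  for G (structure)

text \<open>\<open>tcomp f' g' f g : (f' \<otimes> g') \<cdot> (f \<otimes> g) \<Rightarrow> (f' \<cdot> f) \<otimes> (g' \<cdot> g)\<close>,
  the invertible comparison induced by the interchange cell of \<open>f'\<close> and \<open>g\<close>.\<close>

definition tcomp :: "('o, 'm, 'c) gray \<Rightarrow> 'm \<Rightarrow> 'm \<Rightarrow> 'm \<Rightarrow> 'm \<Rightarrow> 'c"
  where "tcomp G f' g' f g =
    (cod G f' \<otimes>\<^sub>L g') \<rhd> vinv G (gi G f' g) \<lhd> (f \<otimes>\<^sub>R dom G g)"
  for G (structure)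

definition reverse :: "('o, 'm, 'c) gray \<Rightarrow> ('o, 'm, 'c) gray"
  where "reverse G = G\<lparr>
    tens0 := \<lambda>X Y. tens0 G Y X,
    lact1 := \<lambda>X f. ract1 G f X,
    ract1 := \<lambda>f X. lact1 G X f,
    lact2 := \<lambda>X a. ract2 G a X,
    ract2 := \<lambda>a X. lact2 G X a,
    gi := \<lambda>f g. vinv G (gi G g f)\<rparr>"


section \<open>Pseudomonoids and monoidal 1-cells\<close>

text \<open>\<open>pa : m (m \<otimes> B) \<Rightarrow> m (B \<otimes> m)\<close>, \<open>pl : m (u \<otimes> B) \<Rightarrow> id\<close>, \<open>pr : m (B \<otimes> u) \<Rightarrow> id\<close>.\<close>

record ('o, 'm, 'c) pmon =
  ob :: 'o
  mul :: 'm
  uni :: 'm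
  pa :: 'c
  pl :: 'c
  pr :: 'c

definition pseudomonoid :: "('o, 'm, 'c) gray \<Rightarrow> ('o, 'm, 'c) pmon \<Rightarrow> bool"
  where "pseudomonoid G P \<longleftrightarrow> (let B = ob P; m = mul P; u = uni P; \<alpha> = pa P in
    B \<in> Obj G \<and> m \<in> hom1 G (B \<otimes>\<^sub>0 B) B \<and> u \<in> hom1 G (unit_obj G) B \<and>
    \<alpha> \<in> iso2 G (m \<cdot> (m \<otimes>\<^sub>R B)) (m \<cdot> (B \<otimes>\<^sub>L m)) \<and>
    pl P \<in> iso2 G (m \<cdot> (u \<otimes>\<^sub>R B)) (id1 G B) \<and>
    pr P \<in> iso2 G (m \<cdot> (B \<otimes>\<^sub>L u)) (id1 G B) \<and>
    (\<alpha> \<lhd> ((B \<otimes>\<^sub>0 B) \<otimes>\<^sub>L m)) \<bullet> (m \<rhd> gi G m m) \<bullet> (\<alpha> \<lhd> (m \<otimes>\<^sub>R (B \<otimes>\<^sub>0 B))) =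
      (m \<rhd> (B \<otimes>\<^sub>L\<^sub>2 \<alpha>)) \<bullet> (\<alpha> \<lhd> (B \<otimes>\<^sub>L (m \<otimes>\<^sub>R B))) \<bullet> (m \<rhd> (\<alpha> \<otimes>\<^sub>R\<^sub>2 B)) \<and>
    (m \<rhd> (B \<otimes>\<^sub>L\<^sub>2 pl P)) \<bullet> (\<alpha> \<lhd> (B \<otimes>\<^sub>L (u \<otimes>\<^sub>R B))) = m \<rhd> (pr P \<otimes>\<^sub>R\<^sub>2 B))"
  for G (structure)

definition map_pseudomonoid :: "('o, 'm, 'c) gray \<Rightarrow> ('o, 'm, 'c) pmon \<Rightarrow> bool"
  where "map_pseudomonoid G P \<longleftrightarrow> pseudomonoid G P \<and>
    is_map G (tens0 G (ob P) (ob P)) (ob P) (mul P) \<and> is_map G (unit_obj G) (ob P) (uni P)"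

definition reverse_pmon ::
    "('o, 'm, 'c) gray \<Rightarrow> ('o, 'm, 'c) pmon \<Rightarrow> ('o, 'm, 'c) pmon"
  where "reverse_pmon G P = P\<lparr>pa := vinv G (pa P), pl := pr P, pr := pl P\<rparr>"

text \<open>\<open>(f, \<phi>, \<phi>\<^sub>0) : P \<rightarrow> Q\<close> with \<open>\<phi> : m\<^sub>Q (f \<otimes> f) \<Rightarrow> f m\<^sub>P\<close> and \<open>\<phi>\<^sub>0 : u\<^sub>Q \<Rightarrow> f u\<^sub>P\<close>.\<close>

definition lax_monoidal ::
    "('o, 'm, 'c) gray \<Rightarrow> ('o, 'm, 'c) pmon \<Rightarrow> ('o, 'm, 'c) pmon \<Rightarrow> 'm \<Rightarrow> 'c \<Rightarrow> 'c \<Rightarrow> bool"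
  where "lax_monoidal G P Q f \<phi> \<phi>\<^sub>0 \<longleftrightarrow>
    (let I = unit_obj G; A = ob P; p = mul P; j = uni P; B = ob Q; m = mul Q; u = uni Q in
    f \<in> hom1 G A B \<and>
    \<phi> \<in> hom2 G (m \<cdot> (f \<otimes>\<^sub>1 f)) (f \<cdot> p) \<and>
    \<phi>\<^sub>0 \<in> hom2 G u (f \<cdot> j) \<and>
    (f \<rhd> pa P) \<bullet> (\<phi> \<lhd> (p \<otimes>\<^sub>R A)) \<bullet> (m \<rhd> vinv G (tcomp G f f p (id1 G A)))
        \<bullet> (m \<rhd> (\<phi> \<otimes>\<^sub>2 id2 G f)) \<bullet> (m \<rhd> tcomp G m (id1 G B) (f \<otimes>\<^sub>1 f) f) =
      (\<phi> \<lhd> (A \<otimes>\<^sub>L p)) \<bullet> (m \<rhd> vinv G (tcomp G f f (id1 G A) p))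
        \<bullet> (m \<rhd> (id2 G f \<otimes>\<^sub>2 \<phi>)) \<bullet> (m \<rhd> tcomp G (id1 G B) m f (f \<otimes>\<^sub>1 f))
        \<bullet> (pa Q \<lhd> (f \<otimes>\<^sub>1 f \<otimes>\<^sub>1 f)) \<and>
    (f \<rhd> pl P) \<bullet> (\<phi> \<lhd> (j \<otimes>\<^sub>R A)) \<bullet> (m \<rhd> vinv G (tcomp G f f j (id1 G A)))
        \<bullet> (m \<rhd> (\<phi>\<^sub>0 \<otimes>\<^sub>2 id2 G f)) \<bullet> (m \<rhd> tcomp G u (id1 G B) (id1 G I) f) = pl Q \<lhd> f \<and>
    (f \<rhd> pr P) \<bullet> (\<phi> \<lhd> (A \<otimes>\<^sub>L j)) \<bullet> (m \<rhd> vinv G (tcomp G f f (id1 G A) j))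
        \<bullet> (m \<rhd> (id2 G f \<otimes>\<^sub>2 \<phi>\<^sub>0)) \<bullet> (m \<rhd> tcomp G (id1 G B) u f (id1 G I)) = pr Q \<lhd> f)"
  for G (structure)

text \<open>Structure 2-cells of a composite \<open>g \<cdot> f : P \<rightarrow> Q \<rightarrow> R\<close> of monoidal 1-cells.\<close>

definition comp_mult ::
    "('o, 'm, 'c) gray \<Rightarrow> ('o, 'm, 'c) pmon \<Rightarrow> 'm \<Rightarrow> 'c \<Rightarrow> 'm \<Rightarrow> 'c \<Rightarrow> 'c"
  where "comp_mult G R g \<gamma> f \<phi> =
    (g \<rhd> \<phi>) \<bullet> (\<gamma> \<lhd> (f \<otimes>\<^sub>1 f)) \<bullet> (mul R \<rhd> vinv G (tcomp G g g f f))"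
  for G (structure)

definition comp_unit :: "('o, 'm, 'c) gray \<Rightarrow> 'm \<Rightarrow> 'c \<Rightarrow> 'c \<Rightarrow> 'c"
  where "comp_unit G g \<gamma>\<^sub>0 \<phi>\<^sub>0 = (g \<rhd> \<phi>\<^sub>0) \<bullet> \<gamma>\<^sub>0"
  for G (structure)

definition monoidal_cell ::
    "('o, 'm, 'c) gray \<Rightarrow> ('o, 'm, 'c) pmon \<Rightarrow> ('o, 'm, 'c) pmon \<Rightarrow>
      'm \<Rightarrow> 'c \<Rightarrow> 'c \<Rightarrow> 'm \<Rightarrow> 'c \<Rightarrow> 'c \<Rightarrow> 'c \<Rightarrow> bool"
  where "monoidal_cell G P Q f \<phi> \<phi>\<^sub>0 g \<gamma> \<gamma>\<^sub>0 \<sigma> \<longleftrightarrow>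
    \<sigma> \<in> hom2 G f g \<and>
    \<gamma> \<bullet> (mul Q \<rhd> (\<sigma> \<otimes>\<^sub>2 \<sigma>)) = (\<sigma> \<lhd> mul P) \<bullet> \<phi> \<and>
    \<gamma>\<^sub>0 = (\<sigma> \<lhd> uni P) \<bullet> \<phi>\<^sub>0"
  for G (structure)


section \<open>The lax slice and autonomous pseudomonoids\<close>

text \<open>The lax slice over the underlying object of a pseudomonoid \<open>P\<close>. Its objects are the 1-cells
  into \<open>ob P\<close>, its 1-cells \<open>f \<rightarrow> f'\<close> are pairs \<open>(a, \<alpha>)\<close> with \<open>\<alpha> : f' a \<Rightarrow> f\<close>.\<close>

definition slice_obj :: "('o, 'm, 'c) gray \<Rightarrow> ('o, 'm, 'c) pmon \<Rightarrow> 'm set"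
  where "slice_obj G P = {f \<in> Arr G. cod G f = ob P}"

definition slice_hom1 :: "('o, 'm, 'c) gray \<Rightarrow> 'm \<Rightarrow> 'm \<Rightarrow> ('m \<times> 'c) set"
  where "slice_hom1 G f f' =
    {(a, \<alpha>). a \<in> hom1 G (dom G f) (dom G f') \<and> \<alpha> \<in> hom2 G (f' \<cdot> a) f}"
  for G (structure)

definition slice_hom2 :: "('o, 'm, 'c) gray \<Rightarrow> 'm \<Rightarrow> 'm \<times> 'c \<Rightarrow> 'm \<times> 'c \<Rightarrow> 'c set"
  where "slice_hom2 G f' s t =
    {\<phi> \<in> hom2 G (fst s) (fst t). snd t \<bullet> (f' \<rhd> \<phi>) = snd s}"
  for G (structure)

definition slice_id :: "('o, 'm, 'c) gray \<Rightarrow> 'm \<Rightarrow> 'm \<times> 'c"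
  where "slice_id G f = (id1 G (dom G f), id2 G f)"

definition slice_comp :: "('o, 'm, 'c) gray \<Rightarrow> 'm \<times> 'c \<Rightarrow> 'm \<times> 'c \<Rightarrow> 'm \<times> 'c"
  where "slice_comp G t s = (fst t \<cdot> fst s, snd s \<bullet> (snd t \<lhd> fst s))"
  for G (structure)

definition slice_tens0 :: "('o, 'm, 'c) gray \<Rightarrow> ('o, 'm, 'c) pmon \<Rightarrow> 'm \<Rightarrow> 'm \<Rightarrow> 'm"
  where "slice_tens0 G P f g = mul P \<cdot> (f \<otimes>\<^sub>1 g)"
  for G (structure)

text \<open>\<open>slice_tens1 G P f' g' s t\<close> is the tensor of \<open>s : f \<rightarrow> f'\<close> and \<open>t : g \<rightarrow> g'\<close>.\<close>

definition slice_tens1 ::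
    "('o, 'm, 'c) gray \<Rightarrow> ('o, 'm, 'c) pmon \<Rightarrow> 'm \<Rightarrow> 'm \<Rightarrow> 'm \<times> 'c \<Rightarrow> 'm \<times> 'c \<Rightarrow> 'm \<times> 'c"
  where "slice_tens1 G P f' g' s t =
    (fst s \<otimes>\<^sub>1 fst t,
     (mul P \<rhd> (snd s \<otimes>\<^sub>2 snd t)) \<bullet> (mul P \<rhd> tcomp G f' g' (fst s) (fst t)))"
  for G (structure)

text \<open>2-cell parts of the coherence 1-cells, whose underlying 1-cells are identities. Being a 1-cell
  of the lax slice, \<open>(f\<bullet>g)\<bullet>h \<rightarrow> f\<bullet>(g\<bullet>h)\<close> is given by a 2-cell
  \<open>m (f \<otimes> m (g \<otimes> h)) \<Rightarrow> m (m (f \<otimes> g) \<otimes> h)\<close>, and similarly for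
  \<open>u\<bullet>f \<rightarrow> f\<close> and \<open>f\<bullet>u \<rightarrow> f\<close>.\<close>

definition assoc_cell :: "('o, 'm, 'c) gray \<Rightarrow> ('o, 'm, 'c) pmon \<Rightarrow> 'm \<Rightarrow> 'm \<Rightarrow> 'm \<Rightarrow> 'c"
  where "assoc_cell G P f g h = (let m = mul P; i = id1 G (ob P) in
    (m \<rhd> tcomp G m i (f \<otimes>\<^sub>1 g) h) \<bullet> (vinv G (pa P) \<lhd> (f \<otimes>\<^sub>1 g \<otimes>\<^sub>1 h))
      \<bullet> (m \<rhd> vinv G (tcomp G i m f (g \<otimes>\<^sub>1 h))))"
  for G (structure)

definition lunit_cell :: "('o, 'm, 'c) gray \<Rightarrow> ('o, 'm, 'c) pmon \<Rightarrow> 'm \<Rightarrow> 'c"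
  where "lunit_cell G P f =
    (mul P \<rhd> tcomp G (uni P) (id1 G (ob P)) (id1 G (unit_obj G)) f) \<bullet> (vinv G (pl P) \<lhd> f)"
  for G (structure)

definition runit_cell :: "('o, 'm, 'c) gray \<Rightarrow> ('o, 'm, 'c) pmon \<Rightarrow> 'm \<Rightarrow> 'c"
  where "runit_cell G P f =
    (mul P \<rhd> tcomp G (id1 G (ob P)) (uni P) f (id1 G (unit_obj G))) \<bullet> (vinv G (pr P) \<lhd> f)"
  for G (structure)

definition slice_assoc :: "('o, 'm, 'c) gray \<Rightarrow> ('o, 'm, 'c) pmon \<Rightarrow> 'm \<Rightarrow> 'm \<Rightarrow> 'm \<Rightarrow> 'm \<times> 'c"
  where "slice_assoc G P f g h =
    (id1 G (dom G f \<otimes>\<^sub>0 dom G g \<otimes>\<^sub>0 dom G h), assoc_cell G P f g h)"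
  for G (structure)

definition slice_assoc_inv :: "('o, 'm, 'c) gray \<Rightarrow> ('o, 'm, 'c) pmon \<Rightarrow> 'm \<Rightarrow> 'm \<Rightarrow> 'm \<Rightarrow> 'm \<times> 'c"
  where "slice_assoc_inv G P f g h =
    (id1 G (dom G f \<otimes>\<^sub>0 dom G g \<otimes>\<^sub>0 dom G h), vinv G (assoc_cell G P f g h))"
  for G (structure)

definition slice_lunit :: "('o, 'm, 'c) gray \<Rightarrow> ('o, 'm, 'c) pmon \<Rightarrow> 'm \<Rightarrow> 'm \<times> 'c"
  where "slice_lunit G P f = (id1 G (dom G f), lunit_cell G P f)"

definition slice_lunit_inv :: "('o, 'm, 'c) gray \<Rightarrow> ('o, 'm, 'c) pmon \<Rightarrow> 'm \<Rightarrow> 'm \<times> 'c"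
  where "slice_lunit_inv G P f = (id1 G (dom G f), vinv G (lunit_cell G P f))"

definition slice_runit :: "('o, 'm, 'c) gray \<Rightarrow> ('o, 'm, 'c) pmon \<Rightarrow> 'm \<Rightarrow> 'm \<times> 'c"
  where "slice_runit G P f = (id1 G (dom G f), runit_cell G P f)"

definition slice_runit_inv :: "('o, 'm, 'c) gray \<Rightarrow> ('o, 'm, 'c) pmon \<Rightarrow> 'm \<Rightarrow> 'm \<times> 'c"
  where "slice_runit_inv G P f = (id1 G (dom G f), vinv G (runit_cell G P f))"

text \<open>The composites \<open>Ye \<cdot> nY : y \<rightarrow> u\<bullet>y \<rightarrow> (y\<bullet>x)\<bullet>y \<rightarrow> y\<bullet>(x\<bullet>y) \<rightarrow> y\<bullet>u \<rightarrow> y\<close> and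
  \<open>eX \<cdot> Xn : x \<rightarrow> x\<bullet>u \<rightarrow> x\<bullet>(y\<bullet>x) \<rightarrow> (x\<bullet>y)\<bullet>x \<rightarrow> u\<bullet>x \<rightarrow> x\<close> in the lax slice, for
  \<open>n : u \<rightarrow> y\<bullet>x\<close> and \<open>e : x\<bullet>y \<rightarrow> u\<close>.\<close>

definition snake_y ::
    "('o, 'm, 'c) gray \<Rightarrow> ('o, 'm, 'c) pmon \<Rightarrow> 'm \<Rightarrow> 'm \<Rightarrow> 'm \<times> 'c \<Rightarrow> 'm \<times> 'c \<Rightarrow> 'm \<times> 'c"
  where "snake_y G P x y n e =
    slice_comp G (slice_runit G P y)
     (slice_comp G (slice_tens1 G P y (uni P) (slice_id G y) e)
      (slice_comp G (slice_assoc G P y x y)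
       (slice_comp G (slice_tens1 G P (slice_tens0 G P y x) y n (slice_id G y))
        (slice_lunit_inv G P y))))"

definition snake_x ::
    "('o, 'm, 'c) gray \<Rightarrow> ('o, 'm, 'c) pmon \<Rightarrow> 'm \<Rightarrow> 'm \<Rightarrow> 'm \<times> 'c \<Rightarrow> 'm \<times> 'c \<Rightarrow> 'm \<times> 'c"
  where "snake_x G P x y n e =
    slice_comp G (slice_lunit G P x)
     (slice_comp G (slice_tens1 G P (uni P) x e (slice_id G x))
      (slice_comp G (slice_assoc_inv G P x y x)
       (slice_comp G (slice_tens1 G P x (slice_tens0 G P y x) (slice_id G x) n)
        (slice_runit_inv G P x))))"

text \<open>The swallowtail equations for \<open>n : I \<rightarrow> Y \<otimes> X\<close>, \<open>e : X \<otimes> Y \<rightarrow> I\<close>,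
  \<open>\<theta> : id_Y \<Rightarrow> Ye \<cdot> nY\<close>, \<open>\<zeta> : eX \<cdot> Xn \<Rightarrow> id_X\<close>.\<close>

definition swallowtails :: "('o, 'm, 'c) gray \<Rightarrow> 'o \<Rightarrow> 'o \<Rightarrow> 'm \<Rightarrow> 'm \<Rightarrow> 'c \<Rightarrow> 'c \<Rightarrow> bool"
  where "swallowtails G X Y n e \<theta> \<zeta> \<longleftrightarrow>
    (e \<rhd> (\<zeta> \<otimes>\<^sub>R\<^sub>2 Y)) \<bullet> (vinv G (gi G e e) \<lhd> (X \<otimes>\<^sub>L (n \<otimes>\<^sub>R Y))) \<bullet> (e \<rhd> (X \<otimes>\<^sub>L\<^sub>2 \<theta>)) = id2 G e \<and>
    ((Y \<otimes>\<^sub>L\<^sub>2 \<zeta>) \<lhd> n) \<bullet> ((Y \<otimes>\<^sub>L (e \<otimes>\<^sub>R X)) \<rhd> vinv G (gi G n n)) \<bullet> ((\<theta> \<otimes>\<^sub>R\<^sub>2 X) \<lhd> n) = id2 G n"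
  for G (structure)

text \<open>A right bidual \<open>y : Y \<rightarrow> B\<close> of \<open>x : X \<rightarrow> B\<close> in the lax slice. The swallowtail equations are
  equations between 2-cells of the slice, which are 2-cells of \<open>G\<close> and compose as such; as the
  coherence 1-cells have identity underlying 1-cells, the coherence 2-cells entering them are the
  interchange cells of \<open>G\<close>. So the equations are those in \<open>G\<close>.\<close>

definition slice_right_bidual :: "('o, 'm, 'c) gray \<Rightarrow> ('o, 'm, 'c) pmon \<Rightarrow> 'm \<Rightarrow> 'm \<Rightarrow> bool"
  where "slice_right_bidual G P x y \<longleftrightarrow>
    x \<in> slice_obj G P \<and> y \<in> slice_obj G P \<and>
    (\<exists>n e \<theta> \<zeta>.
      n \<in> slice_hom1 G (uni P) (slice_tens0 G P y x) \<and>
      e \<in> slice_hom1 G (slice_tens0 G P x y) (uni P) \<and>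
      \<theta> \<in> slice_hom2 G y (slice_id G y) (snake_y G P x y n e) \<and> invertible G \<theta> \<and>
      \<zeta> \<in> slice_hom2 G x (snake_x G P x y n e) (slice_id G x) \<and> invertible G \<zeta> \<and>
      swallowtails G (dom G x) (dom G y) (fst n) (fst e) \<theta> \<zeta>)"

definition left_autonomous :: "('o, 'm, 'c) gray \<Rightarrow> ('o, 'm, 'c) pmon \<Rightarrow> bool"
  where "left_autonomous G P \<longleftrightarrow> (\<exists>d. slice_right_bidual G P (id1 G (ob P)) d)"

definition right_autonomous :: "('o, 'm, 'c) gray \<Rightarrow> ('o, 'm, 'c) pmon \<Rightarrow> bool"
  where "right_autonomous G P \<longleftrightarrow> left_autonomous (reverse G) (reverse_pmon G P)"

definition autonomous :: "('o, 'm, 'c) gray \<Rightarrow> ('o, 'm, 'c) pmon \<Rightarrow> bool"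
  where "autonomous G P \<longleftrightarrow> left_autonomous G P \<and> right_autonomous G P"


section \<open>Strong monoidal maps and Hopf monoidal comonads\<close>

record ('m, 'c) monoidal_map =
  arr :: 'm
  radj :: 'm
  adj_unit :: 'c
  adj_counit :: 'c
  psi :: 'c
  psi0 :: 'c

definition strong_monoidal_map ::
    "('o, 'm, 'c) gray \<Rightarrow> ('o, 'm, 'c) pmon \<Rightarrow> ('o, 'm, 'c) pmon \<Rightarrow> ('m, 'c) monoidal_map \<Rightarrow> bool"
  where "strong_monoidal_map G P Q w \<longleftrightarrow>
    adjunction G (ob P) (ob Q) (arr w) (radj w) (adj_unit w) (adj_counit w) \<and>
    lax_monoidal G P Q (arr w) (psi w) (psi0 w) \<and>
    invertible G (psi w) \<and> invertible G (psi0 w)"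

text \<open>The monoidal structure on the right adjoint, formed by the mates of the inverses of
  \<open>psi\<close> and \<open>psi0\<close>; the counit of \<open>w \<otimes> w \<stileturn> r \<otimes> r\<close> is \<open>(\<epsilon> \<otimes> \<epsilon>) \<bullet> tcomp w w r r\<close>.\<close>

definition radj_mult ::
    "('o, 'm, 'c) gray \<Rightarrow> ('o, 'm, 'c) pmon \<Rightarrow> ('o, 'm, 'c) pmon \<Rightarrow> ('m, 'c) monoidal_map \<Rightarrow> 'c"
  where "radj_mult G P Q W = (let w = arr W; r = radj W; \<epsilon> = adj_counit W; m = mul Q in
    (r \<cdot> m \<rhd> (\<epsilon> \<otimes>\<^sub>2 \<epsilon>)) \<bullet> (r \<cdot> m \<rhd> tcomp G w w r r)
      \<bullet> (r \<rhd> vinv G (psi W) \<lhd> (r \<otimes>\<^sub>1 r)) \<bullet> (adj_unit W \<lhd> mul P \<cdot> (r \<otimes>\<^sub>1 r)))"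
  for G (structure)

definition radj_unit ::
    "('o, 'm, 'c) gray \<Rightarrow> ('o, 'm, 'c) pmon \<Rightarrow> ('m, 'c) monoidal_map \<Rightarrow> 'c"
  where "radj_unit G P W = (radj W \<rhd> vinv G (psi0 W)) \<bullet> (adj_unit W \<lhd> uni P)"
  for G (structure)

record ('m, 'c) comonad_data =
  carr :: 'm
  cdelta :: 'c
  ccounit :: 'c
  cphi :: 'c
  cphi0 :: 'c

definition induced_comonad ::
    "('o, 'm, 'c) gray \<Rightarrow> ('o, 'm, 'c) pmon \<Rightarrow> ('o, 'm, 'c) pmon \<Rightarrow> ('m, 'c) monoidal_map \<Rightarrow>
      ('m, 'c) comonad_data"
  where "induced_comonad G P Q W = \<lparr>
    carr = arr W \<cdot> radj W,
    cdelta = arr W \<rhd> adj_unit W \<lhd> radj W,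
    ccounit = adj_counit W,
    cphi = comp_mult G Q (arr W) (psi W) (radj W) (radj_mult G P Q W),
    cphi0 = comp_unit G (arr W) (psi0 W) (radj_unit G P W)\<rparr>"
  for G (structure)

definition comonad :: "('o, 'm, 'c) gray \<Rightarrow> 'o \<Rightarrow> 'm \<Rightarrow> 'c \<Rightarrow> 'c \<Rightarrow> bool"
  where "comonad G B c \<delta> \<epsilon> \<longleftrightarrow>
    c \<in> hom1 G B B \<and> \<delta> \<in> hom2 G c (c \<cdot> c) \<and> \<epsilon> \<in> hom2 G c (id1 G B) \<and>
    (c \<rhd> \<delta>) \<bullet> \<delta> = (\<delta> \<lhd> c) \<bullet> \<delta> \<and>
    (c \<rhd> \<epsilon>) \<bullet> \<delta> = id2 G c \<and> (\<epsilon> \<lhd> c) \<bullet> \<delta> = id2 G c"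
  for G (structure)

definition monoidal_comonad ::
    "('o, 'm, 'c) gray \<Rightarrow> ('o, 'm, 'c) pmon \<Rightarrow> ('m, 'c) comonad_data \<Rightarrow> bool"
  where "monoidal_comonad G P T \<longleftrightarrow>
    (let c = carr T; \<delta> = cdelta T; \<epsilon> = ccounit T; \<phi> = cphi T; \<phi>\<^sub>0 = cphi0 T in
    comonad G (ob P) c \<delta> \<epsilon> \<and>
    lax_monoidal G P P c \<phi> \<phi>\<^sub>0 \<and>
    monoidal_cell G P P c \<phi> \<phi>\<^sub>0 (c \<cdot> c) (comp_mult G P c \<phi> c \<phi>) (comp_unit G c \<phi>\<^sub>0 \<phi>\<^sub>0) \<delta> \<and>
    monoidal_cell G P P c \<phi> \<phi>\<^sub>0 (id1 G (ob P)) (id2 G (mul P)) (id2 G (uni P)) \<epsilon>)"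
  for G (structure)

definition fusion_1 ::
    "('o, 'm, 'c) gray \<Rightarrow> ('o, 'm, 'c) pmon \<Rightarrow> ('m, 'c) comonad_data \<Rightarrow> 'c"
  where "fusion_1 G P T = (let B = ob P; m = mul P; c = carr T in
    (cphi T \<lhd> (id1 G B \<otimes>\<^sub>1 c)) \<bullet> (m \<rhd> vinv G (tcomp G c c (id1 G B) c))
      \<bullet> (m \<rhd> (id2 G c \<otimes>\<^sub>2 cdelta T)))"
  for G (structure)

definition fusion_2 ::
    "('o, 'm, 'c) gray \<Rightarrow> ('o, 'm, 'c) pmon \<Rightarrow> ('m, 'c) comonad_data \<Rightarrow> 'c"
  where "fusion_2 G P T = (let B = ob P; m = mul P; c = carr T in
    (cphi T \<lhd> (c \<otimes>\<^sub>1 id1 G B)) \<bullet> (m \<rhd> vinv G (tcomp G c c c (id1 G B)))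
      \<bullet> (m \<rhd> (cdelta T \<otimes>\<^sub>2 id2 G c)))"
  for G (structure)

definition hopf_monoidal_comonad ::
    "('o, 'm, 'c) gray \<Rightarrow> ('o, 'm, 'c) pmon \<Rightarrow> ('m, 'c) comonad_data \<Rightarrow> bool"
  where "hopf_monoidal_comonad G P T \<longleftrightarrow>
    monoidal_comonad G P T \<and> invertible G (fusion_1 G P T) \<and> invertible G (fusion_2 G P T)"

end

theory Submission
  imports Defs
begin

text \<open>
  The 1-cells into the underlying object of a pseudomonoid \<open>P\<close> form an ordinary monoidal category with
  \<open>x \<odot> y = m (x \<otimes> y)\<close>, and a strong monoidal map \<open>w \<stileturn> r\<close> gives an adjunction between two such
  categories whose left adjoint is strong monoidal. The calculus of mates there makes \<open>w r\<close> a
  monoidal comonad, and turns its fusion 2-cells, up to invertible 2-cells, into the images under \<open>w\<close>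
  of the projection cells \<open>a \<odot> r y \<rightarrow> r (w a \<odot> y)\<close> and \<open>r x \<odot> a \<rightarrow> r (x \<odot> w a)\<close>.

  For the generic element \<open>a = 1\<^sub>A\<close> with dual \<open>d\<close>, the first projection cell has the inverse
  \<open>r (w a \<odot> y) \<rightarrow> a \<odot> (d \<odot> r (w a \<odot> y)) \<rightarrow> a \<odot> r (w d \<odot> (w a \<odot> y)) \<rightarrow> a \<odot> r y\<close>. Both identities reduce
  to the zigzag \<open>a \<rightarrow> a \<odot> (d \<odot> a) \<rightarrow> a\<close>, which is an invertible 2-cell by definition of a bidual.
  The second projection cell is the first one for the reversed Gray monoid.
\<close>

section \<open>Whiskering and invertible 2-cells\<close>

text \<open>The dual of \<open>one\<close> lives in the lax slice, not in the fibre: its unit and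
  counit are 1-cells \<open>nn : I -> dom d B\<close> and \<open>ee : B dom d -> I\<close> that
  change domains. So coevaluation and evaluation exist only after precomposition, and the zigzag at
  \<open>a = one\<close> is a 2-cell \<open>(ee B)(B nn) => one\<close>, invertible rather than an
  identity; its inverse has to be inserted into the candidate inverse of the projection cell.
  Precomposition is the obstacle that shapes the calculation: a tensor of 1-cells applies its second
  factor last, so reindexing the first factor is strict, whereas reindexing a later one must cross
  the earlier factors and costs an interchange cell. These cells are collected in
  \<open>tsplit\<close> and \<open>elt_split\<close>, whose naturality and coherence carry the
  proof. Generic elements suffice, since the fusion cells restrict from there by reindexing. The
  zigzag is needed both over \<open>B\<close>, through the action of \<open>A\<close>, and in
  \<open>A\<close> itself; the second is the first for the identity map. Under reversal
  \<open>w w\<close> becomes the other composite, so \<open>psi\<close> must be corrected by an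
  inverse interchange cell.\<close>

context two_category
begin

lemma mem_hom1: "f \<in> hom1 C X Y \<longleftrightarrow> f \<in> Arr C \<and> dom C f = X \<and> cod C f = Y"
  by (simp add: hom1_def)

lemma mem_hom2: "a \<in> hom2 C f g \<longleftrightarrow> a \<in> Cell C \<and> src C a = f \<and> trg C a = g"
  by (simp add: hom2_def)

lemma arr_objs [simp]:
  assumes "f \<in> Arr C"
  shows "dom C f \<in> Obj C" "cod C f \<in> Obj C"
  using arr_obj[of f "dom C f" "cod C f"] assms by (simp_all add: mem_hom1)

lemma cell_arrs [simp]:
  assumes "a \<in> Cell C"
  shows "src C a \<in> Arr C" "trg C a \<in> Arr C"
    "dom C (trg C a) = dom C (src C a)" "cod C (trg C a) = cod C (src C a)"
  using cell_arr[of a "src C a" "trg C a"] assms by (simp_all add: mem_hom2)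

lemma id1_simps [simp]:
  assumes "X \<in> Obj C"
  shows "id1 C X \<in> Arr C" "dom C (id1 C X) = X" "cod C (id1 C X) = X"
  using id1_hom[OF assms] by (simp_all add: mem_hom1)

lemma comp1_simps [simp]:
  assumes "f \<in> Arr C" "g \<in> Arr C" "cod C f = dom C g"
  shows "g \<cdot> f \<in> Arr C" "dom C (g \<cdot> f) = dom C f" "cod C (g \<cdot> f) = cod C g"
  using comp1_hom[of f "dom C f" "cod C f" g "cod C g"] assms by (simp_all add: mem_hom1)

lemma comp1_assoc' [simp]:
  assumes "f \<in> Arr C" "g \<in> Arr C" "h \<in> Arr C" "cod C f = dom C g" "cod C g = dom C h"
  shows "h \<cdot> g \<cdot> f = h \<cdot> (g \<cdot> f)"
  using comp1_assoc[of f "dom C f" "cod C f" g "cod C g" h "cod C h"] assms by (simp add: mem_hom1)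

lemma comp1_ids [simp]:
  assumes "f \<in> Arr C"
  shows "X = dom C f \<Longrightarrow> f \<cdot> id1 C X = f" "Y = cod C f \<Longrightarrow> id1 C Y \<cdot> f = f"
  using comp1_id[of f "dom C f" "cod C f"] assms by (simp_all add: mem_hom1)

lemma id2_simps [simp]:
  assumes "f \<in> Arr C"
  shows "id2 C f \<in> Cell C" "src C (id2 C f) = f" "trg C (id2 C f) = f"
  using id2_hom[OF assms] by (simp_all add: mem_hom2)

lemma vcomp_simps [simp]:
  assumes "a \<in> Cell C" "b \<in> Cell C" "trg C a = src C b"
  shows "b \<bullet> a \<in> Cell C" "src C (b \<bullet> a) = src C a" "trg C (b \<bullet> a) = trg C b"
  using vcomp_hom[of a "src C a" "trg C a" b "trg C b"] assms by (simp_all add: mem_hom2)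

lemma vcomp_assoc' [simp]:
  assumes "a \<in> Cell C" "b \<in> Cell C" "c \<in> Cell C" "trg C a = src C b" "trg C b = src C c"
  shows "c \<bullet> b \<bullet> a = c \<bullet> (b \<bullet> a)"
  using vcomp_assoc[of a "src C a" "trg C a" b "trg C b" c "trg C c"] assms by (simp add: mem_hom2)

lemma vcomp_ids [simp]:
  assumes "a \<in> Cell C"
  shows "f = src C a \<Longrightarrow> a \<bullet> id2 C f = a" "g = trg C a \<Longrightarrow> id2 C g \<bullet> a = a"
  using vcomp_id[of a "src C a" "trg C a"] assms by (simp_all add: mem_hom2)

lemma hcomp_simps [simp]:
  assumes "a \<in> Cell C" "b \<in> Cell C" "cod C (src C a) = dom C (src C b)"
  shows "b \<star> a \<in> Cell C" "src C (b \<star> a) = src C b \<cdot> src C a" "trg C (b \<star> a) = trg C b \<cdot> trg C a"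
  using hcomp_hom[of a "src C a" "trg C a" b "src C b" "trg C b"] assms by (simp_all add: mem_hom2)

lemma hcomp_assoc':
  assumes "a \<in> Cell C" "b \<in> Cell C" "c \<in> Cell C"
    "cod C (src C a) = dom C (src C b)" "cod C (src C b) = dom C (src C c)"
  shows "c \<star> b \<star> a = c \<star> (b \<star> a)"
  using hcomp_assoc[of a "src C a" "trg C a" b "src C b" "trg C b" c "src C c" "trg C c"] assms
  by (simp add: mem_hom2)

lemma hcomp_id2' [simp]:
  assumes "f \<in> Arr C" "g \<in> Arr C" "cod C f = dom C g"
  shows "id2 C g \<star> id2 C f = id2 C (g \<cdot> f)"
  using hcomp_id2[of f "dom C f" "cod C f" g "cod C g"] assms by (simp add: mem_hom1)

lemma interchange':
  assumes "a \<in> Cell C" "a' \<in> Cell C" "b \<in> Cell C" "b' \<in> Cell C"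
    "trg C a = src C a'" "trg C b = src C b'" "cod C (src C a) = dom C (src C b)"
  shows "(b' \<bullet> b) \<star> (a' \<bullet> a) = (b' \<star> a') \<bullet> (b \<star> a)"
  using interchange[of a "src C a" "trg C a" a' "trg C a'" b "src C b" "trg C b" b' "trg C b'"] assms
  by (simp add: mem_hom2)

lemma lwhisk_simps [simp]:
  assumes "a \<in> Cell C" "g \<in> Arr C" "cod C (src C a) = dom C g"
  shows "g \<rhd> a \<in> Cell C" "src C (g \<rhd> a) = g \<cdot> src C a" "trg C (g \<rhd> a) = g \<cdot> trg C a"
  using assms by (simp_all add: lwhisk_def)

lemma rwhisk_simps [simp]:
  assumes "a \<in> Cell C" "f \<in> Arr C" "cod C f = dom C (src C a)"
  shows "a \<lhd> f \<in> Cell C" "src C (a \<lhd> f) = src C a \<cdot> f" "trg C (a \<lhd> f) = trg C a \<cdot> f"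
  using assms by (simp_all add: rwhisk_def)

lemma whisk_id2 [simp]:
  assumes "f \<in> Arr C" "g \<in> Arr C" "cod C f = dom C g"
  shows "g \<rhd> id2 C f = id2 C (g \<cdot> f)" "id2 C g \<lhd> f = id2 C (g \<cdot> f)"
  using assms by (simp_all add: lwhisk_def rwhisk_def)

lemma whisk_id1 [simp]:
  assumes "a \<in> Cell C"
  shows "Y = cod C (src C a) \<Longrightarrow> id1 C Y \<rhd> a = a" "X = dom C (src C a) \<Longrightarrow> a \<lhd> id1 C X = a"
  using hcomp_id[of a "src C a" "trg C a"] assms by (simp_all add: lwhisk_def rwhisk_def mem_hom2)

text \<open>Together with the associativity rules these fix a normal form: composed 1-cells are
  collected on each side of a 2-cell, and vertical composites are nested to the right. What
  normalization does not see, above all interchange, is supplied by hand.\<close>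

lemma whisk_whisk [simp]:
  assumes "a \<in> Cell C" "f \<in> Arr C" "g \<in> Arr C"
  shows "\<lbrakk>cod C (src C a) = dom C f; cod C f = dom C g\<rbrakk> \<Longrightarrow> g \<rhd> f \<rhd> a = g \<cdot> f \<rhd> a"
    "\<lbrakk>cod C f = dom C (src C a); cod C g = dom C f\<rbrakk> \<Longrightarrow> a \<lhd> f \<lhd> g = a \<lhd> f \<cdot> g"
    "\<lbrakk>cod C f = dom C (src C a); cod C (src C a) = dom C g\<rbrakk> \<Longrightarrow> (g \<rhd> a) \<lhd> f = g \<rhd> a \<lhd> f"
proof -
  have *: "id2 C g \<star> (id2 C f \<star> a) = id2 C (g \<cdot> f) \<star> a"
    if "cod C (src C a) = dom C f" "cod C f = dom C g"
    using that assms hcomp_assoc'[of a "id2 C f" "id2 C g"] by simp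
  have **: "(a \<star> id2 C f) \<star> id2 C g = a \<star> id2 C (f \<cdot> g)"
    if "cod C f = dom C (src C a)" "cod C g = dom C f"
    using that assms hcomp_assoc'[of "id2 C g" "id2 C f" a] by simp
  have ***: "(id2 C g \<star> a) \<star> id2 C f = id2 C g \<star> (a \<star> id2 C f)"
    if "cod C f = dom C (src C a)" "cod C (src C a) = dom C g"
    using that assms hcomp_assoc'[of "id2 C f" a "id2 C g"] by simp
  show "\<lbrakk>cod C (src C a) = dom C f; cod C f = dom C g\<rbrakk> \<Longrightarrow> g \<rhd> f \<rhd> a = g \<cdot> f \<rhd> a"
    "\<lbrakk>cod C f = dom C (src C a); cod C g = dom C f\<rbrakk> \<Longrightarrow> a \<lhd> f \<lhd> g = a \<lhd> f \<cdot> g"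
    "\<lbrakk>cod C f = dom C (src C a); cod C (src C a) = dom C g\<rbrakk> \<Longrightarrow> (g \<rhd> a) \<lhd> f = g \<rhd> a \<lhd> f"
    unfolding lwhisk_def rwhisk_def using * ** *** by simp_all
qed

lemma whisk_vcomp [simp]:
  assumes "a \<in> Cell C" "b \<in> Cell C" "trg C a = src C b" "f \<in> Arr C"
  shows "cod C (src C a) = dom C f \<Longrightarrow> f \<rhd> (b \<bullet> a) = (f \<rhd> b) \<bullet> (f \<rhd> a)"
    "cod C f = dom C (src C a) \<Longrightarrow> (b \<bullet> a) \<lhd> f = (b \<lhd> f) \<bullet> (a \<lhd> f)"
proof -
  have eq: "id2 C f = id2 C f \<bullet> id2 C f" using assms by simp
  have *: "dom C (src C b) = dom C (src C a)" "cod C (src C b) = cod C (src C a)"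
    using assms(1,3) cell_arrs(3,4)[of a] by simp_all
  show "cod C (src C a) = dom C f \<Longrightarrow> f \<rhd> (b \<bullet> a) = (f \<rhd> b) \<bullet> (f \<rhd> a)"
    using assms * by (subst (1) lwhisk_def, subst eq, subst interchange') (simp_all add: lwhisk_def)
  show "cod C f = dom C (src C a) \<Longrightarrow> (b \<bullet> a) \<lhd> f = (b \<lhd> f) \<bullet> (a \<lhd> f)"
    using assms * by (subst (1) rwhisk_def, subst eq, subst interchange') (simp_all add: rwhisk_def)
qed

text \<open>Pad the two cells with identities on opposite sides and apply interchange.\<close>

lemma hcomp_whisk:
  assumes "a \<in> Cell C" "b \<in> Cell C" "cod C (src C a) = dom C (src C b)"
  shows "b \<star> a = (trg C b \<rhd> a) \<bullet> (b \<lhd> src C a)" "b \<star> a = (b \<lhd> trg C a) \<bullet> (src C b \<rhd> a)"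
proof -
  have "(id2 C (trg C b) \<bullet> b) \<star> (a \<bullet> id2 C (src C a)) = (trg C b \<rhd> a) \<bullet> (b \<lhd> src C a)"
    using assms by (subst interchange') (simp_all add: lwhisk_def rwhisk_def)
  then show "b \<star> a = (trg C b \<rhd> a) \<bullet> (b \<lhd> src C a)" using assms by simp
  have "(b \<bullet> id2 C (src C b)) \<star> (id2 C (trg C a) \<bullet> a) = (b \<lhd> trg C a) \<bullet> (src C b \<rhd> a)"
    using assms by (subst interchange') (simp_all add: lwhisk_def rwhisk_def)
  then show "b \<star> a = (b \<lhd> trg C a) \<bullet> (src C b \<rhd> a)" using assms by simp
qed

text \<open>With composites nested to the right, an equation for \<open>b \<bullet> a\<close> does
  not match inside \<open>b \<bullet> (a \<bullet> e)\<close>; this is the instance that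
  does.\<close>

lemma vcomp_reassoc:
  assumes "b \<bullet> a = d" "e \<in> Cell C" "a \<in> Cell C" "b \<in> Cell C" "trg C e = src C a" "trg C a = src C b"
  shows "b \<bullet> (a \<bullet> e) = d \<bullet> e"
  using assms(2-6) by (simp flip: assms(1))

lemma whisk_interchange:
  assumes "a \<in> Cell C" "b \<in> Cell C" "cod C (src C a) = dom C (src C b)"
  shows "(trg C b \<rhd> a) \<bullet> (b \<lhd> src C a) = (b \<lhd> trg C a) \<bullet> (src C b \<rhd> a)"
  using hcomp_whisk[OF assms] by simp

section \<open>Invertible 2-cells and their inverses\<close>

lemma invertibleI: "inverse_cells C a b \<Longrightarrow> invertible C a"
  unfolding invertible_def by (rule exI)

lemma inverse_cells_unique:
  assumes "inverse_cells C a b" "inverse_cells C a b'"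
  shows "b = b'"
proof -
  have *: "a \<in> Cell C" "b \<in> Cell C" "b' \<in> Cell C" "src C b = trg C a" "trg C b = src C a"
    "src C b' = trg C a" "trg C b' = src C a" "b \<bullet> a = id2 C (src C a)" "a \<bullet> b' = id2 C (trg C a)"
    using assms unfolding inverse_cells_def mem_hom2 by blast+
  have "b = b \<bullet> (a \<bullet> b')" unfolding *(9) using *(1-7) by simp
  also have "\<dots> = b \<bullet> a \<bullet> b'" using *(1-7) by simp
  also have "\<dots> = b'" unfolding *(8) using *(1-7) by simp
  finally show ?thesis .
qed

lemma inverse_cells_vinv:
  assumes "invertible C a"
  shows "inverse_cells C a (vinv C a)"
proof -
  obtain b where b: "inverse_cells C a b" using assms unfolding invertible_def by (elim exE)
  then have "vinv C a = b"
    unfolding vinv_def by (rule the_equality) (rule inverse_cells_unique[OF _ b])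
  with b show ?thesis by simp
qed

lemma vinvI: "inverse_cells C a b \<Longrightarrow> vinv C a = b"
  by (rule inverse_cells_unique[OF inverse_cells_vinv[OF invertibleI]])

lemma inverse_cellsI:
  assumes "a \<in> Cell C" "b \<in> Cell C" "src C b = trg C a" "trg C b = src C a"
    "b \<bullet> a = id2 C (src C a)" "a \<bullet> b = id2 C (trg C a)"
  shows "inverse_cells C a b"
  using assms by (simp add: inverse_cells_def mem_hom2)

lemma invertible_cell: "invertible C a \<Longrightarrow> a \<in> Cell C"
  unfolding invertible_def inverse_cells_def mem_hom2 by (elim exE conjE)

lemma vinv_simps [simp]:
  assumes "invertible C a"
  shows "vinv C a \<in> Cell C" "src C (vinv C a) = trg C a" "trg C (vinv C a) = src C a"
    "vinv C a \<bullet> a = id2 C (src C a)" "a \<bullet> vinv C a = id2 C (trg C a)"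
  using inverse_cells_vinv[OF assms] by (simp_all add: inverse_cells_def mem_hom2)

lemma vinv_cancel [simp]:
  assumes "invertible C a" "b \<in> Cell C"
  shows "trg C b = src C a \<Longrightarrow> vinv C a \<bullet> (a \<bullet> b) = b"
    "trg C b = trg C a \<Longrightarrow> a \<bullet> (vinv C a \<bullet> b) = b"
  using assms invertible_cell[OF assms(1)] by (simp_all flip: vcomp_assoc')

lemma inverse_cells_sym: "inverse_cells C a b \<Longrightarrow> inverse_cells C b a"
  unfolding inverse_cells_def mem_hom2 by (elim conjE, intro conjI) simp_all

lemma invertible_vinv [simp]:
  assumes "invertible C a"
  shows "invertible C (vinv C a)" "vinv C (vinv C a) = a"
  using inverse_cells_sym[OF inverse_cells_vinv[OF assms]] by (simp_all add: vinvI invertibleI)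

lemma invertible_id2 [simp]:
  assumes "f \<in> Arr C"
  shows "invertible C (id2 C f)" "vinv C (id2 C f) = id2 C f"
proof -
  have "inverse_cells C (id2 C f) (id2 C f)" using assms by (simp add: inverse_cells_def mem_hom2)
  then show "invertible C (id2 C f)" "vinv C (id2 C f) = id2 C f"
    by (simp_all add: vinvI invertibleI)
qed

lemma inverse_cells_vcomp:
  assumes "invertible C a" "invertible C b" "trg C a = src C b"
  shows "inverse_cells C (b \<bullet> a) (vinv C a \<bullet> vinv C b)"
proof -
  have [simp]: "a \<in> Cell C" "b \<in> Cell C" using assms invertible_cell by auto
  show ?thesis using assms by (intro inverse_cellsI) simp_all
qed

lemma invertible_vcomp [simp]:
  assumes "invertible C a" "invertible C b" "trg C a = src C b"
  shows "invertible C (b \<bullet> a)" "vinv C (b \<bullet> a) = vinv C a \<bullet> vinv C b"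
  using inverse_cells_vcomp[OF assms] by (simp_all add: vinvI invertibleI)

lemma inverse_cells_whisk:
  assumes "invertible C a" "f \<in> Arr C"
  shows "cod C (src C a) = dom C f \<Longrightarrow> inverse_cells C (f \<rhd> a) (f \<rhd> vinv C a)"
    "cod C f = dom C (src C a) \<Longrightarrow> inverse_cells C (a \<lhd> f) (vinv C a \<lhd> f)"
proof -
  have [simp]: "a \<in> Cell C" using assms invertible_cell by auto
  show "cod C (src C a) = dom C f \<Longrightarrow> inverse_cells C (f \<rhd> a) (f \<rhd> vinv C a)"
    using assms by (intro inverse_cellsI) (simp_all flip: whisk_vcomp)
  show "cod C f = dom C (src C a) \<Longrightarrow> inverse_cells C (a \<lhd> f) (vinv C a \<lhd> f)"
    using assms by (intro inverse_cellsI) (simp_all flip: whisk_vcomp)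
qed

lemma invertible_whisk [simp]:
  assumes "invertible C a" "f \<in> Arr C"
  shows "cod C (src C a) = dom C f \<Longrightarrow> invertible C (f \<rhd> a)"
    "cod C (src C a) = dom C f \<Longrightarrow> vinv C (f \<rhd> a) = f \<rhd> vinv C a"
    "cod C f = dom C (src C a) \<Longrightarrow> invertible C (a \<lhd> f)"
    "cod C f = dom C (src C a) \<Longrightarrow> vinv C (a \<lhd> f) = vinv C a \<lhd> f"
  using inverse_cells_whisk[OF assms] by (simp_all add: vinvI invertibleI)

lemma iso_cancel_left:
  assumes "invertible C a" "b \<in> Cell C" "c \<in> Cell C" "trg C b = src C a" "trg C c = src C a"
    "a \<bullet> b = a \<bullet> c"
  shows "b = c"
proof -
  have "vinv C a \<bullet> (a \<bullet> b) = vinv C a \<bullet> (a \<bullet> c)" by (simp only: assms(6))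
  then show ?thesis using assms(1-5) by simp
qed

lemma iso_cancel_right:
  assumes "invertible C a" "b \<in> Cell C" "c \<in> Cell C" "src C b = trg C a" "src C c = trg C a"
    "b \<bullet> a = c \<bullet> a"
  shows "b = c"
proof -
  have [simp]: "a \<in> Cell C" using assms invertible_cell by auto
  have "b \<bullet> a \<bullet> vinv C a = c \<bullet> a \<bullet> vinv C a" by (simp only: assms(6))
  then show ?thesis using assms(1-5) by simp
qed

lemma vinv_move:
  assumes "b \<bullet> a = c" "invertible C b" "invertible C c" "a \<in> Cell C" "trg C a = src C b"
  shows "a \<bullet> vinv C c = vinv C b"
proof -
  have [simp]: "b \<in> Cell C" "c \<in> Cell C" using assms(2,3) invertible_cell by auto
  have t: "src C c = src C a" "trg C c = trg C b" using assms(4,5) by (simp_all flip: assms(1))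
  have "a \<bullet> vinv C c = vinv C b \<bullet> ((b \<bullet> a) \<bullet> vinv C c)" using assms(2-5) t by simp
  then show ?thesis unfolding assms(1) using assms(2-5) t by simp
qed

text \<open>A commuting square with invertible sides \<open>c\<close> and \<open>d\<close>, read
  against their direction. Naturality squares and coherence laws are passed to inverse cells in this
  way.\<close>

lemma vinv_square:
  assumes eq: "c \<bullet> a = b \<bullet> d" and [simp]: "invertible C c" "invertible C d"
    "a \<in> Cell C" "b \<in> Cell C" and t: "trg C a = src C c" "src C b = trg C d"
  shows "vinv C c \<bullet> b = a \<bullet> vinv C d"
proof -
  have [simp]: "c \<in> Cell C" "d \<in> Cell C" by (simp_all add: invertible_cell)
  have "src C (c \<bullet> a) = src C a" "trg C (c \<bullet> a) = trg C c" "src C (b \<bullet> d) = src C d" "trg C (b \<bullet> d) = trg C b"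
    by (simp_all add: t)
  then have t': "trg C b = trg C c" "src C a = src C d" by (simp_all add: eq)
  have "vinv C c \<bullet> b = vinv C c \<bullet> ((b \<bullet> d) \<bullet> vinv C d)" by (simp add: t t')
  also have "\<dots> = a \<bullet> vinv C d" unfolding eq[symmetric] by (simp add: t t')
  finally show ?thesis .
qed

end

section \<open>The tensor product of a Gray monoid\<close>

text \<open>The inverse of \<open>tcomp\<close>; unlike \<open>tcomp\<close> it does not involve the inverse of an interchange cell.\<close>

definition tsplit :: "('o, 'm, 'c) gray \<Rightarrow> 'm \<Rightarrow> 'm \<Rightarrow> 'm \<Rightarrow> 'm \<Rightarrow> 'c"
  where "tsplit G f' g' f g = (cod G f' \<otimes>\<^sub>L g') \<rhd> gi G f' g \<lhd> (f \<otimes>\<^sub>R dom G g)"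
  for G (structure)

context gray_monoid
begin

lemma tens0_simps [simp]:
  assumes "X \<in> Obj G"
  shows "Y \<in> Obj G \<Longrightarrow> X \<otimes>\<^sub>0 Y \<in> Obj G"
    "\<lbrakk>Y \<in> Obj G; Z \<in> Obj G\<rbrakk> \<Longrightarrow> X \<otimes>\<^sub>0 Y \<otimes>\<^sub>0 Z = X \<otimes>\<^sub>0 (Y \<otimes>\<^sub>0 Z)"
    "unit_obj G \<otimes>\<^sub>0 X = X" "X \<otimes>\<^sub>0 unit_obj G = X"
  using assms by (simp_all add: tens0_obj tens0_assoc tens0_unit)

declare unit_obj [simp]

lemma act1_simps [simp]:
  assumes "Z \<in> Obj G" "f \<in> Arr G"
  shows "Z \<otimes>\<^sub>L f \<in> Arr G" "dom G (Z \<otimes>\<^sub>L f) = Z \<otimes>\<^sub>0 dom G f" "cod G (Z \<otimes>\<^sub>L f) = Z \<otimes>\<^sub>0 cod G f"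
    "f \<otimes>\<^sub>R Z \<in> Arr G" "dom G (f \<otimes>\<^sub>R Z) = dom G f \<otimes>\<^sub>0 Z" "cod G (f \<otimes>\<^sub>R Z) = cod G f \<otimes>\<^sub>0 Z"
  using lact1_hom[of Z f "dom G f" "cod G f"] ract1_hom[of Z f "dom G f" "cod G f"] assms
  by (simp_all add: mem_hom1)

lemma act1_comp [simp]:
  assumes "Z \<in> Obj G" "f \<in> Arr G" "g \<in> Arr G" "cod G f = dom G g"
  shows "Z \<otimes>\<^sub>L (g \<cdot> f) = (Z \<otimes>\<^sub>L g) \<cdot> (Z \<otimes>\<^sub>L f)" "(g \<cdot> f) \<otimes>\<^sub>R Z = (g \<otimes>\<^sub>R Z) \<cdot> (f \<otimes>\<^sub>R Z)"
  using lact1_comp[of Z f "dom G f" "cod G f" g "cod G g"]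
    ract1_comp[of Z f "dom G f" "cod G f" g "cod G g"] assms
  by (simp_all add: mem_hom1)

lemma act1_id [simp]:
  assumes "Z \<in> Obj G" "X \<in> Obj G"
  shows "Z \<otimes>\<^sub>L id1 G X = id1 G (Z \<otimes>\<^sub>0 X)" "id1 G X \<otimes>\<^sub>R Z = id1 G (X \<otimes>\<^sub>0 Z)"
  using assms by (simp_all add: lact1_id ract1_id)

lemma act1_objs [simp]:
  assumes "f \<in> Arr G"
  shows "unit_obj G \<otimes>\<^sub>L f = f" "f \<otimes>\<^sub>R unit_obj G = f"
    "\<lbrakk>X \<in> Obj G; Y \<in> Obj G\<rbrakk> \<Longrightarrow> (X \<otimes>\<^sub>0 Y) \<otimes>\<^sub>L f = X \<otimes>\<^sub>L (Y \<otimes>\<^sub>L f)"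
    "\<lbrakk>X \<in> Obj G; Y \<in> Obj G\<rbrakk> \<Longrightarrow> f \<otimes>\<^sub>R (X \<otimes>\<^sub>0 Y) = (f \<otimes>\<^sub>R X) \<otimes>\<^sub>R Y"
    "\<lbrakk>X \<in> Obj G; Y \<in> Obj G\<rbrakk> \<Longrightarrow> X \<otimes>\<^sub>L (f \<otimes>\<^sub>R Y) = (X \<otimes>\<^sub>L f) \<otimes>\<^sub>R Y"
  using assms act1_unit act1_assoc by blast+

lemma act2_simps [simp]:
  assumes "Z \<in> Obj G" "a \<in> Cell G"
  shows "Z \<otimes>\<^sub>L\<^sub>2 a \<in> Cell G" "src G (Z \<otimes>\<^sub>L\<^sub>2 a) = Z \<otimes>\<^sub>L src G a" "trg G (Z \<otimes>\<^sub>L\<^sub>2 a) = Z \<otimes>\<^sub>L trg G a"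
    "a \<otimes>\<^sub>R\<^sub>2 Z \<in> Cell G" "src G (a \<otimes>\<^sub>R\<^sub>2 Z) = src G a \<otimes>\<^sub>R Z" "trg G (a \<otimes>\<^sub>R\<^sub>2 Z) = trg G a \<otimes>\<^sub>R Z"
  using lact2_hom[of Z a "src G a" "trg G a"] ract2_hom[of Z a "src G a" "trg G a"] assms
  by (simp_all add: mem_hom2)

lemma act2_id [simp]:
  assumes "Z \<in> Obj G" "f \<in> Arr G"
  shows "Z \<otimes>\<^sub>L\<^sub>2 id2 G f = id2 G (Z \<otimes>\<^sub>L f)" "id2 G f \<otimes>\<^sub>R\<^sub>2 Z = id2 G (f \<otimes>\<^sub>R Z)"
  using assms by (simp_all add: lact2_id ract2_id)

lemma act2_vcomp [simp]:
  assumes "Z \<in> Obj G" "a \<in> Cell G" "b \<in> Cell G" "trg G a = src G b"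
  shows "Z \<otimes>\<^sub>L\<^sub>2 (b \<bullet> a) = (Z \<otimes>\<^sub>L\<^sub>2 b) \<bullet> (Z \<otimes>\<^sub>L\<^sub>2 a)"
    "(b \<bullet> a) \<otimes>\<^sub>R\<^sub>2 Z = (b \<otimes>\<^sub>R\<^sub>2 Z) \<bullet> (a \<otimes>\<^sub>R\<^sub>2 Z)"
  using lact2_vcomp[of Z a "src G a" "trg G a" b "trg G b"]
    ract2_vcomp[of Z a "src G a" "trg G a" b "trg G b"] assms
  by (simp_all add: mem_hom2)

lemma act2_hcomp [simp]:
  assumes "Z \<in> Obj G" "a \<in> Cell G" "b \<in> Cell G" "cod G (src G a) = dom G (src G b)"
  shows "Z \<otimes>\<^sub>L\<^sub>2 (b \<star> a) = (Z \<otimes>\<^sub>L\<^sub>2 b) \<star> (Z \<otimes>\<^sub>L\<^sub>2 a)"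
    "(b \<star> a) \<otimes>\<^sub>R\<^sub>2 Z = (b \<otimes>\<^sub>R\<^sub>2 Z) \<star> (a \<otimes>\<^sub>R\<^sub>2 Z)"
  using lact2_hcomp[of Z a "src G a" "trg G a" b "src G b" "trg G b"]
    ract2_hcomp[of Z a "src G a" "trg G a" b "src G b" "trg G b"] assms
  by (simp_all add: mem_hom2)

lemma act2_whisk [simp]:
  assumes "Z \<in> Obj G" "a \<in> Cell G" "f \<in> Arr G"
  shows "cod G (src G a) = dom G f \<Longrightarrow> Z \<otimes>\<^sub>L\<^sub>2 (f \<rhd> a) = (Z \<otimes>\<^sub>L f) \<rhd> (Z \<otimes>\<^sub>L\<^sub>2 a)"
    "cod G (src G a) = dom G f \<Longrightarrow> (f \<rhd> a) \<otimes>\<^sub>R\<^sub>2 Z = (f \<otimes>\<^sub>R Z) \<rhd> (a \<otimes>\<^sub>R\<^sub>2 Z)"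
    "cod G f = dom G (src G a) \<Longrightarrow> Z \<otimes>\<^sub>L\<^sub>2 (a \<lhd> f) = (Z \<otimes>\<^sub>L\<^sub>2 a) \<lhd> (Z \<otimes>\<^sub>L f)"
    "cod G f = dom G (src G a) \<Longrightarrow> (a \<lhd> f) \<otimes>\<^sub>R\<^sub>2 Z = (a \<otimes>\<^sub>R\<^sub>2 Z) \<lhd> (f \<otimes>\<^sub>R Z)"
  using assms by (simp_all add: lwhisk_def rwhisk_def)

lemma act2_objs [simp]:
  assumes "a \<in> Cell G"
  shows "unit_obj G \<otimes>\<^sub>L\<^sub>2 a = a" "a \<otimes>\<^sub>R\<^sub>2 unit_obj G = a"
    "\<lbrakk>X \<in> Obj G; Y \<in> Obj G\<rbrakk> \<Longrightarrow> (X \<otimes>\<^sub>0 Y) \<otimes>\<^sub>L\<^sub>2 a = X \<otimes>\<^sub>L\<^sub>2 (Y \<otimes>\<^sub>L\<^sub>2 a)"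
    "\<lbrakk>X \<in> Obj G; Y \<in> Obj G\<rbrakk> \<Longrightarrow> a \<otimes>\<^sub>R\<^sub>2 (X \<otimes>\<^sub>0 Y) = (a \<otimes>\<^sub>R\<^sub>2 X) \<otimes>\<^sub>R\<^sub>2 Y"
    "\<lbrakk>X \<in> Obj G; Y \<in> Obj G\<rbrakk> \<Longrightarrow> X \<otimes>\<^sub>L\<^sub>2 (a \<otimes>\<^sub>R\<^sub>2 Y) = (X \<otimes>\<^sub>L\<^sub>2 a) \<otimes>\<^sub>R\<^sub>2 Y"
  using assms act2_unit act2_assoc by blast+

lemma inverse_cells_act2:
  assumes "invertible G a" "Z \<in> Obj G"
  shows "inverse_cells G (Z \<otimes>\<^sub>L\<^sub>2 a) (Z \<otimes>\<^sub>L\<^sub>2 vinv G a)" "inverse_cells G (a \<otimes>\<^sub>R\<^sub>2 Z) (vinv G a \<otimes>\<^sub>R\<^sub>2 Z)"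
proof -
  have [simp]: "a \<in> Cell G" using assms invertible_cell by auto
  show "inverse_cells G (Z \<otimes>\<^sub>L\<^sub>2 a) (Z \<otimes>\<^sub>L\<^sub>2 vinv G a)" "inverse_cells G (a \<otimes>\<^sub>R\<^sub>2 Z) (vinv G a \<otimes>\<^sub>R\<^sub>2 Z)"
    using assms by (auto intro!: inverse_cellsI simp flip: act2_vcomp)
qed

lemma invertible_act2 [simp]:
  assumes "invertible G a" "Z \<in> Obj G"
  shows "invertible G (Z \<otimes>\<^sub>L\<^sub>2 a)" "vinv G (Z \<otimes>\<^sub>L\<^sub>2 a) = Z \<otimes>\<^sub>L\<^sub>2 vinv G a"
    "invertible G (a \<otimes>\<^sub>R\<^sub>2 Z)" "vinv G (a \<otimes>\<^sub>R\<^sub>2 Z) = vinv G a \<otimes>\<^sub>R\<^sub>2 Z"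
  using inverse_cells_act2[OF assms] by (simp_all add: vinvI invertibleI)

lemma gi_simps [simp]:
  assumes "f \<in> Arr G" "g \<in> Arr G"
  shows "gi G f g \<in> Cell G" "src G (gi G f g) = (cod G f \<otimes>\<^sub>L g) \<cdot> (f \<otimes>\<^sub>R dom G g)"
    "trg G (gi G f g) = (f \<otimes>\<^sub>R cod G g) \<cdot> (dom G f \<otimes>\<^sub>L g)" "invertible G (gi G f g)"
  using gi_iso[of f "dom G f" "cod G f" g "dom G g" "cod G g"] assms
  by (simp_all add: mem_hom1 mem_hom2 iso2_def)

lemma gi_nat:
  assumes "a \<in> Cell G" "b \<in> Cell G"
  shows "gi G (trg G a) (trg G b) \<bullet>
      ((cod G (src G a) \<otimes>\<^sub>L\<^sub>2 b) \<star> (a \<otimes>\<^sub>R\<^sub>2 dom G (src G b))) =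
    ((a \<otimes>\<^sub>R\<^sub>2 cod G (src G b)) \<star> (dom G (src G a) \<otimes>\<^sub>L\<^sub>2 b)) \<bullet> gi G (src G a) (src G b)"
  using gi_natural[of "src G a" "dom G (src G a)" "cod G (src G a)" "src G b" "dom G (src G b)"
      "cod G (src G b)" a "trg G a" b "trg G b"] assms
  by (simp add: mem_hom1 mem_hom2)

lemma gi_id1 [simp]:
  assumes "X \<in> Obj G" "f \<in> Arr G"
  shows "gi G (id1 G X) f = id2 G (X \<otimes>\<^sub>L f)" "gi G f (id1 G X) = id2 G (f \<otimes>\<^sub>R X)"
  using gi_id assms by blast+

lemma gi_comp [simp]:
  assumes "f \<in> Arr G" "f' \<in> Arr G" "g \<in> Arr G"
  shows "cod G f = dom G f' \<Longrightarrow> gi G (f' \<cdot> f) g =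
      ((f' \<otimes>\<^sub>R cod G g) \<rhd> gi G f g) \<bullet> (gi G f' g \<lhd> (f \<otimes>\<^sub>R dom G g))"
    "cod G f = dom G f' \<Longrightarrow> gi G g (f' \<cdot> f) =
      (gi G g f' \<lhd> (dom G g \<otimes>\<^sub>L f)) \<bullet> ((cod G g \<otimes>\<^sub>L f') \<rhd> gi G g f)"
  using gi_comp_left[of f "dom G f" "cod G f" f' "cod G f'" g "dom G g" "cod G g"]
    gi_comp_right[of g "dom G g" "cod G g" f "dom G f" "cod G f" f' "cod G f'"] assms
  by (simp_all add: mem_hom1)

lemma gi_act1 [simp]:
  assumes "X \<in> Obj G" "f \<in> Arr G" "g \<in> Arr G"
  shows "gi G (X \<otimes>\<^sub>L f) g = X \<otimes>\<^sub>L\<^sub>2 gi G f g" "gi G (f \<otimes>\<^sub>R X) g = gi G f (X \<otimes>\<^sub>L g)"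
    "gi G f (g \<otimes>\<^sub>R X) = gi G f g \<otimes>\<^sub>R\<^sub>2 X"
  using gi_act assms by blast+

lemma tens1_simps [simp]:
  assumes "f \<in> Arr G" "g \<in> Arr G"
  shows "f \<otimes>\<^sub>1 g \<in> Arr G" "dom G (f \<otimes>\<^sub>1 g) = dom G f \<otimes>\<^sub>0 dom G g"
    "cod G (f \<otimes>\<^sub>1 g) = cod G f \<otimes>\<^sub>0 cod G g"
  using assms by (simp_all add: tens1_def)

lemma tens1_id [simp]:
  assumes "X \<in> Obj G" "Y \<in> Obj G"
  shows "id1 G X \<otimes>\<^sub>1 id1 G Y = id1 G (X \<otimes>\<^sub>0 Y)"
  using assms by (simp add: tens1_def)

lemma tens1_unit [simp]:
  assumes "f \<in> Arr G"
  shows "id1 G (unit_obj G) \<otimes>\<^sub>1 f = f" "f \<otimes>\<^sub>1 id1 G (unit_obj G) = f"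
  using assms by (simp_all add: tens1_def)

lemma tens1_assoc [simp]:
  assumes "f \<in> Arr G" "g \<in> Arr G" "h \<in> Arr G"
  shows "f \<otimes>\<^sub>1 g \<otimes>\<^sub>1 h = f \<otimes>\<^sub>1 (g \<otimes>\<^sub>1 h)"
  using assms by (simp add: tens1_def)

text \<open>The pseudomonoid axioms are written with the actions of objects, the calculations with
  \<open>tens1\<close>. The rewriting has to be requested explicitly, because unfolding
  \<open>tens1_def\<close> goes the opposite way.\<close>

lemma act1_tens1:
  assumes "f \<in> Arr G" "X \<in> Obj G"
  shows "X \<otimes>\<^sub>L f = id1 G X \<otimes>\<^sub>1 f" "f \<otimes>\<^sub>R X = f \<otimes>\<^sub>1 id1 G X"
  using assms by (simp_all add: tens1_def)

text \<open>A tensor applies its first factor first and its second factor last. Hence a 1-cell on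
  the second factor composes strictly after it, and a 1-cell on the first factor strictly before it;
  in the other two positions an interchange cell intervenes.\<close>

lemma tens1_comp_strict [simp]:
  assumes "X = cod G f" "cod G g = dom G f'" "f \<in> Arr G" "g \<in> Arr G" "f' \<in> Arr G"
  shows "(id1 G X \<otimes>\<^sub>1 f') \<cdot> (f \<otimes>\<^sub>1 g) = f \<otimes>\<^sub>1 (f' \<cdot> g)"
    "\<lbrakk>cod G h = dom G f \<otimes>\<^sub>0 dom G g; h \<in> Arr G\<rbrakk> \<Longrightarrow>
      (id1 G X \<otimes>\<^sub>1 f') \<cdot> ((f \<otimes>\<^sub>1 g) \<cdot> h) = (f \<otimes>\<^sub>1 (f' \<cdot> g)) \<cdot> h"
  using assms by (simp_all add: tens1_def)

lemma tens1_comp_strict' [simp]: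
  assumes "X = dom G g" "cod G f = dom G f'" "f \<in> Arr G" "f' \<in> Arr G" "g \<in> Arr G"
  shows "(f' \<otimes>\<^sub>1 g) \<cdot> (f \<otimes>\<^sub>1 id1 G X) = (f' \<cdot> f) \<otimes>\<^sub>1 g"
    "\<lbrakk>cod G h = dom G f \<otimes>\<^sub>0 dom G g; h \<in> Arr G\<rbrakk> \<Longrightarrow>
      (f' \<otimes>\<^sub>1 g) \<cdot> ((f \<otimes>\<^sub>1 id1 G X) \<cdot> h) = ((f' \<cdot> f) \<otimes>\<^sub>1 g) \<cdot> h"
  using assms by (simp_all add: tens1_def)

lemma tens1_comp_strict3 [simp]:
  "\<lbrakk>X = cod G f; Y = cod G g; cod G h = dom G k; f \<in> Arr G; g \<in> Arr G; h \<in> Arr G; k \<in> Arr G\<rbrakk> \<Longrightarrow>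
    (id1 G (X \<otimes>\<^sub>0 Y) \<otimes>\<^sub>1 k) \<cdot> (f \<otimes>\<^sub>1 (g \<otimes>\<^sub>1 h)) = f \<otimes>\<^sub>1 (g \<otimes>\<^sub>1 (k \<cdot> h))"
  "\<lbrakk>X = dom G k; dom G h = cod G f \<otimes>\<^sub>0 cod G g; f \<in> Arr G; g \<in> Arr G; h \<in> Arr G; k \<in> Arr G\<rbrakk> \<Longrightarrow>
    (h \<otimes>\<^sub>1 k) \<cdot> (f \<otimes>\<^sub>1 (g \<otimes>\<^sub>1 id1 G X)) = (h \<cdot> (f \<otimes>\<^sub>1 g)) \<otimes>\<^sub>1 k"
  "\<lbrakk>Z = dom G k; dom G h = cod G f \<otimes>\<^sub>0 Y; Y \<in> Obj G; f \<in> Arr G; h \<in> Arr G; k \<in> Arr G\<rbrakk> \<Longrightarrow>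
    (h \<otimes>\<^sub>1 k) \<cdot> (f \<otimes>\<^sub>1 id1 G (Y \<otimes>\<^sub>0 Z)) = (h \<cdot> (f \<otimes>\<^sub>1 id1 G Y)) \<otimes>\<^sub>1 k"
  by (simp_all add: tens1_def)

lemma tens1_comp_unit [simp]:
  assumes "dom G h = unit_obj G" "cod G f = dom G g" "h \<in> Arr G" "f \<in> Arr G" "g \<in> Arr G"
  shows "(g \<otimes>\<^sub>1 h) \<cdot> f = (g \<cdot> f) \<otimes>\<^sub>1 h"
  using assms by (simp add: tens1_def)

lemma tens2_simps [simp]:
  assumes "a \<in> Cell G" "b \<in> Cell G"
  shows "a \<otimes>\<^sub>2 b \<in> Cell G" "src G (a \<otimes>\<^sub>2 b) = src G a \<otimes>\<^sub>1 src G b"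
    "trg G (a \<otimes>\<^sub>2 b) = trg G a \<otimes>\<^sub>1 trg G b"
  using assms by (simp_all add: tens2_def tens1_def)

lemma tens2_id [simp]:
  assumes "f \<in> Arr G" "g \<in> Arr G"
  shows "id2 G f \<otimes>\<^sub>2 id2 G g = id2 G (f \<otimes>\<^sub>1 g)"
  using assms by (simp add: tens2_def tens1_def)

lemma tens2_vcomp:
  assumes "a \<in> Cell G" "b \<in> Cell G" "c \<in> Cell G" "d \<in> Cell G" "trg G a = src G b" "trg G c = src G d"
  shows "(b \<otimes>\<^sub>2 d) \<bullet> (a \<otimes>\<^sub>2 c) = (b \<bullet> a) \<otimes>\<^sub>2 (d \<bullet> c)"
proof -
  have *: "cod G (src G b) = cod G (src G a)" "dom G (src G d) = dom G (src G c)"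
    "cod G (src G d) = cod G (src G c)" "dom G (src G b) = dom G (src G a)"
    using assms cell_arrs[of a] cell_arrs[of c] by simp_all
  show ?thesis using assms * by (simp add: tens2_def interchange')
qed

lemma tens2_unit [simp]:
  assumes "a \<in> Cell G"
  shows "id2 G (id1 G (unit_obj G)) \<otimes>\<^sub>2 a = a" "a \<otimes>\<^sub>2 id2 G (id1 G (unit_obj G)) = a"
  using assms by (simp_all add: tens2_def flip: lwhisk_def rwhisk_def)

lemma tens2_assoc [simp]:
  assumes "a \<in> Cell G" "b \<in> Cell G" "c \<in> Cell G"
  shows "a \<otimes>\<^sub>2 b \<otimes>\<^sub>2 c = a \<otimes>\<^sub>2 (b \<otimes>\<^sub>2 c)"
  using assms by (simp add: tens2_def hcomp_assoc')

lemma act2_tens2: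
  assumes "a \<in> Cell G" "X \<in> Obj G"
  shows "X \<otimes>\<^sub>L\<^sub>2 a = id2 G (id1 G X) \<otimes>\<^sub>2 a" "a \<otimes>\<^sub>R\<^sub>2 X = a \<otimes>\<^sub>2 id2 G (id1 G X)"
  using assms by (simp_all add: tens2_def flip: lwhisk_def rwhisk_def)

lemma inverse_cells_tens2:
  assumes "invertible G a" "invertible G b"
  shows "inverse_cells G (a \<otimes>\<^sub>2 b) (vinv G a \<otimes>\<^sub>2 vinv G b)"
proof -
  have [simp]: "a \<in> Cell G" "b \<in> Cell G" using assms invertible_cell by auto
  show ?thesis using assms by (intro inverse_cellsI) (simp_all add: tens2_vcomp)
qed

lemma invertible_tens2 [simp]:
  assumes "invertible G a" "invertible G b"
  shows "invertible G (a \<otimes>\<^sub>2 b)" "vinv G (a \<otimes>\<^sub>2 b) = vinv G a \<otimes>\<^sub>2 vinv G b"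
  using inverse_cells_tens2[OF assms] by (simp_all add: vinvI invertibleI)

section \<open>Naturality and coherence of the comparison cells \<open>tsplit\<close>\<close>

lemma tsplit_simps [simp]:
  assumes "f \<in> Arr G" "g \<in> Arr G" "f' \<in> Arr G" "g' \<in> Arr G"
    "cod G f = dom G f'" "cod G g = dom G g'"
  shows "tsplit G f' g' f g \<in> Cell G" "src G (tsplit G f' g' f g) = (f' \<cdot> f) \<otimes>\<^sub>1 (g' \<cdot> g)"
    "trg G (tsplit G f' g' f g) = (f' \<otimes>\<^sub>1 g') \<cdot> (f \<otimes>\<^sub>1 g)" "invertible G (tsplit G f' g' f g)"
    "tcomp G f' g' f g = vinv G (tsplit G f' g' f g)"
  using assms by (simp_all add: tsplit_def tcomp_def tens1_def)

lemma tsplit_strict [simp]: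
  assumes "f \<in> Arr G" "g' \<in> Arr G"
  shows "\<lbrakk>X = cod G f; g \<in> Arr G; cod G g = dom G g'\<rbrakk> \<Longrightarrow>
      tsplit G (id1 G X) g' f g = id2 G (f \<otimes>\<^sub>1 (g' \<cdot> g))"
    "\<lbrakk>Y = dom G g'; f' \<in> Arr G; cod G f = dom G f'\<rbrakk> \<Longrightarrow>
      tsplit G f' g' f (id1 G Y) = id2 G ((f' \<cdot> f) \<otimes>\<^sub>1 g')"
  using assms by (simp_all add: tsplit_def tens1_def)

text \<open>The cells \<open>b'\<close> and \<open>a\<close> sit on the outer sides of the composite
  and pass through by interchange, so everything reduces to naturality of the interchange cell in
  \<open>a'\<close> and \<open>b\<close>.\<close>

lemma tsplit_nat:
  assumes "a \<in> Cell G" "b \<in> Cell G" "a' \<in> Cell G" "b' \<in> Cell G"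
    "cod G (src G a) = dom G (src G a')" "cod G (src G b) = dom G (src G b')"
  shows "tsplit G (trg G a') (trg G b') (trg G a) (trg G b) \<bullet> ((a' \<star> a) \<otimes>\<^sub>2 (b' \<star> b)) =
    ((a' \<otimes>\<^sub>2 b') \<star> (a \<otimes>\<^sub>2 b)) \<bullet> tsplit G (src G a') (src G b') (src G a) (src G b)"
proof -
  let ?A = "cod G (src G a')" and ?B = "dom G (src G b)"
  let ?x = "?A \<otimes>\<^sub>L\<^sub>2 b'" and ?y = "(?A \<otimes>\<^sub>L\<^sub>2 b) \<star> (a' \<otimes>\<^sub>R\<^sub>2 ?B)" and ?z = "a \<otimes>\<^sub>R\<^sub>2 ?B"
    and ?y' = "(a' \<otimes>\<^sub>R\<^sub>2 dom G (src G b')) \<star> (dom G (src G a') \<otimes>\<^sub>L\<^sub>2 b)"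
  have 1: "(a' \<star> a) \<otimes>\<^sub>2 (b' \<star> b) = ?x \<star> (?y \<star> ?z)"
    using assms by (simp add: tens2_def hcomp_assoc')
  have 2: "(a' \<otimes>\<^sub>2 b') \<star> (a \<otimes>\<^sub>2 b) = ?x \<star> (?y' \<star> ?z)"
    using assms by (simp add: tens2_def hcomp_assoc')
  have 3: "tsplit G (trg G a') (trg G b') (trg G a) (trg G b) =
     id2 G (trg G ?x) \<star> (gi G (trg G a') (trg G b) \<star> id2 G (trg G ?z))"
    using assms by (simp add: tsplit_def lwhisk_def rwhisk_def)
  have 4: "tsplit G (src G a') (src G b') (src G a) (src G b) =
     id2 G (src G ?x) \<star> (gi G (src G a') (src G b) \<star> id2 G (src G ?z))"
    using assms by (simp add: tsplit_def lwhisk_def rwhisk_def)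
  have 5: "gi G (trg G a') (trg G b) \<bullet> ?y = ?y' \<bullet> gi G (src G a') (src G b)"
    using gi_nat[of a' b] assms by simp
  have "(id2 G (trg G ?x) \<star> (gi G (trg G a') (trg G b) \<star> id2 G (trg G ?z))) \<bullet> (?x \<star> (?y \<star> ?z))
      = (id2 G (trg G ?x) \<bullet> ?x) \<star> ((gi G (trg G a') (trg G b) \<bullet> ?y) \<star> (id2 G (trg G ?z) \<bullet> ?z))"
    using assms by (simp flip: interchange')
  also have "\<dots> = (?x \<bullet> id2 G (src G ?x)) \<star> ((?y' \<bullet> gi G (src G a') (src G b)) \<star> (?z \<bullet> id2 G (src G ?z)))"
    unfolding 5 using assms by simp
  also have "\<dots> = (?x \<star> (?y' \<star> ?z)) \<bullet> (id2 G (src G ?x) \<star> (gi G (src G a') (src G b) \<star> id2 G (src G ?z)))"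
    using assms by (simp flip: interchange')
  finally show ?thesis unfolding 1 2 3 4 .
qed

text \<open>Both sides consist of the interchange cells of \<open>(f'', g)\<close>,
  \<open>(f', g)\<close> and \<open>(f'', g')\<close>. After the common first one, the other two act
  in different places, so their order is immaterial.\<close>

lemma tsplit_assoc:
  assumes "f \<in> Arr G" "g \<in> Arr G" "f' \<in> Arr G" "g' \<in> Arr G" "f'' \<in> Arr G" "g'' \<in> Arr G"
    "cod G f = dom G f'" "cod G g = dom G g'" "cod G f' = dom G f''" "cod G g' = dom G g''"
  shows "(tsplit G f'' g'' f' g' \<lhd> (f \<otimes>\<^sub>1 g)) \<bullet> tsplit G (f'' \<cdot> f') (g'' \<cdot> g') f g =
    ((f'' \<otimes>\<^sub>1 g'') \<rhd> tsplit G f' g' f g) \<bullet> tsplit G f'' g'' (f' \<cdot> f) (g' \<cdot> g)"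
proof -
  let ?a = "gi G f' g \<lhd> (f \<otimes>\<^sub>R dom G g)" and ?b = "(cod G f'' \<otimes>\<^sub>L g'') \<rhd> gi G f'' g'"
  let ?r = "(cod G f'' \<otimes>\<^sub>L g'') \<cdot> (cod G f'' \<otimes>\<^sub>L g') \<rhd> gi G f'' g \<lhd> (f' \<otimes>\<^sub>R dom G g) \<cdot> (f \<otimes>\<^sub>R dom G g)"
  have "(trg G ?b \<rhd> ?a) \<bullet> (?b \<lhd> src G ?a) = (?b \<lhd> trg G ?a) \<bullet> (src G ?b \<rhd> ?a)"
    using assms by (intro whisk_interchange) simp_all
  then have "(trg G ?b \<rhd> ?a) \<bullet> (?b \<lhd> src G ?a) \<bullet> ?r = (?b \<lhd> trg G ?a) \<bullet> (src G ?b \<rhd> ?a) \<bullet> ?r"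
    by simp
  then show ?thesis using assms by (simp add: tsplit_def tens1_def)
qed

text \<open>Both sides consist of the interchange cells of \<open>(f', g)\<close>,
  \<open>(f', h)\<close> and \<open>(g', h)\<close>; they differ only in the order of the first and
  the last, which act in different places.\<close>

lemma tsplit_tens:
  assumes "f \<in> Arr G" "g \<in> Arr G" "h \<in> Arr G" "f' \<in> Arr G" "g' \<in> Arr G" "h' \<in> Arr G"
    "cod G f = dom G f'" "cod G g = dom G g'" "cod G h = dom G h'"
  shows "tsplit G (f' \<otimes>\<^sub>1 g') h' (f \<otimes>\<^sub>1 g) h \<bullet> (tsplit G f' g' f g \<otimes>\<^sub>2 id2 G (h' \<cdot> h)) =
    tsplit G f' (g' \<otimes>\<^sub>1 h') f (g \<otimes>\<^sub>1 h) \<bullet> (id2 G (f' \<cdot> f) \<otimes>\<^sub>2 tsplit G g' h' g h)"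
proof -
  let ?a = "gi G f' g \<otimes>\<^sub>R\<^sub>2 dom G h" and ?b = "cod G f' \<otimes>\<^sub>L\<^sub>2 gi G g' h"
  let ?l = "cod G f' \<otimes>\<^sub>L cod G g' \<otimes>\<^sub>L h'" and ?r = "f \<otimes>\<^sub>R dom G g \<otimes>\<^sub>R dom G h"
  have "(trg G ?b \<rhd> ?a) \<bullet> (?b \<lhd> src G ?a) = (?b \<lhd> trg G ?a) \<bullet> (src G ?b \<rhd> ?a)"
    using assms by (intro whisk_interchange) simp_all
  then have "?l \<rhd> ((trg G ?b \<rhd> ?a) \<bullet> (?b \<lhd> src G ?a)) \<lhd> ?r =
      ?l \<rhd> ((?b \<lhd> trg G ?a) \<bullet> (src G ?b \<rhd> ?a)) \<lhd> ?r"
    by simp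
  then show ?thesis
    using assms by (simp add: tsplit_def tens1_def tens2_def flip: lwhisk_def rwhisk_def)
qed

end

section \<open>Monoidal adjunctions between categories of 1-cells\<close>

text \<open>A monoidal category whose objects are the 1-cells into \<open>X\<close> from all domains
  and whose morphisms are 2-cells of \<open>C\<close>. Only codomains are constrained, so the
  abstract calculus never sees how \<open>T\<close> acts on domains.\<close>

locale monoidal_fibre = two_category C
  for C :: "('o, 'm, 'c, 'z) two_cat_scheme" (structure) +
  fixes X :: 'o
    and T :: "'m \<Rightarrow> 'm \<Rightarrow> 'm" (infixl \<open>\<odot>\<close> 60)
    and T2 :: "'c \<Rightarrow> 'c \<Rightarrow> 'c" (infixl \<open>\<boxtimes>\<close> 60)
    and J :: 'm
    and al :: "'m \<Rightarrow> 'm \<Rightarrow> 'm \<Rightarrow> 'c"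
    and la ro :: "'m \<Rightarrow> 'c"
  assumes T_simps [simp]: "\<lbrakk>x \<in> Arr C; y \<in> Arr C; cod C x = X; cod C y = X\<rbrakk> \<Longrightarrow> x \<odot> y \<in> Arr C \<and> cod C (x \<odot> y) = X"
    and J_simps [simp]: "J \<in> Arr C" "cod C J = X"
    and T2_simps [simp]: "\<lbrakk>a \<in> Cell C; b \<in> Cell C; cod C (src C a) = X; cod C (src C b) = X\<rbrakk> \<Longrightarrow>
       a \<boxtimes> b \<in> Cell C \<and> src C (a \<boxtimes> b) = src C a \<odot> src C b \<and> trg C (a \<boxtimes> b) = trg C a \<odot> trg C b"
    and T2_id [simp]: "\<lbrakk>x \<in> Arr C; y \<in> Arr C; cod C x = X; cod C y = X\<rbrakk> \<Longrightarrow>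
       id2 C x \<boxtimes> id2 C y = id2 C (x \<odot> y)"
    and T2_vcomp: "\<lbrakk>a \<in> Cell C; b \<in> Cell C; a' \<in> Cell C; b' \<in> Cell C; cod C (src C a) = X;
       cod C (src C b) = X; trg C a = src C a'; trg C b = src C b'\<rbrakk> \<Longrightarrow>
       (a' \<boxtimes> b') \<bullet> (a \<boxtimes> b) = (a' \<bullet> a) \<boxtimes> (b' \<bullet> b)"
    and al_simps [simp]: "\<lbrakk>x \<in> Arr C; y \<in> Arr C; z \<in> Arr C; cod C x = X; cod C y = X; cod C z = X\<rbrakk> \<Longrightarrow>
       al x y z \<in> Cell C \<and> src C (al x y z) = x \<odot> y \<odot> z \<and> trg C (al x y z) = x \<odot> (y \<odot> z) \<and>
       invertible C (al x y z)"
    and al_nat: "\<lbrakk>a \<in> Cell C; b \<in> Cell C; c \<in> Cell C; cod C (src C a) = X; cod C (src C b) = X;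
       cod C (src C c) = X\<rbrakk> \<Longrightarrow>
       al (trg C a) (trg C b) (trg C c) \<bullet> (a \<boxtimes> b \<boxtimes> c) = (a \<boxtimes> (b \<boxtimes> c)) \<bullet> al (src C a) (src C b) (src C c)"
    and la_simps [simp]: "\<lbrakk>x \<in> Arr C; cod C x = X\<rbrakk> \<Longrightarrow>
       la x \<in> Cell C \<and> src C (la x) = J \<odot> x \<and> trg C (la x) = x \<and> invertible C (la x)"
    and la_nat: "\<lbrakk>a \<in> Cell C; cod C (src C a) = X\<rbrakk> \<Longrightarrow> la (trg C a) \<bullet> (id2 C J \<boxtimes> a) = a \<bullet> la (src C a)"
    and ro_simps [simp]: "\<lbrakk>x \<in> Arr C; cod C x = X\<rbrakk> \<Longrightarrow>
       ro x \<in> Cell C \<and> src C (ro x) = x \<odot> J \<and> trg C (ro x) = x \<and> invertible C (ro x)"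
    and ro_nat: "\<lbrakk>a \<in> Cell C; cod C (src C a) = X\<rbrakk> \<Longrightarrow> ro (trg C a) \<bullet> (a \<boxtimes> id2 C J) = a \<bullet> ro (src C a)"
    and pentagon: "\<lbrakk>v \<in> Arr C; x \<in> Arr C; y \<in> Arr C; z \<in> Arr C; cod C v = X; cod C x = X; cod C y = X; cod C z = X\<rbrakk> \<Longrightarrow>
       al v x (y \<odot> z) \<bullet> al (v \<odot> x) y z = (id2 C v \<boxtimes> al x y z) \<bullet> (al v (x \<odot> y) z \<bullet> (al v x y \<boxtimes> id2 C z))"
    and triangle: "\<lbrakk>x \<in> Arr C; y \<in> Arr C; cod C x = X; cod C y = X\<rbrakk> \<Longrightarrow>
       (id2 C x \<boxtimes> la y) \<bullet> al x J y = ro x \<boxtimes> id2 C y"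
begin

lemma T2_vcomp_assoc:
  assumes "a \<in> Cell C" "b \<in> Cell C" "a' \<in> Cell C" "b' \<in> Cell C" "cod C (src C a) = X"
       "cod C (src C b) = X" "trg C a = src C a'" "trg C b = src C b'"
       "c \<in> Cell C" "trg C c = src C a \<odot> src C b"
  shows "(a' \<boxtimes> b') \<bullet> ((a \<boxtimes> b) \<bullet> c) = ((a' \<bullet> a) \<boxtimes> (b' \<bullet> b)) \<bullet> c"
  using assms cell_arrs(4)[of a] cell_arrs(4)[of b] by (intro vcomp_reassoc T2_vcomp) simp_all

lemmas T2_merge = T2_vcomp T2_vcomp_assoc

lemma invertible_T2 [simp]:
  assumes "invertible C a" "invertible C b" "cod C (src C a) = X" "cod C (src C b) = X"
  shows "invertible C (a \<boxtimes> b)" "vinv C (a \<boxtimes> b) = vinv C a \<boxtimes> vinv C b"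
proof -
  have [simp]: "a \<in> Cell C" "b \<in> Cell C" using assms invertible_cell by auto
  have "inverse_cells C (a \<boxtimes> b) (vinv C a \<boxtimes> vinv C b)"
    using assms by (intro inverse_cellsI) (simp_all add: T2_vcomp)
  then show "invertible C (a \<boxtimes> b)" "vinv C (a \<boxtimes> b) = vinv C a \<boxtimes> vinv C b"
    by (simp_all add: vinvI invertibleI)
qed

text \<open>Naturality of the invertible \<open>la\<close> recovers a cell from its tensor with
  \<open>J\<close>.\<close>

lemma J_T2_cancel:
  assumes "a \<in> Cell C" "b \<in> Cell C" "src C a = src C b" "trg C a = trg C b" "cod C (src C b) = X"
    "id2 C J \<boxtimes> a = id2 C J \<boxtimes> b"
  shows "a = b"
proof (rule iso_cancel_right[of "la (src C a)"])
  show "a \<bullet> la (src C a) = b \<bullet> la (src C a)"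
    using la_nat[of a] la_nat[of b] assms(1-5) unfolding assms(6) by simp
qed (use assms in simp_all)

text \<open>Kelly's argument: tensor with the unit object on the left, where \<open>la\<close> is faithful.\<close>

lemma la_T:
  assumes "x \<in> Arr C" "y \<in> Arr C" "cod C x = X" "cod C y = X"
  shows "la (x \<odot> y) \<bullet> al J x y = la x \<boxtimes> id2 C y"
proof (rule J_T2_cancel)
  let ?l = "id2 C J \<boxtimes> (la (x \<odot> y) \<bullet> al J x y)" and ?r = "id2 C J \<boxtimes> (la x \<boxtimes> id2 C y)"
  \<comment> \<open>\<open>?p\<close> is invertible: adding it on the right brings in the pentagon
    at \<open>J, J, x, y\<close>, and it is cancelled at the end.\<close>
  let ?p = "al J (J \<odot> x) y \<bullet> (al J J x \<boxtimes> id2 C y)"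
  have 1: "?l = (id2 C J \<boxtimes> la (x \<odot> y)) \<bullet> (id2 C J \<boxtimes> al J x y)"
    using assms by (simp add: T2_vcomp)
  have "?l \<bullet> ?p = (id2 C J \<boxtimes> la (x \<odot> y)) \<bullet> ((id2 C J \<boxtimes> al J x y) \<bullet> ?p)"
    unfolding 1 using assms by simp
  also have "\<dots> = ((id2 C J \<boxtimes> la (x \<odot> y)) \<bullet> al J J (x \<odot> y)) \<bullet> al (J \<odot> J) x y"
    using assms by (simp flip: pentagon)
  also have "\<dots> = (ro J \<boxtimes> (id2 C x \<boxtimes> id2 C y)) \<bullet> al (J \<odot> J) x y"
    using assms by (simp add: triangle)
  also have "\<dots> = al J x y \<bullet> (ro J \<boxtimes> id2 C x \<boxtimes> id2 C y)"
    using assms al_nat[of "ro J" "id2 C x" "id2 C y"] by simp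
  also have "\<dots> = al J x y \<bullet> (((id2 C J \<boxtimes> la x) \<bullet> al J J x) \<boxtimes> id2 C y)"
    using assms by (simp add: triangle)
  also have "\<dots> = al J x y \<bullet> ((id2 C J \<boxtimes> la x \<boxtimes> id2 C y) \<bullet> (al J J x \<boxtimes> id2 C y))"
    using assms by (simp add: T2_vcomp)
  also have "\<dots> = ?r \<bullet> ?p"
    using assms vcomp_reassoc[OF al_nat[of "id2 C J" "la x" "id2 C y"]] by simp
  finally show "?l = ?r"
    by (rule iso_cancel_right[rotated 5]) (use assms in simp_all)
qed (use assms in simp_all)

end

text \<open>Postcomposition with \<open>w\<close> and with \<open>r\<close> is the adjunction
  between the two fibres. The strong structure is a family \<open>ps x y\<close> indexed by 1-cells,
  not one 2-cell, so that its laws are those of an ordinary strong monoidal functor.\<close>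

locale monoidal_adjunction =
  A: monoidal_fibre C XA TA TA2 JA alA laA roA + B: monoidal_fibre C XB TB TB2 JB alB laB roB
  for C :: "('o, 'm, 'c, 'z) two_cat_scheme" (structure)
    and XA and TA (infixl \<open>\<odot>\<^sub>A\<close> 60) and TA2 (infixl \<open>\<boxtimes>\<^sub>A\<close> 60) and JA alA laA roA
    and XB and TB (infixl \<open>\<odot>\<^sub>B\<close> 60) and TB2 (infixl \<open>\<boxtimes>\<^sub>B\<close> 60) and JB alB laB roB +
  fixes w r :: 'm and \<eta> \<epsilon> :: 'c and ps :: "'m \<Rightarrow> 'm \<Rightarrow> 'c" and ps0 :: 'c
  assumes adj: "adjunction C XA XB w r \<eta> \<epsilon>"
    and ps_simps [simp]: "\<lbrakk>x \<in> Arr C; y \<in> Arr C; cod C x = XA; cod C y = XA\<rbrakk> \<Longrightarrow>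
      ps x y \<in> Cell C \<and> src C (ps x y) = w \<cdot> x \<odot>\<^sub>B w \<cdot> y \<and> trg C (ps x y) = w \<cdot> (x \<odot>\<^sub>A y) \<and> invertible C (ps x y)"
    and ps0_simps [simp]: "ps0 \<in> Cell C" "src C ps0 = JB" "trg C ps0 = w \<cdot> JA" "invertible C ps0"
    and ps_nat: "\<lbrakk>a \<in> Cell C; b \<in> Cell C; cod C (src C a) = XA; cod C (src C b) = XA\<rbrakk> \<Longrightarrow>
      ps (trg C a) (trg C b) \<bullet> ((w \<rhd> a) \<boxtimes>\<^sub>B (w \<rhd> b)) = (w \<rhd> (a \<boxtimes>\<^sub>A b)) \<bullet> ps (src C a) (src C b)"
    and ps_assoc: "\<lbrakk>x \<in> Arr C; y \<in> Arr C; z \<in> Arr C; cod C x = XA; cod C y = XA; cod C z = XA\<rbrakk> \<Longrightarrow>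
      (w \<rhd> alA x y z) \<bullet> (ps (x \<odot>\<^sub>A y) z \<bullet> (ps x y \<boxtimes>\<^sub>B id2 C (w \<cdot> z))) =
      ps x (y \<odot>\<^sub>A z) \<bullet> ((id2 C (w \<cdot> x) \<boxtimes>\<^sub>B ps y z) \<bullet> alB (w \<cdot> x) (w \<cdot> y) (w \<cdot> z))"
    and ps_la: "\<lbrakk>x \<in> Arr C; cod C x = XA\<rbrakk> \<Longrightarrow>
      (w \<rhd> laA x) \<bullet> (ps JA x \<bullet> (ps0 \<boxtimes>\<^sub>B id2 C (w \<cdot> x))) = laB (w \<cdot> x)"
    and ps_ro: "\<lbrakk>x \<in> Arr C; cod C x = XA\<rbrakk> \<Longrightarrow>
      (w \<rhd> roA x) \<bullet> (ps x JA \<bullet> (id2 C (w \<cdot> x) \<boxtimes>\<^sub>B ps0)) = roB (w \<cdot> x)"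
begin

section \<open>The mate correspondence of the adjunction\<close>

lemma adj_simps [simp]:
  "w \<in> Arr C" "dom C w = XA" "cod C w = XB" "r \<in> Arr C" "dom C r = XB" "cod C r = XA"
  "\<eta> \<in> Cell C" "src C \<eta> = id1 C XA" "trg C \<eta> = r \<cdot> w"
  "\<epsilon> \<in> Cell C" "src C \<epsilon> = w \<cdot> r" "trg C \<epsilon> = id1 C XB"
  using adj by (simp_all add: adjunction_def A.mem_hom1 A.mem_hom2)

lemma X_Obj [simp]: "XA \<in> Obj C" "XB \<in> Obj C"
  using A.arr_objs[of w] by simp_all

lemma eps_nat: "\<lbrakk>a \<in> Cell C; cod C (src C a) = XB\<rbrakk> \<Longrightarrow> (\<epsilon> \<lhd> trg C a) \<bullet> (w \<cdot> r \<rhd> a) = a \<bullet> (\<epsilon> \<lhd> src C a)"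
  using A.whisk_interchange[of a \<epsilon>] by simp

lemma eta_nat: "\<lbrakk>a \<in> Cell C; cod C (src C a) = XA\<rbrakk> \<Longrightarrow> (\<eta> \<lhd> trg C a) \<bullet> a = (r \<cdot> w \<rhd> a) \<bullet> (\<eta> \<lhd> src C a)"
  using A.whisk_interchange[of a \<eta>] by simp

lemma adj_triangles:
  assumes "x \<in> Arr C"
  shows "cod C x = XA \<Longrightarrow> (\<epsilon> \<lhd> w \<cdot> x) \<bullet> (w \<rhd> \<eta> \<lhd> x) = id2 C (w \<cdot> x)"
    "cod C x = XB \<Longrightarrow> (r \<rhd> \<epsilon> \<lhd> x) \<bullet> (\<eta> \<lhd> r \<cdot> x) = id2 C (r \<cdot> x)"
proof -
  have 1: "(\<epsilon> \<lhd> w) \<bullet> (w \<rhd> \<eta>) = id2 C w" and 2: "(r \<rhd> \<epsilon>) \<bullet> (\<eta> \<lhd> r) = id2 C r"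
    using adj by (auto simp: adjunction_def)
  show "cod C x = XA \<Longrightarrow> (\<epsilon> \<lhd> w \<cdot> x) \<bullet> (w \<rhd> \<eta> \<lhd> x) = id2 C (w \<cdot> x)"
    using assms arg_cong[OF 1, of "\<lambda>t. t \<lhd> x"] by simp
  show "cod C x = XB \<Longrightarrow> (r \<rhd> \<epsilon> \<lhd> x) \<bullet> (\<eta> \<lhd> r \<cdot> x) = id2 C (r \<cdot> x)"
    using assms arg_cong[OF 2, of "\<lambda>t. t \<lhd> x"] by simp
qed

text \<open>The transpose of a cell \<open>w x => y\<close> across the adjunction, a cell
  \<open>x => r y\<close>.\<close>

definition mate :: "'m \<Rightarrow> 'c \<Rightarrow> 'c"
  where "mate x k = (r \<rhd> k) \<bullet> (\<eta> \<lhd> x)"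

lemma mate_simps [simp]:
  assumes "x \<in> Arr C" "cod C x = XA" "k \<in> Cell C" "src C k = w \<cdot> x"
  shows "mate x k \<in> Cell C" "src C (mate x k) = x" "trg C (mate x k) = r \<cdot> trg C k"
  using assms by (simp_all add: mate_def)

lemma eps_mate:
  assumes "x \<in> Arr C" "cod C x = XA" "k \<in> Cell C" "src C k = w \<cdot> x"
  shows "(\<epsilon> \<lhd> trg C k) \<bullet> (w \<rhd> mate x k) = k"
    (is "?lhs = _")
proof -
  have c: "cod C (src C k) = XB" using assms by simp
  have "?lhs = ((\<epsilon> \<lhd> trg C k) \<bullet> (w \<cdot> r \<rhd> k)) \<bullet> (w \<rhd> \<eta> \<lhd> x)"
    using assms A.cell_arrs(4)[of k] by (simp add: mate_def)
  also have "\<dots> = k \<bullet> ((\<epsilon> \<lhd> w \<cdot> x) \<bullet> (w \<rhd> \<eta> \<lhd> x))"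
    using assms eps_nat[of k] by simp
  finally show ?thesis using assms by (simp add: adj_triangles)
qed

text \<open>Transposition is injective. Every law for cells defined as mates is proved by
  transposing it into the fibre over \<open>XB\<close>, where the counit consumes the units inside
  the mates.\<close>

lemma mate_eqI:
  assumes "a \<in> Cell C" "b \<in> Cell C" "src C a = src C b" "cod C (src C b) = XA" "trg C a = r \<cdot> y"
    "trg C b = r \<cdot> y" "y \<in> Arr C" "cod C y = XB"
    "(\<epsilon> \<lhd> y) \<bullet> (w \<rhd> a) = (\<epsilon> \<lhd> y) \<bullet> (w \<rhd> b)"
  shows "a = b"
proof -
  \<comment> \<open>A cell into \<open>r y\<close> is the mate of its own transpose, by naturality
    of \<open>\<eta>\<close> and the second triangle identity.\<close>
  have *: "c = (r \<rhd> ((\<epsilon> \<lhd> y) \<bullet> (w \<rhd> c))) \<bullet> (\<eta> \<lhd> src C c)"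
    if "c \<in> Cell C" "cod C (src C c) = XA" "trg C c = r \<cdot> y" for c
  proof -
    have "(r \<rhd> ((\<epsilon> \<lhd> y) \<bullet> (w \<rhd> c))) \<bullet> (\<eta> \<lhd> src C c) =
        (r \<rhd> \<epsilon> \<lhd> y) \<bullet> ((r \<cdot> w \<rhd> c) \<bullet> (\<eta> \<lhd> src C c))"
      using that assms(7,8) by simp
    also have "\<dots> = ((r \<rhd> \<epsilon> \<lhd> y) \<bullet> (\<eta> \<lhd> r \<cdot> y)) \<bullet> c"
      using that assms(7,8) by (simp flip: eta_nat)
    finally show ?thesis using that assms(7,8) by (simp add: adj_triangles)
  qed
  have "a = (r \<rhd> ((\<epsilon> \<lhd> y) \<bullet> (w \<rhd> a))) \<bullet> (\<eta> \<lhd> src C a)"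
    using assms(1-8) by (intro *) simp_all
  also have "\<dots> = b" unfolding assms(9) assms(3) using assms(1-8) by (intro *[symmetric]) simp_all
  finally show ?thesis .
qed

section \<open>Doctrinal adjunction: the lax monoidal structure of the right adjoint\<close>

abbreviation ips :: "'m \<Rightarrow> 'm \<Rightarrow> 'c" where "ips x y \<equiv> vinv C (ps x y)"

lemma ips_nat:
  assumes "a \<in> Cell C" "b \<in> Cell C" "cod C (src C a) = XA" "cod C (src C b) = XA"
  shows "ips (trg C a) (trg C b) \<bullet> (w \<rhd> (a \<boxtimes>\<^sub>A b)) = ((w \<rhd> a) \<boxtimes>\<^sub>B (w \<rhd> b)) \<bullet> ips (src C a) (src C b)"
    (is "?lhs = ?rhs")
proof (rule A.iso_cancel_left[of "ps (trg C a) (trg C b)"])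
  show "ps (trg C a) (trg C b) \<bullet> ?lhs =
    ps (trg C a) (trg C b) \<bullet> ?rhs"
    using assms A.vcomp_reassoc[OF ps_nat[OF assms]] by simp
qed (use assms in simp_all)

lemma ips_assoc:
  assumes "x \<in> Arr C" "y \<in> Arr C" "z \<in> Arr C" "cod C x = XA" "cod C y = XA" "cod C z = XA"
  shows "(id2 C (w \<cdot> x) \<boxtimes>\<^sub>B ips y z) \<bullet> (ips x (y \<odot>\<^sub>A z) \<bullet> (w \<rhd> alA x y z)) =
    alB (w \<cdot> x) (w \<cdot> y) (w \<cdot> z) \<bullet> ((ips x y \<boxtimes>\<^sub>B id2 C (w \<cdot> z)) \<bullet> ips (x \<odot>\<^sub>A y) z)"
    (is "?lhs = _")
proof (rule A.iso_cancel_left[of "ps x (y \<odot>\<^sub>A z) \<bullet> (id2 C (w \<cdot> x) \<boxtimes>\<^sub>B ps y z)"])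
  let ?p = "(ips x y \<boxtimes>\<^sub>B id2 C (w \<cdot> z)) \<bullet> ips (x \<odot>\<^sub>A y) z"
  have "(ps x (y \<odot>\<^sub>A z) \<bullet> (id2 C (w \<cdot> x) \<boxtimes>\<^sub>B ps y z)) \<bullet> (alB (w \<cdot> x) (w \<cdot> y) (w \<cdot> z) \<bullet> ?p)
     = (ps x (y \<odot>\<^sub>A z) \<bullet> ((id2 C (w \<cdot> x) \<boxtimes>\<^sub>B ps y z) \<bullet> alB (w \<cdot> x) (w \<cdot> y) (w \<cdot> z))) \<bullet> ?p"
    using assms by simp
  also have "\<dots> = w \<rhd> alA x y z"
    unfolding ps_assoc[OF assms, symmetric] using assms by (simp add: B.T2_merge)
  also have "\<dots> = (ps x (y \<odot>\<^sub>A z) \<bullet> (id2 C (w \<cdot> x) \<boxtimes>\<^sub>B ps y z)) \<bullet>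
     ?lhs"
    using assms by (simp add: B.T2_merge)
  finally show "(ps x (y \<odot>\<^sub>A z) \<bullet> (id2 C (w \<cdot> x) \<boxtimes>\<^sub>B ps y z)) \<bullet>
     ?lhs =
     (ps x (y \<odot>\<^sub>A z) \<bullet> (id2 C (w \<cdot> x) \<boxtimes>\<^sub>B ps y z)) \<bullet> (alB (w \<cdot> x) (w \<cdot> y) (w \<cdot> z) \<bullet> ?p)"
    by simp
qed (use assms in simp_all)

lemma ips_la:
  assumes "x \<in> Arr C" "cod C x = XA"
  shows "laB (w \<cdot> x) \<bullet> ((vinv C ps0 \<boxtimes>\<^sub>B id2 C (w \<cdot> x)) \<bullet> ips JA x) = w \<rhd> laA x"
  unfolding ps_la[OF assms, symmetric] using assms by (simp add: B.T2_merge)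

lemma ips_ro:
  assumes "x \<in> Arr C" "cod C x = XA"
  shows "roB (w \<cdot> x) \<bullet> ((id2 C (w \<cdot> x) \<boxtimes>\<^sub>B vinv C ps0) \<bullet> ips x JA) = w \<rhd> roA x"
  unfolding ps_ro[OF assms, symmetric] using assms by (simp add: B.T2_merge)

text \<open>The structure that a right adjoint inherits from an oplax left adjoint, the inverses of
  \<open>ps\<close> serving as the oplax structure.\<close>

definition radj_mul :: "'m \<Rightarrow> 'm \<Rightarrow> 'c"
  where "radj_mul x y = mate (r \<cdot> x \<odot>\<^sub>A r \<cdot> y) ((\<epsilon> \<lhd> x \<boxtimes>\<^sub>B \<epsilon> \<lhd> y) \<bullet> ips (r \<cdot> x) (r \<cdot> y))"

definition radj_uni :: 'c
  where "radj_uni = mate JA (vinv C ps0)"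

lemma radj_mul_simps [simp]:
  assumes "x \<in> Arr C" "y \<in> Arr C" "cod C x = XB" "cod C y = XB"
  shows "radj_mul x y \<in> Cell C" "src C (radj_mul x y) = r \<cdot> x \<odot>\<^sub>A r \<cdot> y" "trg C (radj_mul x y) = r \<cdot> (x \<odot>\<^sub>B y)"
    "(\<epsilon> \<lhd> (x \<odot>\<^sub>B y)) \<bullet> (w \<rhd> radj_mul x y) = (\<epsilon> \<lhd> x \<boxtimes>\<^sub>B \<epsilon> \<lhd> y) \<bullet> ips (r \<cdot> x) (r \<cdot> y)"
  using assms eps_mate[of "r \<cdot> x \<odot>\<^sub>A r \<cdot> y" "(\<epsilon> \<lhd> x \<boxtimes>\<^sub>B \<epsilon> \<lhd> y) \<bullet> ips (r \<cdot> x) (r \<cdot> y)"]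
  by (simp_all add: radj_mul_def)

lemma radj_uni_simps [simp]:
  "radj_uni \<in> Cell C" "src C radj_uni = JA" "trg C radj_uni = r \<cdot> JB" "(\<epsilon> \<lhd> JB) \<bullet> (w \<rhd> radj_uni) = vinv C ps0"
  using eps_mate[of JA "vinv C ps0"] by (simp_all add: radj_uni_def)

lemma radj_mul_eps_assoc [simp]:
  assumes "x \<in> Arr C" "y \<in> Arr C" "cod C x = XB" "cod C y = XB" "e \<in> Cell C" "trg C e = w \<cdot> (r \<cdot> x \<odot>\<^sub>A r \<cdot> y)"
  shows "(\<epsilon> \<lhd> (x \<odot>\<^sub>B y)) \<bullet> ((w \<rhd> radj_mul x y) \<bullet> e) = (\<epsilon> \<lhd> x \<boxtimes>\<^sub>B \<epsilon> \<lhd> y) \<bullet> (ips (r \<cdot> x) (r \<cdot> y) \<bullet> e)"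
  using assms A.vcomp_reassoc[OF radj_mul_simps(4)[of x y]] by simp

text \<open>Transposed, each side becomes three copies of \<open>\<epsilon>\<close> after two
  inverses of \<open>ps\<close>; naturality of the associator and \<open>ips_assoc\<close> identify
  them.\<close>

lemma radj_mul_assoc:
  assumes "x \<in> Arr C" "y \<in> Arr C" "z \<in> Arr C" "cod C x = XB" "cod C y = XB" "cod C z = XB"
  shows "(r \<rhd> alB x y z) \<bullet> (radj_mul (x \<odot>\<^sub>B y) z \<bullet> (radj_mul x y \<boxtimes>\<^sub>A id2 C (r \<cdot> z))) =
    radj_mul x (y \<odot>\<^sub>B z) \<bullet> ((id2 C (r \<cdot> x) \<boxtimes>\<^sub>A radj_mul y z) \<bullet> alA (r \<cdot> x) (r \<cdot> y) (r \<cdot> z))"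
    (is "?lhs = ?rhs")
proof (rule mate_eqI[of _ _ "x \<odot>\<^sub>B (y \<odot>\<^sub>B z)"])
  let ?i = "ips (r \<cdot> x) (r \<cdot> y)" and ?j = "ips (r \<cdot> y) (r \<cdot> z)"
  let ?k = "ips (r \<cdot> x \<odot>\<^sub>A r \<cdot> y) (r \<cdot> z)"
  have "(\<epsilon> \<lhd> (x \<odot>\<^sub>B (y \<odot>\<^sub>B z))) \<bullet> (w \<rhd> ?lhs)
     = alB x y z \<bullet> ((\<epsilon> \<lhd> (x \<odot>\<^sub>B y) \<boxtimes>\<^sub>B \<epsilon> \<lhd> z) \<bullet> (ips (r \<cdot> (x \<odot>\<^sub>B y)) (r \<cdot> z) \<bullet> (w \<rhd> (radj_mul x y \<boxtimes>\<^sub>A id2 C (r \<cdot> z)))))"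
    using assms A.vcomp_reassoc[OF eps_nat[of "alB x y z"]] by simp
  also have "\<dots> = alB x y z \<bullet> ((((\<epsilon> \<lhd> x \<boxtimes>\<^sub>B \<epsilon> \<lhd> y) \<bullet> ?i) \<boxtimes>\<^sub>B \<epsilon> \<lhd> z) \<bullet> ?k)"
    using assms ips_nat[of "radj_mul x y" "id2 C (r \<cdot> z)"] by (simp add: B.T2_merge)
  also have "\<dots> = (alB x y z \<bullet> (\<epsilon> \<lhd> x \<boxtimes>\<^sub>B \<epsilon> \<lhd> y \<boxtimes>\<^sub>B \<epsilon> \<lhd> z)) \<bullet> ((?i \<boxtimes>\<^sub>B id2 C (w \<cdot> (r \<cdot> z))) \<bullet> ?k)"
    using assms by (simp add: B.T2_merge)
  also have "\<dots> = (\<epsilon> \<lhd> x \<boxtimes>\<^sub>B (\<epsilon> \<lhd> y \<boxtimes>\<^sub>B \<epsilon> \<lhd> z)) \<bullet>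
      (alB (w \<cdot> (r \<cdot> x)) (w \<cdot> (r \<cdot> y)) (w \<cdot> (r \<cdot> z)) \<bullet> ((?i \<boxtimes>\<^sub>B id2 C (w \<cdot> (r \<cdot> z))) \<bullet> ?k))"
    using assms B.al_nat[of "\<epsilon> \<lhd> x" "\<epsilon> \<lhd> y" "\<epsilon> \<lhd> z"] by simp
  also have "\<dots> = (\<epsilon> \<lhd> x \<boxtimes>\<^sub>B (\<epsilon> \<lhd> y \<boxtimes>\<^sub>B \<epsilon> \<lhd> z)) \<bullet> ((id2 C (w \<cdot> (r \<cdot> x)) \<boxtimes>\<^sub>B ?j) \<bullet>
      (ips (r \<cdot> x) (r \<cdot> y \<odot>\<^sub>A r \<cdot> z) \<bullet> (w \<rhd> alA (r \<cdot> x) (r \<cdot> y) (r \<cdot> z))))"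
    using assms ips_assoc[of "r \<cdot> x" "r \<cdot> y" "r \<cdot> z"] by simp
  also have "\<dots> = (\<epsilon> \<lhd> x \<boxtimes>\<^sub>B \<epsilon> \<lhd> (y \<odot>\<^sub>B z)) \<bullet> (((id2 C (w \<cdot> (r \<cdot> x))) \<boxtimes>\<^sub>B (w \<rhd> radj_mul y z)) \<bullet>
      (ips (r \<cdot> x) (r \<cdot> y \<odot>\<^sub>A r \<cdot> z) \<bullet> (w \<rhd> alA (r \<cdot> x) (r \<cdot> y) (r \<cdot> z))))"
    using assms by (simp add: B.T2_merge)
  also have "\<dots> = (\<epsilon> \<lhd> (x \<odot>\<^sub>B (y \<odot>\<^sub>B z))) \<bullet> (w \<rhd> ?rhs)"
    using assms A.vcomp_reassoc[OF ips_nat[of "id2 C (r \<cdot> x)" "radj_mul y z"]] by simp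
  finally show "(\<epsilon> \<lhd> (x \<odot>\<^sub>B (y \<odot>\<^sub>B z))) \<bullet> (w \<rhd> ?lhs) = \<dots>" .
qed (use assms in simp_all)

lemma radj_mul_la:
  assumes "x \<in> Arr C" "cod C x = XB"
  shows "(r \<rhd> laB x) \<bullet> (radj_mul JB x \<bullet> (radj_uni \<boxtimes>\<^sub>A id2 C (r \<cdot> x))) = laA (r \<cdot> x)"
    (is "?lhs = _")
proof (rule mate_eqI[of _ _ x])
  have "(\<epsilon> \<lhd> x) \<bullet> (w \<rhd> ?lhs) =
      laB x \<bullet> ((vinv C ps0 \<boxtimes>\<^sub>B \<epsilon> \<lhd> x) \<bullet> ips JA (r \<cdot> x))"
    using assms A.vcomp_reassoc[OF eps_nat[of "laB x"]] ips_nat[of radj_uni "id2 C (r \<cdot> x)"]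
    by (simp add: B.T2_merge)
  also have "\<dots> = (laB x \<bullet> (id2 C JB \<boxtimes>\<^sub>B \<epsilon> \<lhd> x)) \<bullet> ((vinv C ps0 \<boxtimes>\<^sub>B id2 C (w \<cdot> (r \<cdot> x))) \<bullet> ips JA (r \<cdot> x))"
    using assms by (simp add: B.T2_merge)
  also have "\<dots> = (\<epsilon> \<lhd> x) \<bullet> (w \<rhd> laA (r \<cdot> x))"
    using assms B.la_nat[of "\<epsilon> \<lhd> x"] ips_la[of "r \<cdot> x"] by simp
  finally show "(\<epsilon> \<lhd> x) \<bullet> (w \<rhd> ?lhs) = \<dots>" .
qed (use assms in simp_all)

lemma radj_mul_ro:
  assumes "x \<in> Arr C" "cod C x = XB"
  shows "(r \<rhd> roB x) \<bullet> (radj_mul x JB \<bullet> (id2 C (r \<cdot> x) \<boxtimes>\<^sub>A radj_uni)) = roA (r \<cdot> x)"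
    (is "?lhs = _")
proof (rule mate_eqI[of _ _ x])
  have "(\<epsilon> \<lhd> x) \<bullet> (w \<rhd> ?lhs) =
      roB x \<bullet> ((\<epsilon> \<lhd> x \<boxtimes>\<^sub>B vinv C ps0) \<bullet> ips (r \<cdot> x) JA)"
    using assms A.vcomp_reassoc[OF eps_nat[of "roB x"]] ips_nat[of "id2 C (r \<cdot> x)" radj_uni]
    by (simp add: B.T2_merge)
  also have "\<dots> = (roB x \<bullet> (\<epsilon> \<lhd> x \<boxtimes>\<^sub>B id2 C JB)) \<bullet> ((id2 C (w \<cdot> (r \<cdot> x)) \<boxtimes>\<^sub>B vinv C ps0) \<bullet> ips (r \<cdot> x) JA)"
    using assms by (simp add: B.T2_merge)
  also have "\<dots> = (\<epsilon> \<lhd> x) \<bullet> (w \<rhd> roA (r \<cdot> x))"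
    using assms B.ro_nat[of "\<epsilon> \<lhd> x"] ips_ro[of "r \<cdot> x"] by simp
  finally show "(\<epsilon> \<lhd> x) \<bullet> (w \<rhd> ?lhs) = \<dots>" .
qed (use assms in simp_all)

text \<open>Transposed, the two copies of \<open>\<eta>\<close> meet the two copies of
  \<open>\<epsilon>\<close> inside \<open>radj_mul\<close>, and a triangle identity applies in each
  factor.\<close>

lemma eta_monoidal:
  assumes "a \<in> Arr C" "b \<in> Arr C" "cod C a = XA" "cod C b = XA"
  shows "(r \<rhd> ps a b) \<bullet> (radj_mul (w \<cdot> a) (w \<cdot> b) \<bullet> (\<eta> \<lhd> a \<boxtimes>\<^sub>A \<eta> \<lhd> b)) = \<eta> \<lhd> (a \<odot>\<^sub>A b)"
    (is "?lhs = _")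
proof (rule mate_eqI[of _ _ "w \<cdot> (a \<odot>\<^sub>A b)"])
  have "(\<epsilon> \<lhd> w \<cdot> (a \<odot>\<^sub>A b)) \<bullet> (w \<rhd> ?lhs) =
     ps a b \<bullet> ((((\<epsilon> \<lhd> w \<cdot> a) \<bullet> (w \<rhd> \<eta> \<lhd> a)) \<boxtimes>\<^sub>B ((\<epsilon> \<lhd> w \<cdot> b) \<bullet> (w \<rhd> \<eta> \<lhd> b))) \<bullet> ips a b)"
    using assms A.vcomp_reassoc[OF eps_nat[of "ps a b"]] ips_nat[of "\<eta> \<lhd> a" "\<eta> \<lhd> b"]
    by (simp add: B.T2_merge)
  also have "\<dots> = (\<epsilon> \<lhd> w \<cdot> (a \<odot>\<^sub>A b)) \<bullet> (w \<rhd> \<eta> \<lhd> (a \<odot>\<^sub>A b))"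
    using assms by (simp add: adj_triangles)
  finally show "(\<epsilon> \<lhd> w \<cdot> (a \<odot>\<^sub>A b)) \<bullet> (w \<rhd> ?lhs) = \<dots>" .
qed (use assms in simp_all)

section \<open>The lax monoidal structure of the comonad \<open>w r\<close>\<close>

definition cmul :: "'m \<Rightarrow> 'm \<Rightarrow> 'c"
  where "cmul x y = (w \<rhd> radj_mul x y) \<bullet> ps (r \<cdot> x) (r \<cdot> y)"

definition cuni :: 'c
  where "cuni = (w \<rhd> radj_uni) \<bullet> ps0"

lemma cmul_simps [simp]:
  assumes "x \<in> Arr C" "y \<in> Arr C" "cod C x = XB" "cod C y = XB"
  shows "cmul x y \<in> Cell C" "src C (cmul x y) = w \<cdot> (r \<cdot> x) \<odot>\<^sub>B w \<cdot> (r \<cdot> y)"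
    "trg C (cmul x y) = w \<cdot> (r \<cdot> (x \<odot>\<^sub>B y))"
  using assms by (simp_all add: cmul_def)

lemma cuni_simps [simp]:
  "cuni \<in> Cell C" "src C cuni = JB" "trg C cuni = w \<cdot> (r \<cdot> JB)"
  by (simp_all add: cuni_def)

text \<open>A composite of lax monoidal functors is lax: slide \<open>ps\<close> past the image of
  \<open>radj_mul\<close> by naturality, use the law of \<open>r\<close> under \<open>w\<close>,
  then the law of \<open>w\<close>.\<close>

lemma cmul_assoc:
  assumes "x \<in> Arr C" "y \<in> Arr C" "z \<in> Arr C" "cod C x = XB" "cod C y = XB" "cod C z = XB"
  shows "(w \<cdot> r \<rhd> alB x y z) \<bullet> (cmul (x \<odot>\<^sub>B y) z \<bullet> (cmul x y \<boxtimes>\<^sub>B id2 C (w \<cdot> (r \<cdot> z)))) =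
    cmul x (y \<odot>\<^sub>B z) \<bullet> ((id2 C (w \<cdot> (r \<cdot> x)) \<boxtimes>\<^sub>B cmul y z) \<bullet> alB (w \<cdot> (r \<cdot> x)) (w \<cdot> (r \<cdot> y)) (w \<cdot> (r \<cdot> z)))"
    (is "?lhs = ?rhs")
proof -
  let ?p = "ps (r \<cdot> x) (r \<cdot> y) \<boxtimes>\<^sub>B id2 C (w \<cdot> (r \<cdot> z))" and ?q = "ps (r \<cdot> x \<odot>\<^sub>A r \<cdot> y) (r \<cdot> z)"
  have "cmul x y \<boxtimes>\<^sub>B id2 C (w \<cdot> (r \<cdot> z)) = ((w \<rhd> radj_mul x y) \<boxtimes>\<^sub>B (w \<rhd> id2 C (r \<cdot> z))) \<bullet> ?p"
    using assms by (simp add: cmul_def B.T2_merge)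
  then have "?lhs =
    (w \<rhd> ((r \<rhd> alB x y z) \<bullet> (radj_mul (x \<odot>\<^sub>B y) z \<bullet> (radj_mul x y \<boxtimes>\<^sub>A id2 C (r \<cdot> z))))) \<bullet> (?q \<bullet> ?p)"
    using assms A.vcomp_reassoc[OF ps_nat[of "radj_mul x y" "id2 C (r \<cdot> z)"]] by (simp add: cmul_def)
  also have "\<dots> = (w \<rhd> radj_mul x (y \<odot>\<^sub>B z)) \<bullet> ((w \<rhd> (id2 C (r \<cdot> x) \<boxtimes>\<^sub>A radj_mul y z)) \<bullet>
     ((w \<rhd> alA (r \<cdot> x) (r \<cdot> y) (r \<cdot> z)) \<bullet> (?q \<bullet> ?p)))"
    unfolding radj_mul_assoc[OF assms] using assms by simp
  also have "\<dots> = (w \<rhd> radj_mul x (y \<odot>\<^sub>B z)) \<bullet> (((w \<rhd> (id2 C (r \<cdot> x) \<boxtimes>\<^sub>A radj_mul y z)) \<bullet>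
     ps (r \<cdot> x) (r \<cdot> y \<odot>\<^sub>A r \<cdot> z)) \<bullet> ((id2 C (w \<cdot> (r \<cdot> x)) \<boxtimes>\<^sub>B ps (r \<cdot> y) (r \<cdot> z)) \<bullet>
     alB (w \<cdot> (r \<cdot> x)) (w \<cdot> (r \<cdot> y)) (w \<cdot> (r \<cdot> z))))"
    using assms ps_assoc[of "r \<cdot> x" "r \<cdot> y" "r \<cdot> z"] by simp
  also have "\<dots> = ?rhs"
    using assms ps_nat[of "id2 C (r \<cdot> x)" "radj_mul y z", symmetric] by (simp add: cmul_def B.T2_merge)
  finally show ?thesis .
qed

lemma cmul_la:
  assumes "x \<in> Arr C" "cod C x = XB"
  shows "(w \<cdot> r \<rhd> laB x) \<bullet> (cmul JB x \<bullet> (cuni \<boxtimes>\<^sub>B id2 C (w \<cdot> (r \<cdot> x)))) = laB (w \<cdot> (r \<cdot> x))"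
    (is "?lhs = _")
proof -
  have "cuni \<boxtimes>\<^sub>B id2 C (w \<cdot> (r \<cdot> x)) = ((w \<rhd> radj_uni) \<boxtimes>\<^sub>B (w \<rhd> id2 C (r \<cdot> x))) \<bullet> (ps0 \<boxtimes>\<^sub>B id2 C (w \<cdot> (r \<cdot> x)))"
    using assms by (simp add: cuni_def B.T2_merge)
  then have "?lhs =
    (w \<rhd> ((r \<rhd> laB x) \<bullet> (radj_mul JB x \<bullet> (radj_uni \<boxtimes>\<^sub>A id2 C (r \<cdot> x))))) \<bullet>
      (ps JA (r \<cdot> x) \<bullet> (ps0 \<boxtimes>\<^sub>B id2 C (w \<cdot> (r \<cdot> x))))"
    using assms A.vcomp_reassoc[OF ps_nat[of radj_uni "id2 C (r \<cdot> x)"]] by (simp add: cmul_def)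
  then show ?thesis unfolding radj_mul_la[OF assms] using assms by (simp add: ps_la)
qed

lemma cmul_ro:
  assumes "x \<in> Arr C" "cod C x = XB"
  shows "(w \<cdot> r \<rhd> roB x) \<bullet> (cmul x JB \<bullet> (id2 C (w \<cdot> (r \<cdot> x)) \<boxtimes>\<^sub>B cuni)) = roB (w \<cdot> (r \<cdot> x))"
    (is "?lhs = _")
proof -
  have "id2 C (w \<cdot> (r \<cdot> x)) \<boxtimes>\<^sub>B cuni = ((w \<rhd> id2 C (r \<cdot> x)) \<boxtimes>\<^sub>B (w \<rhd> radj_uni)) \<bullet> (id2 C (w \<cdot> (r \<cdot> x)) \<boxtimes>\<^sub>B ps0)"
    using assms by (simp add: cuni_def B.T2_merge)
  then have "?lhs =
    (w \<rhd> ((r \<rhd> roB x) \<bullet> (radj_mul x JB \<bullet> (id2 C (r \<cdot> x) \<boxtimes>\<^sub>A radj_uni)))) \<bullet>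
      (ps (r \<cdot> x) JA \<bullet> (id2 C (w \<cdot> (r \<cdot> x)) \<boxtimes>\<^sub>B ps0))"
    using assms A.vcomp_reassoc[OF ps_nat[of "id2 C (r \<cdot> x)" radj_uni]] by (simp add: cmul_def)
  then show ?thesis unfolding radj_mul_ro[OF assms] using assms by (simp add: ps_ro)
qed

text \<open>Naturality of \<open>ps\<close> moves both copies of \<open>\<eta>\<close> under
  \<open>w\<close>, where this is \<open>eta_monoidal\<close> at \<open>r x\<close> and
  \<open>r y\<close>.\<close>

lemma delta_monoidal:
  assumes "x \<in> Arr C" "y \<in> Arr C" "cod C x = XB" "cod C y = XB"
  shows "(w \<cdot> r \<rhd> cmul x y) \<bullet> (cmul (w \<cdot> (r \<cdot> x)) (w \<cdot> (r \<cdot> y)) \<bullet>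
      ((w \<rhd> \<eta> \<lhd> r \<cdot> x) \<boxtimes>\<^sub>B (w \<rhd> \<eta> \<lhd> r \<cdot> y))) = (w \<rhd> \<eta> \<lhd> r \<cdot> (x \<odot>\<^sub>B y)) \<bullet> cmul x y"
    (is "?lhs = ?rhs")
proof -
  have "?lhs =
      (w \<cdot> (r \<cdot> w) \<rhd> radj_mul x y) \<bullet> ((w \<rhd> ((r \<rhd> ps (r \<cdot> x) (r \<cdot> y)) \<bullet>
        (radj_mul (w \<cdot> (r \<cdot> x)) (w \<cdot> (r \<cdot> y)) \<bullet> (\<eta> \<lhd> r \<cdot> x \<boxtimes>\<^sub>A \<eta> \<lhd> r \<cdot> y)))) \<bullet> ps (r \<cdot> x) (r \<cdot> y))"
    using assms ps_nat[of "\<eta> \<lhd> r \<cdot> x" "\<eta> \<lhd> r \<cdot> y"] by (simp add: cmul_def)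
  also have "\<dots> = (w \<rhd> ((r \<cdot> w \<rhd> radj_mul x y) \<bullet> (\<eta> \<lhd> (r \<cdot> x \<odot>\<^sub>A r \<cdot> y)))) \<bullet> ps (r \<cdot> x) (r \<cdot> y)"
    using assms by (subst eta_monoidal) simp_all
  also have "\<dots> = ?rhs"
    using assms eta_nat[of "radj_mul x y", symmetric] by (simp add: cmul_def)
  finally show ?thesis .
qed

lemma delta_monoidal_unit: "(w \<cdot> r \<rhd> cuni) \<bullet> cuni = (w \<rhd> \<eta> \<lhd> r \<cdot> JB) \<bullet> cuni"
proof -
  have "(r \<rhd> ps0) \<bullet> radj_uni = (r \<rhd> ps0) \<bullet> (r \<rhd> vinv C ps0) \<bullet> (\<eta> \<lhd> JA)"
    by (simp add: radj_uni_def mate_def)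
  also have "\<dots> = (r \<rhd> (ps0 \<bullet> vinv C ps0)) \<bullet> (\<eta> \<lhd> JA)"
    by (subst A.whisk_vcomp(1)) simp_all
  finally have 1: "(r \<rhd> ps0) \<bullet> radj_uni = \<eta> \<lhd> JA" by simp
  have "(w \<cdot> r \<rhd> cuni) \<bullet> cuni = (w \<cdot> (r \<cdot> w) \<rhd> radj_uni) \<bullet> ((w \<rhd> ((r \<rhd> ps0) \<bullet> radj_uni)) \<bullet> ps0)"
    by (simp add: cuni_def)
  also have "\<dots> = (w \<rhd> ((r \<cdot> w \<rhd> radj_uni) \<bullet> (\<eta> \<lhd> JA))) \<bullet> ps0"
    unfolding 1 by simp
  also have "\<dots> = (w \<rhd> \<eta> \<lhd> r \<cdot> JB) \<bullet> cuni"
    using eta_nat[of radj_uni, symmetric] by (simp add: cuni_def)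
  finally show ?thesis .
qed

lemma eps_monoidal:
  assumes "x \<in> Arr C" "y \<in> Arr C" "cod C x = XB" "cod C y = XB"
  shows "(\<epsilon> \<lhd> (x \<odot>\<^sub>B y)) \<bullet> cmul x y = \<epsilon> \<lhd> x \<boxtimes>\<^sub>B \<epsilon> \<lhd> y"
  using assms by (simp add: cmul_def)

lemma eps_monoidal_unit: "(\<epsilon> \<lhd> JB) \<bullet> cuni = id2 C JB"
  using A.vcomp_reassoc[OF radj_uni_simps(4), of ps0] by (simp add: cuni_def)

section \<open>The comparison cells of the projection formula, and the action of one fibre on the
  other\<close>

definition proj_left :: "'m \<Rightarrow> 'm \<Rightarrow> 'c"
  where "proj_left a y = mate (a \<odot>\<^sub>A r \<cdot> y) ((id2 C (w \<cdot> a) \<boxtimes>\<^sub>B \<epsilon> \<lhd> y) \<bullet> ips a (r \<cdot> y))"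

definition proj_right :: "'m \<Rightarrow> 'm \<Rightarrow> 'c"
  where "proj_right x a = mate (r \<cdot> x \<odot>\<^sub>A a) ((\<epsilon> \<lhd> x \<boxtimes>\<^sub>B id2 C (w \<cdot> a)) \<bullet> ips (r \<cdot> x) a)"

lemma proj_left_simps [simp]:
  assumes "a \<in> Arr C" "y \<in> Arr C" "cod C a = XA" "cod C y = XB"
  shows "proj_left a y \<in> Cell C" "src C (proj_left a y) = a \<odot>\<^sub>A r \<cdot> y" "trg C (proj_left a y) = r \<cdot> (w \<cdot> a \<odot>\<^sub>B y)"
    "(\<epsilon> \<lhd> (w \<cdot> a \<odot>\<^sub>B y)) \<bullet> (w \<rhd> proj_left a y) = (id2 C (w \<cdot> a) \<boxtimes>\<^sub>B \<epsilon> \<lhd> y) \<bullet> ips a (r \<cdot> y)"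
  using assms eps_mate[of "a \<odot>\<^sub>A r \<cdot> y" "(id2 C (w \<cdot> a) \<boxtimes>\<^sub>B \<epsilon> \<lhd> y) \<bullet> ips a (r \<cdot> y)"]
  by (simp_all add: proj_left_def)

lemma proj_right_simps [simp]:
  assumes "a \<in> Arr C" "x \<in> Arr C" "cod C a = XA" "cod C x = XB"
  shows "proj_right x a \<in> Cell C" "src C (proj_right x a) = r \<cdot> x \<odot>\<^sub>A a" "trg C (proj_right x a) = r \<cdot> (x \<odot>\<^sub>B w \<cdot> a)"
    "(\<epsilon> \<lhd> (x \<odot>\<^sub>B w \<cdot> a)) \<bullet> (w \<rhd> proj_right x a) = (\<epsilon> \<lhd> x \<boxtimes>\<^sub>B id2 C (w \<cdot> a)) \<bullet> ips (r \<cdot> x) a"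
  using assms eps_mate[of "r \<cdot> x \<odot>\<^sub>A a" "(\<epsilon> \<lhd> x \<boxtimes>\<^sub>B id2 C (w \<cdot> a)) \<bullet> ips (r \<cdot> x) a"]
  by (simp_all add: proj_right_def)

lemma proj_left_eps_assoc [simp]:
  assumes "a \<in> Arr C" "y \<in> Arr C" "cod C a = XA" "cod C y = XB" "e \<in> Cell C" "trg C e = w \<cdot> (a \<odot>\<^sub>A r \<cdot> y)"
  shows "(\<epsilon> \<lhd> (w \<cdot> a \<odot>\<^sub>B y)) \<bullet> ((w \<rhd> proj_left a y) \<bullet> e) = (id2 C (w \<cdot> a) \<boxtimes>\<^sub>B \<epsilon> \<lhd> y) \<bullet> (ips a (r \<cdot> y) \<bullet> e)"
  using assms A.vcomp_reassoc[OF proj_left_simps(4)[of a y]] by simp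

text \<open>The second description of the projection cell, by which the structure of the comonad is
  linked to it: the \<open>\<epsilon>\<close> on the first factor of \<open>radj_mul\<close> is
  removed by a triangle identity.\<close>

lemma proj_left_radj_mul:
  assumes "a \<in> Arr C" "y \<in> Arr C" "cod C a = XA" "cod C y = XB"
  shows "radj_mul (w \<cdot> a) y \<bullet> (\<eta> \<lhd> a \<boxtimes>\<^sub>A id2 C (r \<cdot> y)) = proj_left a y"
    (is "?lhs = _")
proof (rule mate_eqI[of _ _ "w \<cdot> a \<odot>\<^sub>B y"])
  show "(\<epsilon> \<lhd> (w \<cdot> a \<odot>\<^sub>B y)) \<bullet> (w \<rhd> ?lhs) =
      (\<epsilon> \<lhd> (w \<cdot> a \<odot>\<^sub>B y)) \<bullet> (w \<rhd> proj_left a y)"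
    using assms ips_nat[of "\<eta> \<lhd> a" "id2 C (r \<cdot> y)"] by (simp add: B.T2_merge adj_triangles)
qed (use assms in simp_all)

lemma proj_right_radj_mul:
  assumes "a \<in> Arr C" "x \<in> Arr C" "cod C a = XA" "cod C x = XB"
  shows "radj_mul x (w \<cdot> a) \<bullet> (id2 C (r \<cdot> x) \<boxtimes>\<^sub>A \<eta> \<lhd> a) = proj_right x a"
    (is "?lhs = _")
proof (rule mate_eqI[of _ _ "x \<odot>\<^sub>B w \<cdot> a"])
  show "(\<epsilon> \<lhd> (x \<odot>\<^sub>B w \<cdot> a)) \<bullet> (w \<rhd> ?lhs) =
      (\<epsilon> \<lhd> (x \<odot>\<^sub>B w \<cdot> a)) \<bullet> (w \<rhd> proj_right x a)"
    using assms ips_nat[of "id2 C (r \<cdot> x)" "\<eta> \<lhd> a"] by (simp add: B.T2_merge adj_triangles)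
qed (use assms in simp_all)

text \<open>The comultiplication puts \<open>\<eta>\<close> on one factor; \<open>\<eta>\<close>
  followed by \<open>radj_mul\<close> is a projection cell, and what is left of \<open>cmul\<close>
  is the invertible \<open>ps\<close>. So invertibility of the fusion cell becomes a question about
  the projection cell alone.\<close>

lemma fusion_proj_left:
  assumes "x \<in> Arr C" "y \<in> Arr C" "cod C x = XB" "cod C y = XB"
  shows "cmul (w \<cdot> (r \<cdot> x)) y \<bullet> ((w \<rhd> \<eta> \<lhd> r \<cdot> x) \<boxtimes>\<^sub>B id2 C (w \<cdot> (r \<cdot> y))) =
    (w \<rhd> proj_left (r \<cdot> x) y) \<bullet> ps (r \<cdot> x) (r \<cdot> y)"
  using assms ps_nat[of "\<eta> \<lhd> r \<cdot> x" "id2 C (r \<cdot> y)"] by (simp add: cmul_def flip: proj_left_radj_mul)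

lemma fusion_proj_right:
  assumes "x \<in> Arr C" "y \<in> Arr C" "cod C x = XB" "cod C y = XB"
  shows "cmul x (w \<cdot> (r \<cdot> y)) \<bullet> (id2 C (w \<cdot> (r \<cdot> x)) \<boxtimes>\<^sub>B (w \<rhd> \<eta> \<lhd> r \<cdot> y)) =
    (w \<rhd> proj_right x (r \<cdot> y)) \<bullet> ps (r \<cdot> x) (r \<cdot> y)"
  using assms ps_nat[of "id2 C (r \<cdot> x)" "\<eta> \<lhd> r \<cdot> y"] by (simp add: cmul_def flip: proj_right_radj_mul)

lemma proj_left_nat:
  assumes "a \<in> Cell C" "b \<in> Cell C" "cod C (src C a) = XA" "cod C (src C b) = XB"
  shows "proj_left (trg C a) (trg C b) \<bullet> (a \<boxtimes>\<^sub>A (r \<rhd> b)) = (r \<rhd> ((w \<rhd> a) \<boxtimes>\<^sub>B b)) \<bullet> proj_left (src C a) (src C b)"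
    (is "?lhs = ?rhs")
proof (rule mate_eqI[of _ _ "w \<cdot> trg C a \<odot>\<^sub>B trg C b"])
  show "(\<epsilon> \<lhd> (w \<cdot> trg C a \<odot>\<^sub>B trg C b)) \<bullet> (w \<rhd> ?lhs) =
    (\<epsilon> \<lhd> (w \<cdot> trg C a \<odot>\<^sub>B trg C b)) \<bullet> (w \<rhd> ?rhs)"
    using assms ips_nat[of a "r \<rhd> b"] A.vcomp_reassoc[OF eps_nat[of "(w \<rhd> a) \<boxtimes>\<^sub>B b"]]
    by (simp add: B.T2_merge eps_nat)
qed (use assms in simp_all)

text \<open>\<open>act_assoc\<close> and \<open>act_unit\<close> make \<open>(a, y) \<mapsto> w a \<odot> y\<close> an action of the 1-cells into \<open>XA\<close>.\<close>

definition act_assoc :: "'m \<Rightarrow> 'm \<Rightarrow> 'm \<Rightarrow> 'c"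
  where "act_assoc a b y = alB (w \<cdot> a) (w \<cdot> b) y \<bullet> (ips a b \<boxtimes>\<^sub>B id2 C y)"

definition act_unit :: "'m \<Rightarrow> 'c"
  where "act_unit y = laB y \<bullet> (vinv C ps0 \<boxtimes>\<^sub>B id2 C y)"

lemma act_assoc_simps [simp]:
  assumes "a \<in> Arr C" "b \<in> Arr C" "y \<in> Arr C" "cod C a = XA" "cod C b = XA" "cod C y = XB"
  shows "act_assoc a b y \<in> Cell C" "src C (act_assoc a b y) = w \<cdot> (a \<odot>\<^sub>A b) \<odot>\<^sub>B y"
    "trg C (act_assoc a b y) = w \<cdot> a \<odot>\<^sub>B (w \<cdot> b \<odot>\<^sub>B y)" "invertible C (act_assoc a b y)"
  using assms by (simp_all add: act_assoc_def)

lemma act_unit_simps [simp]: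
  assumes "y \<in> Arr C" "cod C y = XB"
  shows "act_unit y \<in> Cell C" "src C (act_unit y) = w \<cdot> JA \<odot>\<^sub>B y" "trg C (act_unit y) = y" "invertible C (act_unit y)"
  using assms by (simp_all add: act_unit_def)

lemma act_assoc_nat:
  assumes "a \<in> Cell C" "b \<in> Cell C" "y \<in> Cell C" "cod C (src C a) = XA" "cod C (src C b) = XA" "cod C (src C y) = XB"
  shows "act_assoc (trg C a) (trg C b) (trg C y) \<bullet> ((w \<rhd> (a \<boxtimes>\<^sub>A b)) \<boxtimes>\<^sub>B y) =
    ((w \<rhd> a) \<boxtimes>\<^sub>B ((w \<rhd> b) \<boxtimes>\<^sub>B y)) \<bullet> act_assoc (src C a) (src C b) (src C y)"
    (is "?lhs = ?rhs")
proof -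
  have "?lhs =
    (alB (w \<cdot> trg C a) (w \<cdot> trg C b) (trg C y) \<bullet> ((w \<rhd> a) \<boxtimes>\<^sub>B (w \<rhd> b) \<boxtimes>\<^sub>B y)) \<bullet>
      (ips (src C a) (src C b) \<boxtimes>\<^sub>B id2 C (src C y))"
    using assms by (simp add: act_assoc_def B.T2_merge ips_nat)
  also have "\<dots> = ?rhs"
    using assms B.al_nat[of "w \<rhd> a" "w \<rhd> b" y] by (simp add: act_assoc_def)
  finally show ?thesis .
qed

text \<open>The pentagon over \<open>B\<close> combined with the associativity law for the inverses
  of \<open>ps\<close>.\<close>

lemma act_assoc_pentagon:
  assumes "a \<in> Arr C" "b \<in> Arr C" "c \<in> Arr C" "y \<in> Arr C"
    "cod C a = XA" "cod C b = XA" "cod C c = XA" "cod C y = XB"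
  shows "act_assoc a b (w \<cdot> c \<odot>\<^sub>B y) \<bullet> act_assoc (a \<odot>\<^sub>A b) c y =
    (id2 C (w \<cdot> a) \<boxtimes>\<^sub>B act_assoc b c y) \<bullet> (act_assoc a (b \<odot>\<^sub>A c) y \<bullet> ((w \<rhd> alA a b c) \<boxtimes>\<^sub>B id2 C y))"
    (is "?lhs = ?rhs")
proof -
  let ?t = "((ips a b \<boxtimes>\<^sub>B id2 C (w \<cdot> c)) \<bullet> ips (a \<odot>\<^sub>A b) c) \<boxtimes>\<^sub>B id2 C y"
  let ?s = "(ips a (b \<odot>\<^sub>A c) \<bullet> (w \<rhd> alA a b c)) \<boxtimes>\<^sub>B id2 C y"
  have "?lhs =
      (alB (w \<cdot> a) (w \<cdot> b) (w \<cdot> c \<odot>\<^sub>B y) \<bullet> alB (w \<cdot> a \<odot>\<^sub>B w \<cdot> b) (w \<cdot> c) y) \<bullet> ?t"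
    using assms A.vcomp_reassoc[OF B.al_nat[of "ips a b" "id2 C (w \<cdot> c)" "id2 C y", symmetric]]
    by (simp add: act_assoc_def B.T2_merge)
  also have "\<dots> = (id2 C (w \<cdot> a) \<boxtimes>\<^sub>B alB (w \<cdot> b) (w \<cdot> c) y) \<bullet> (alB (w \<cdot> a) (w \<cdot> b \<odot>\<^sub>B w \<cdot> c) y \<bullet>
      ((alB (w \<cdot> a) (w \<cdot> b) (w \<cdot> c) \<bullet> ((ips a b \<boxtimes>\<^sub>B id2 C (w \<cdot> c)) \<bullet> ips (a \<odot>\<^sub>A b) c)) \<boxtimes>\<^sub>B id2 C y))"
    using assms by (simp add: B.pentagon B.T2_merge)
  also have "\<dots> = (id2 C (w \<cdot> a) \<boxtimes>\<^sub>B alB (w \<cdot> b) (w \<cdot> c) y) \<bullet>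
      ((alB (w \<cdot> a) (w \<cdot> b \<odot>\<^sub>B w \<cdot> c) y \<bullet> (id2 C (w \<cdot> a) \<boxtimes>\<^sub>B ips b c \<boxtimes>\<^sub>B id2 C y)) \<bullet> ?s)"
    using assms by (simp add: B.T2_merge flip: ips_assoc)
  also have "\<dots> = ?rhs"
    using assms B.al_nat[of "id2 C (w \<cdot> a)" "ips b c" "id2 C y"] by (simp add: act_assoc_def B.T2_merge)
  finally show ?thesis .
qed

text \<open>Rests on \<open>la_T\<close>, the unit law derived from pentagon and triangle by Kelly's
  argument.\<close>

lemma act_unit_act_assoc:
  assumes "a \<in> Arr C" "y \<in> Arr C" "cod C a = XA" "cod C y = XB"
  shows "act_unit (w \<cdot> a \<odot>\<^sub>B y) \<bullet> act_assoc JA a y = (w \<rhd> laA a) \<boxtimes>\<^sub>B id2 C y"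
    (is "?lhs = _")
proof -
  have "?lhs = (laB (w \<cdot> a \<odot>\<^sub>B y) \<bullet> alB JB (w \<cdot> a) y) \<bullet>
      (((vinv C ps0 \<boxtimes>\<^sub>B id2 C (w \<cdot> a)) \<bullet> ips JA a) \<boxtimes>\<^sub>B id2 C y)"
    using assms A.vcomp_reassoc[OF B.al_nat[of "vinv C ps0" "id2 C (w \<cdot> a)" "id2 C y", symmetric]]
    by (simp add: act_assoc_def act_unit_def B.T2_merge)
  also have "\<dots> = (w \<rhd> laA a) \<boxtimes>\<^sub>B id2 C y"
    using assms by (simp add: B.la_T B.T2_merge ips_la)
  finally show ?thesis .
qed

lemma act_assoc_triangle:
  assumes "a \<in> Arr C" "y \<in> Arr C" "cod C a = XA" "cod C y = XB"
  shows "(id2 C (w \<cdot> a) \<boxtimes>\<^sub>B act_unit y) \<bullet> act_assoc a JA y = (w \<rhd> roA a) \<boxtimes>\<^sub>B id2 C y"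
    (is "?lhs = _")
proof -
  have "?lhs = (id2 C (w \<cdot> a) \<boxtimes>\<^sub>B laB y) \<bullet>
      ((id2 C (w \<cdot> a) \<boxtimes>\<^sub>B (vinv C ps0 \<boxtimes>\<^sub>B id2 C y)) \<bullet> (alB (w \<cdot> a) (w \<cdot> JA) y \<bullet> (ips a JA \<boxtimes>\<^sub>B id2 C y)))"
    using assms by (simp add: act_assoc_def act_unit_def B.T2_merge)
  also have "\<dots> = ((id2 C (w \<cdot> a) \<boxtimes>\<^sub>B laB y) \<bullet> alB (w \<cdot> a) JB y) \<bullet>
      (((id2 C (w \<cdot> a) \<boxtimes>\<^sub>B vinv C ps0) \<bullet> ips a JA) \<boxtimes>\<^sub>B id2 C y)"
    using assms A.vcomp_reassoc[OF B.al_nat[of "id2 C (w \<cdot> a)" "vinv C ps0" "id2 C y", symmetric]]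
    by (simp add: B.T2_merge)
  also have "\<dots> = (w \<rhd> roA a) \<boxtimes>\<^sub>B id2 C y"
    using assms by (simp add: B.triangle B.T2_merge ips_ro)
  finally show ?thesis .
qed

text \<open>This law and \<open>proj_left_act_unit\<close> say that \<open>r\<close> is a lax
  morphism of modules over the fibre of \<open>A\<close>, which acts on itself by the tensor product
  and on the other fibre through \<open>w\<close>. They let projection cells pass through the
  coevaluation and evaluation of a dual.\<close>

lemma proj_left_act_assoc:
  assumes "a \<in> Arr C" "b \<in> Arr C" "y \<in> Arr C" "cod C a = XA" "cod C b = XA" "cod C y = XB"
  shows "(r \<rhd> act_assoc a b y) \<bullet> proj_left (a \<odot>\<^sub>A b) y = proj_left a (w \<cdot> b \<odot>\<^sub>B y) \<bullet> ((id2 C a \<boxtimes>\<^sub>A proj_left b y) \<bullet> alA a b (r \<cdot> y))"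
    (is "?lhs = ?rhs")
proof (rule mate_eqI[of _ _ "w \<cdot> a \<odot>\<^sub>B (w \<cdot> b \<odot>\<^sub>B y)"])
  let ?p = "(ips a b \<boxtimes>\<^sub>B id2 C (w \<cdot> (r \<cdot> y))) \<bullet> ips (a \<odot>\<^sub>A b) (r \<cdot> y)"
  have "(\<epsilon> \<lhd> (w \<cdot> a \<odot>\<^sub>B (w \<cdot> b \<odot>\<^sub>B y))) \<bullet> (w \<rhd> ?rhs) =
      (id2 C (w \<cdot> a) \<boxtimes>\<^sub>B ((id2 C (w \<cdot> b) \<boxtimes>\<^sub>B \<epsilon> \<lhd> y) \<bullet> ips b (r \<cdot> y))) \<bullet> (ips a (b \<odot>\<^sub>A r \<cdot> y) \<bullet> (w \<rhd> alA a b (r \<cdot> y)))"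
    using assms A.vcomp_reassoc[OF ips_nat[of "id2 C a" "proj_left b y"]] by (simp add: B.T2_merge)
  also have "\<dots> = (id2 C (w \<cdot> a) \<boxtimes>\<^sub>B (id2 C (w \<cdot> b) \<boxtimes>\<^sub>B \<epsilon> \<lhd> y)) \<bullet>
     ((id2 C (w \<cdot> a) \<boxtimes>\<^sub>B ips b (r \<cdot> y)) \<bullet> (ips a (b \<odot>\<^sub>A r \<cdot> y) \<bullet> (w \<rhd> alA a b (r \<cdot> y))))"
    using assms by (simp add: B.T2_merge)
  also have "\<dots> = ((id2 C (w \<cdot> a) \<boxtimes>\<^sub>B (id2 C (w \<cdot> b) \<boxtimes>\<^sub>B \<epsilon> \<lhd> y)) \<bullet> alB (w \<cdot> a) (w \<cdot> b) (w \<cdot> (r \<cdot> y))) \<bullet> ?p"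
    using assms ips_assoc[of a b "r \<cdot> y"] by simp
  also have "\<dots> = act_assoc a b y \<bullet> ((id2 C (w \<cdot> (a \<odot>\<^sub>A b)) \<boxtimes>\<^sub>B \<epsilon> \<lhd> y) \<bullet> ips (a \<odot>\<^sub>A b) (r \<cdot> y))"
    using assms B.al_nat[of "id2 C (w \<cdot> a)" "id2 C (w \<cdot> b)" "\<epsilon> \<lhd> y", symmetric]
    by (simp add: act_assoc_def B.T2_merge)
  also have "\<dots> = (\<epsilon> \<lhd> (w \<cdot> a \<odot>\<^sub>B (w \<cdot> b \<odot>\<^sub>B y))) \<bullet> (w \<rhd> ?lhs)"
    using assms A.vcomp_reassoc[OF eps_nat[of "act_assoc a b y"]] by simp
  finally show "(\<epsilon> \<lhd> (w \<cdot> a \<odot>\<^sub>B (w \<cdot> b \<odot>\<^sub>B y))) \<bullet> (w \<rhd> ?lhs) =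
     (\<epsilon> \<lhd> (w \<cdot> a \<odot>\<^sub>B (w \<cdot> b \<odot>\<^sub>B y))) \<bullet> (w \<rhd> ?rhs)"
    by simp
qed (use assms in simp_all)

lemma proj_left_act_unit:
  assumes "y \<in> Arr C" "cod C y = XB"
  shows "(r \<rhd> act_unit y) \<bullet> proj_left JA y = laA (r \<cdot> y)"
proof (rule mate_eqI[of _ _ y])
  have "(\<epsilon> \<lhd> y) \<bullet> (w \<rhd> ((r \<rhd> act_unit y) \<bullet> proj_left JA y)) = laB y \<bullet> ((vinv C ps0 \<boxtimes>\<^sub>B \<epsilon> \<lhd> y) \<bullet> ips JA (r \<cdot> y))"
    using assms A.vcomp_reassoc[OF eps_nat[of "act_unit y"]] by (simp add: act_unit_def B.T2_merge)
  also have "\<dots> = (laB y \<bullet> (id2 C JB \<boxtimes>\<^sub>B \<epsilon> \<lhd> y)) \<bullet> ((vinv C ps0 \<boxtimes>\<^sub>B id2 C (w \<cdot> (r \<cdot> y))) \<bullet> ips JA (r \<cdot> y))"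
    using assms by (simp add: B.T2_merge)
  also have "\<dots> = (\<epsilon> \<lhd> y) \<bullet> (w \<rhd> laA (r \<cdot> y))"
    using assms B.la_nat[of "\<epsilon> \<lhd> y"] ips_la[of "r \<cdot> y"] by simp
  finally show "(\<epsilon> \<lhd> y) \<bullet> (w \<rhd> ((r \<rhd> act_unit y) \<bullet> proj_left JA y)) = (\<epsilon> \<lhd> y) \<bullet> (w \<rhd> laA (r \<cdot> y))" .
qed (use assms in simp_all)

end

section \<open>The monoidal category of 1-cells into a pseudomonoid\<close>

definition elt_tens2 :: "('o, 'm, 'c) gray \<Rightarrow> ('o, 'm, 'c) pmon \<Rightarrow> 'c \<Rightarrow> 'c \<Rightarrow> 'c"
  where "elt_tens2 G P a b = mul P \<rhd> (a \<otimes>\<^sub>2 b)"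
  for G (structure)

text \<open>A comparison cell is needed on one side only: regrouping \<open>m (x y) z\<close> moves
  \<open>m\<close> on the first factor past \<open>z\<close>, whereas \<open>x m (y z)\<close>
  regroups strictly. For the same reason \<open>elt_lunit\<close> contains a comparison cell and
  \<open>elt_runit\<close> contains none.\<close>

definition elt_assoc :: "('o, 'm, 'c) gray \<Rightarrow> ('o, 'm, 'c) pmon \<Rightarrow> 'm \<Rightarrow> 'm \<Rightarrow> 'm \<Rightarrow> 'c"
  where "elt_assoc G P x y z = (pa P \<lhd> (x \<otimes>\<^sub>1 (y \<otimes>\<^sub>1 z))) \<bullet>
    (mul P \<rhd> tsplit G (mul P) (id1 G (ob P)) (x \<otimes>\<^sub>1 y) z)"
  for G (structure)

definition elt_lunit :: "('o, 'm, 'c) gray \<Rightarrow> ('o, 'm, 'c) pmon \<Rightarrow> 'm \<Rightarrow> 'c"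
  where "elt_lunit G P x = (pl P \<lhd> x) \<bullet>
    (mul P \<rhd> tsplit G (uni P) (id1 G (ob P)) (id1 G (unit_obj G)) x)"
  for G (structure)

definition elt_runit :: "('o, 'm, 'c) gray \<Rightarrow> ('o, 'm, 'c) pmon \<Rightarrow> 'm \<Rightarrow> 'c"
  where "elt_runit G P x = pr P \<lhd> x"
  for G (structure)

context gray_monoid
begin

lemma tens2_whisk_strict [simp]:
  assumes "a \<in> Cell G" "b \<in> Cell G" "f \<in> Arr G"
  shows "\<lbrakk>X = cod G (src G a); cod G (src G b) = dom G f\<rbrakk> \<Longrightarrow>
      (id1 G X \<otimes>\<^sub>1 f) \<rhd> (a \<otimes>\<^sub>2 b) = a \<otimes>\<^sub>2 (f \<rhd> b)"
    "\<lbrakk>X = dom G (src G b); cod G f = dom G (src G a)\<rbrakk> \<Longrightarrow>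
      (a \<otimes>\<^sub>2 b) \<lhd> (f \<otimes>\<^sub>1 id1 G X) = (a \<lhd> f) \<otimes>\<^sub>2 b"
  using assms by (simp_all add: tens2_def tens1_def lwhisk_def rwhisk_def hcomp_assoc' flip: hcomp_assoc'[of _ "id2 G f \<otimes>\<^sub>R\<^sub>2 X"])
    
lemma tens2_id_whisk:
  assumes "f \<in> Arr G" "g \<in> Arr G" "a \<in> Cell G" "X \<in> Obj G"
  shows "\<lbrakk>cod G f = X; cod G g = dom G (src G a)\<rbrakk> \<Longrightarrow>
      (id2 G (id1 G X) \<otimes>\<^sub>2 a) \<lhd> (f \<otimes>\<^sub>1 g) = id2 G f \<otimes>\<^sub>2 (a \<lhd> g)"
    "\<lbrakk>dom G g = X; cod G (src G a) = dom G f\<rbrakk> \<Longrightarrow>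
      (f \<otimes>\<^sub>1 g) \<rhd> (a \<otimes>\<^sub>2 id2 G (id1 G X)) = (f \<rhd> a) \<otimes>\<^sub>2 id2 G g"
  using assms by (simp_all add: tens2_def tens1_def flip: lwhisk_def rwhisk_def)

end

locale pseudomonoid_in = gray_monoid G
  for G :: "('o, 'm, 'c) gray" (structure) +
  fixes P :: "('o, 'm, 'c) pmon"
  assumes pseudomonoid: "pseudomonoid G P"
begin

abbreviation "m \<equiv> mul P"
abbreviation "u \<equiv> uni P"
abbreviation "B \<equiv> ob P"
abbreviation "one \<equiv> id1 G (ob P)"

lemma pmon_simps [simp]:
  "B \<in> Obj G" "m \<in> Arr G" "dom G m = B \<otimes>\<^sub>0 B" "cod G m = B" "u \<in> Arr G" "dom G u = unit_obj G" "cod G u = B"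
  "pa P \<in> Cell G" "src G (pa P) = (m \<cdot> (m \<otimes>\<^sub>1 one))" "trg G (pa P) = (m \<cdot> (one \<otimes>\<^sub>1 m))" "invertible G (pa P)"
  "pl P \<in> Cell G" "src G (pl P) = (m \<cdot> (u \<otimes>\<^sub>1 one))" "trg G (pl P) = one" "invertible G (pl P)"
  "pr P \<in> Cell G" "src G (pr P) = (m \<cdot> (one \<otimes>\<^sub>1 u))" "trg G (pr P) = one" "invertible G (pr P)"
  using pseudomonoid
  by (auto simp: pseudomonoid_def Let_def iso2_def mem_hom1 mem_hom2 act1_tens1)

lemma pmon_pentagon:
  "(pa P \<lhd> (id1 G (B \<otimes>\<^sub>0 B) \<otimes>\<^sub>1 m)) \<bullet> ((m \<rhd> tsplit G m one (id1 G (B \<otimes>\<^sub>0 B)) m) \<bullet>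
      (pa P \<lhd> (m \<otimes>\<^sub>1 id1 G (B \<otimes>\<^sub>0 B)))) =
   (m \<rhd> (id2 G one \<otimes>\<^sub>2 pa P)) \<bullet> ((pa P \<lhd> (one \<otimes>\<^sub>1 (m \<otimes>\<^sub>1 one))) \<bullet> (m \<rhd> (pa P \<otimes>\<^sub>2 id2 G one)))"
proof -
  \<comment> \<open>The interchange cell in the axiom is a comparison cell with identities for its
    remaining 1-cells, hence subject to the laws of \<open>tsplit\<close>.\<close>
  have *: "gi G m m = tsplit G m one (id1 G (B \<otimes>\<^sub>0 B)) m"
    by (simp add: tsplit_def)
  have 1: "(pa P \<lhd> ((B \<otimes>\<^sub>0 B) \<otimes>\<^sub>L m)) \<bullet> (m \<rhd> gi G m m) \<bullet> (pa P \<lhd> (m \<otimes>\<^sub>R (B \<otimes>\<^sub>0 B))) =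
      (m \<rhd> (B \<otimes>\<^sub>L\<^sub>2 pa P)) \<bullet> (pa P \<lhd> (B \<otimes>\<^sub>L (m \<otimes>\<^sub>R B))) \<bullet> (m \<rhd> (pa P \<otimes>\<^sub>R\<^sub>2 B))"
    using pseudomonoid by (simp add: pseudomonoid_def Let_def)
  have t: "(B \<otimes>\<^sub>0 B) \<otimes>\<^sub>L m = id1 G (B \<otimes>\<^sub>0 B) \<otimes>\<^sub>1 m" "m \<otimes>\<^sub>R (B \<otimes>\<^sub>0 B) = m \<otimes>\<^sub>1 id1 G (B \<otimes>\<^sub>0 B)"
     "B \<otimes>\<^sub>L\<^sub>2 pa P = id2 G one \<otimes>\<^sub>2 pa P" "B \<otimes>\<^sub>L (m \<otimes>\<^sub>R B) = one \<otimes>\<^sub>1 (m \<otimes>\<^sub>1 one)"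
     "pa P \<otimes>\<^sub>R\<^sub>2 B = pa P \<otimes>\<^sub>2 id2 G one"
    by (simp_all only: act1_tens1 act2_tens2 pmon_simps tens1_simps id1_simps act1_simps tens0_simps)
  show ?thesis using 1 unfolding t * by simp
qed

lemma pmon_triangle:
  "(m \<rhd> (id2 G one \<otimes>\<^sub>2 pl P)) \<bullet> (pa P \<lhd> (one \<otimes>\<^sub>1 (u \<otimes>\<^sub>1 one))) = m \<rhd> (pr P \<otimes>\<^sub>2 id2 G one)"
proof -
  have 1: "(m \<rhd> (B \<otimes>\<^sub>L\<^sub>2 pl P)) \<bullet> (pa P \<lhd> (B \<otimes>\<^sub>L (u \<otimes>\<^sub>R B))) = m \<rhd> (pr P \<otimes>\<^sub>R\<^sub>2 B)"
    using pseudomonoid by (simp add: pseudomonoid_def Let_def)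
  have t: "B \<otimes>\<^sub>L\<^sub>2 pl P = id2 G one \<otimes>\<^sub>2 pl P" "B \<otimes>\<^sub>L (u \<otimes>\<^sub>R B) = one \<otimes>\<^sub>1 (u \<otimes>\<^sub>1 one)"
     "pr P \<otimes>\<^sub>R\<^sub>2 B = pr P \<otimes>\<^sub>2 id2 G one"
    by (simp_all only: act1_tens1 act2_tens2 pmon_simps tens1_simps id1_simps act1_simps tens0_simps)
  show ?thesis using 1 unfolding t .
qed

lemma elt_assoc_simps:
  assumes "x \<in> Arr G" "y \<in> Arr G" "z \<in> Arr G" "cod G x = B" "cod G y = B" "cod G z = B"
  shows "elt_assoc G P x y z \<in> Cell G" "src G (elt_assoc G P x y z) = m \<cdot> ((m \<cdot> (x \<otimes>\<^sub>1 y)) \<otimes>\<^sub>1 z)"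
    "trg G (elt_assoc G P x y z) = m \<cdot> (x \<otimes>\<^sub>1 (m \<cdot> (y \<otimes>\<^sub>1 z)))" "invertible G (elt_assoc G P x y z)"
  using assms by (simp_all add: elt_assoc_def)

lemma elt_assoc_nat:
  assumes "a \<in> Cell G" "b \<in> Cell G" "c \<in> Cell G"
    "cod G (src G a) = B" "cod G (src G b) = B" "cod G (src G c) = B"
  shows "elt_assoc G P (trg G a) (trg G b) (trg G c) \<bullet> (m \<rhd> ((m \<rhd> (a \<otimes>\<^sub>2 b)) \<otimes>\<^sub>2 c)) =
    (m \<rhd> (a \<otimes>\<^sub>2 (m \<rhd> (b \<otimes>\<^sub>2 c)))) \<bullet> elt_assoc G P (src G a) (src G b) (src G c)"
    (is "?lhs = ?rhs")
proof -
  let ?K = "\<lambda>a b c. tsplit G m one (a \<otimes>\<^sub>1 b) c"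
  have 1: "?K (trg G a) (trg G b) (trg G c) \<bullet> ((m \<rhd> (a \<otimes>\<^sub>2 b)) \<otimes>\<^sub>2 c) =
      ((m \<otimes>\<^sub>1 one) \<rhd> (a \<otimes>\<^sub>2 (b \<otimes>\<^sub>2 c))) \<bullet> ?K (src G a) (src G b) (src G c)"
    using assms tsplit_nat[of "a \<otimes>\<^sub>2 b" c "id2 G m" "id2 G one"]
    by (simp flip: lwhisk_def)
  have 2: "(pa P \<lhd> (trg G a \<otimes>\<^sub>1 (trg G b \<otimes>\<^sub>1 trg G c))) \<bullet> ((m \<cdot> (m \<otimes>\<^sub>1 one)) \<rhd> (a \<otimes>\<^sub>2 (b \<otimes>\<^sub>2 c))) =
      (m \<rhd> (a \<otimes>\<^sub>2 (m \<rhd> (b \<otimes>\<^sub>2 c)))) \<bullet> (pa P \<lhd> (src G a \<otimes>\<^sub>1 (src G b \<otimes>\<^sub>1 src G c)))"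
    using assms whisk_interchange[of "a \<otimes>\<^sub>2 (b \<otimes>\<^sub>2 c)" "pa P", symmetric]
    by (simp flip: whisk_whisk(1))
  have "?lhs =
     (pa P \<lhd> (trg G a \<otimes>\<^sub>1 (trg G b \<otimes>\<^sub>1 trg G c))) \<bullet>
      (m \<rhd> (?K (trg G a) (trg G b) (trg G c) \<bullet> ((m \<rhd> (a \<otimes>\<^sub>2 b)) \<otimes>\<^sub>2 c)))"
    using assms by (simp add: elt_assoc_def)
  also have "\<dots> = (pa P \<lhd> (trg G a \<otimes>\<^sub>1 (trg G b \<otimes>\<^sub>1 trg G c))) \<bullet> ((m \<cdot> (m \<otimes>\<^sub>1 one)) \<rhd> (a \<otimes>\<^sub>2 (b \<otimes>\<^sub>2 c)))
      \<bullet> (m \<rhd> ?K (src G a) (src G b) (src G c))"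
    unfolding 1 using assms by simp
  also have "\<dots> = ?rhs"
    unfolding 2 using assms by (simp add: elt_assoc_def)
  finally show ?thesis .
qed

text \<open>The comparison cells are slid past \<open>pa\<close> by interchange and naturality until
  the copies of \<open>pa\<close> stand over the fourfold tensor \<open>?Q\<close>. There the
  pentagon of \<open>P\<close> applies; the comparison cells match by \<open>tsplit_assoc\<close>
  and \<open>tsplit_tens\<close>.\<close>

lemma elt_pentagon:
  assumes "v \<in> Arr G" "x \<in> Arr G" "y \<in> Arr G" "z \<in> Arr G"
    "cod G v = B" "cod G x = B" "cod G y = B" "cod G z = B"
  shows "elt_assoc G P v x ((m \<cdot> (y \<otimes>\<^sub>1 z))) \<bullet> elt_assoc G P ((m \<cdot> (v \<otimes>\<^sub>1 x))) y z =
    (m \<rhd> (id2 G v \<otimes>\<^sub>2 elt_assoc G P x y z)) \<bullet>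
      (elt_assoc G P v ((m \<cdot> (x \<otimes>\<^sub>1 y))) z \<bullet> (m \<rhd> (elt_assoc G P v x y \<otimes>\<^sub>2 id2 G z)))"
    (is "?lhs = ?rhs")
proof -
  let ?BB = "id1 G (B \<otimes>\<^sub>0 B)" and ?Q = "v \<otimes>\<^sub>1 (x \<otimes>\<^sub>1 (y \<otimes>\<^sub>1 z))"
  let ?K1 = "tsplit G m ?BB (v \<otimes>\<^sub>1 x) (y \<otimes>\<^sub>1 z)" and ?K2 = "tsplit G m one ((m \<cdot> (v \<otimes>\<^sub>1 x)) \<otimes>\<^sub>1 y) z"
  let ?K3 = "tsplit G m one (x \<otimes>\<^sub>1 y) z"
  have [simp]: "((m \<cdot> (one \<otimes>\<^sub>1 m)) \<otimes>\<^sub>1 one) \<cdot> ?Q = (m \<otimes>\<^sub>1 one) \<cdot> (v \<otimes>\<^sub>1 ((m \<otimes>\<^sub>1 one) \<cdot> (x \<otimes>\<^sub>1 (y \<otimes>\<^sub>1 z))))"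
    using assms by (simp add: tens1_def)
  have mm: "tsplit G m m (v \<otimes>\<^sub>1 x) (y \<otimes>\<^sub>1 z) = (one \<otimes>\<^sub>1 m) \<rhd> ?K1"
    using assms tsplit_assoc[of "v \<otimes>\<^sub>1 x" "y \<otimes>\<^sub>1 z" m ?BB one m] by simp
  have 1: "tsplit G m one (v \<otimes>\<^sub>1 x) ((m \<cdot> (y \<otimes>\<^sub>1 z))) = (tsplit G m one ?BB m \<lhd> ?Q) \<bullet> ((one \<otimes>\<^sub>1 m) \<rhd> ?K1)"
    using assms tsplit_assoc[of "v \<otimes>\<^sub>1 x" "y \<otimes>\<^sub>1 z" ?BB m m one] by (simp add: mm)
  have 2: "((m \<cdot> (one \<otimes>\<^sub>1 m)) \<rhd> ?K1) \<bullet> (pa P \<lhd> ((m \<cdot> (v \<otimes>\<^sub>1 x)) \<otimes>\<^sub>1 (y \<otimes>\<^sub>1 z))) =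
      (pa P \<lhd> (m \<otimes>\<^sub>1 ?BB) \<cdot> ?Q) \<bullet> ((m \<cdot> (m \<otimes>\<^sub>1 one)) \<rhd> ?K1)"
    using assms whisk_interchange[of ?K1 "pa P"] by simp
  have K3: "tsplit G (one \<otimes>\<^sub>1 m) one (v \<otimes>\<^sub>1 (x \<otimes>\<^sub>1 y)) z = id2 G v \<otimes>\<^sub>2 ?K3"
    using assms tsplit_tens[of v "x \<otimes>\<^sub>1 y" z one m one] by simp
  have 3: "((m \<otimes>\<^sub>1 one) \<rhd> (id2 G v \<otimes>\<^sub>2 ?K3)) \<bullet> tsplit G m one (v \<otimes>\<^sub>1 (m \<cdot> (x \<otimes>\<^sub>1 y))) z =
      tsplit G ((m \<cdot> (one \<otimes>\<^sub>1 m))) one (v \<otimes>\<^sub>1 (x \<otimes>\<^sub>1 y)) z"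
    using assms tsplit_assoc[of "v \<otimes>\<^sub>1 (x \<otimes>\<^sub>1 y)" z "one \<otimes>\<^sub>1 m" one m one] by (simp add: K3)
  have 4: "tsplit G ((m \<cdot> (one \<otimes>\<^sub>1 m))) one (v \<otimes>\<^sub>1 (x \<otimes>\<^sub>1 y)) z \<bullet> ((pa P \<lhd> (v \<otimes>\<^sub>1 (x \<otimes>\<^sub>1 y))) \<otimes>\<^sub>2 id2 G z) =
      ((pa P \<otimes>\<^sub>2 id2 G one) \<lhd> ?Q) \<bullet> tsplit G ((m \<cdot> (m \<otimes>\<^sub>1 one))) one (v \<otimes>\<^sub>1 (x \<otimes>\<^sub>1 y)) z"
    using assms tsplit_nat[of "id2 G (v \<otimes>\<^sub>1 (x \<otimes>\<^sub>1 y))" "id2 G z" "pa P" "id2 G one"]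
    by (simp flip: rwhisk_def)
  have K5: "tsplit G (m \<otimes>\<^sub>1 one) one (v \<otimes>\<^sub>1 (x \<otimes>\<^sub>1 y)) z \<bullet> (tsplit G m one (v \<otimes>\<^sub>1 x) y \<otimes>\<^sub>2 id2 G z) = ?K1"
    using assms tsplit_tens[of "v \<otimes>\<^sub>1 x" y z m one one] by simp
  have 5: "tsplit G ((m \<cdot> (m \<otimes>\<^sub>1 one))) one (v \<otimes>\<^sub>1 (x \<otimes>\<^sub>1 y)) z \<bullet> ((m \<rhd> tsplit G m one (v \<otimes>\<^sub>1 x) y) \<otimes>\<^sub>2 id2 G z) =
      ((m \<otimes>\<^sub>1 one) \<rhd> ?K1) \<bullet> ?K2"
  proof -
    have "tsplit G m one ((m \<otimes>\<^sub>1 one) \<cdot> (v \<otimes>\<^sub>1 (x \<otimes>\<^sub>1 y))) z \<bullet> ((m \<rhd> tsplit G m one (v \<otimes>\<^sub>1 x) y) \<otimes>\<^sub>2 id2 G z) =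
        ((m \<otimes>\<^sub>1 one) \<rhd> (tsplit G m one (v \<otimes>\<^sub>1 x) y \<otimes>\<^sub>2 id2 G z)) \<bullet> ?K2"
      using assms tsplit_nat[of "tsplit G m one (v \<otimes>\<^sub>1 x) y" "id2 G z" "id2 G m" "id2 G one"]
      by (simp flip: lwhisk_def)
    moreover have "tsplit G ((m \<cdot> (m \<otimes>\<^sub>1 one))) one (v \<otimes>\<^sub>1 (x \<otimes>\<^sub>1 y)) z =
       ((m \<otimes>\<^sub>1 one) \<rhd> tsplit G (m \<otimes>\<^sub>1 one) one (v \<otimes>\<^sub>1 (x \<otimes>\<^sub>1 y)) z) \<bullet> tsplit G m one ((m \<otimes>\<^sub>1 one) \<cdot> (v \<otimes>\<^sub>1 (x \<otimes>\<^sub>1 y))) z"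
      using assms tsplit_assoc[of "v \<otimes>\<^sub>1 (x \<otimes>\<^sub>1 y)" z "m \<otimes>\<^sub>1 one" one m one] by simp
    ultimately show ?thesis using assms by (simp flip: K5)
  qed
  have 6: "(m \<rhd> (id2 G v \<otimes>\<^sub>2 (m \<rhd> ?K3))) \<bullet> (pa P \<lhd> (v \<otimes>\<^sub>1 ((m \<cdot> (x \<otimes>\<^sub>1 y)) \<otimes>\<^sub>1 z))) =
      (pa P \<lhd> (v \<otimes>\<^sub>1 ((m \<otimes>\<^sub>1 one) \<cdot> (x \<otimes>\<^sub>1 (y \<otimes>\<^sub>1 z))))) \<bullet> ((m \<cdot> (m \<otimes>\<^sub>1 one)) \<rhd> (id2 G v \<otimes>\<^sub>2 ?K3))"
    using assms whisk_interchange[of "id2 G v \<otimes>\<^sub>2 ?K3" "pa P"] by (simp flip: whisk_whisk(1))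
  have "?lhs =
     (pa P \<lhd> (?BB \<otimes>\<^sub>1 m) \<cdot> ?Q) \<bullet> ((m \<rhd> tsplit G m one ?BB m \<lhd> ?Q) \<bullet>
       ((((m \<cdot> (one \<otimes>\<^sub>1 m)) \<rhd> ?K1) \<bullet> (pa P \<lhd> ((m \<cdot> (v \<otimes>\<^sub>1 x)) \<otimes>\<^sub>1 (y \<otimes>\<^sub>1 z)))) \<bullet> (m \<rhd> ?K2)))"
    using assms by (simp add: elt_assoc_def 1)
  \<comment> \<open>Two copies of \<open>pa\<close>, with the interchange cell of \<open>m\<close>
    with itself between them, now stand together over \<open>?Q\<close>: this is the left side of
    the pentagon of \<open>P\<close>.\<close>
  also have "\<dots> = (((pa P \<lhd> (?BB \<otimes>\<^sub>1 m)) \<bullet> ((m \<rhd> tsplit G m one ?BB m) \<bullet>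
      (pa P \<lhd> (m \<otimes>\<^sub>1 ?BB)))) \<lhd> ?Q) \<bullet> (m \<rhd> (((m \<otimes>\<^sub>1 one) \<rhd> ?K1) \<bullet> ?K2))"
    unfolding 2 using assms by simp
  also have "\<dots> = (m \<rhd> (id2 G one \<otimes>\<^sub>2 pa P) \<lhd> ?Q) \<bullet> ((pa P \<lhd> (one \<otimes>\<^sub>1 (m \<otimes>\<^sub>1 one)) \<cdot> ?Q) \<bullet>
      (m \<rhd> (((pa P \<otimes>\<^sub>2 id2 G one) \<lhd> ?Q) \<bullet> tsplit G ((m \<cdot> (m \<otimes>\<^sub>1 one))) one (v \<otimes>\<^sub>1 (x \<otimes>\<^sub>1 y)) z) \<bullet>
        (m \<rhd> ((m \<rhd> tsplit G m one (v \<otimes>\<^sub>1 x) y) \<otimes>\<^sub>2 id2 G z))))"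
    unfolding pmon_pentagon 5[symmetric] using assms by simp
  also have "\<dots> = (m \<rhd> (id2 G one \<otimes>\<^sub>2 pa P) \<lhd> ?Q) \<bullet> (((pa P \<lhd> (v \<otimes>\<^sub>1 ((m \<otimes>\<^sub>1 one) \<cdot> (x \<otimes>\<^sub>1 (y \<otimes>\<^sub>1 z))))) \<bullet>
      ((m \<cdot> (m \<otimes>\<^sub>1 one)) \<rhd> (id2 G v \<otimes>\<^sub>2 ?K3))) \<bullet> ((m \<rhd> tsplit G m one (v \<otimes>\<^sub>1 (m \<cdot> (x \<otimes>\<^sub>1 y))) z) \<bullet>
        ((m \<rhd> ((pa P \<lhd> (v \<otimes>\<^sub>1 (x \<otimes>\<^sub>1 y))) \<otimes>\<^sub>2 id2 G z)) \<bullet>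
        (m \<rhd> ((m \<rhd> tsplit G m one (v \<otimes>\<^sub>1 x) y) \<otimes>\<^sub>2 id2 G z)))))"
    unfolding 4[symmetric] 3[symmetric] using assms by simp
  also have "\<dots> = ?rhs"
  proof -
    have "id2 G v \<otimes>\<^sub>2 elt_assoc G P x y z = ((id2 G one \<otimes>\<^sub>2 pa P) \<lhd> ?Q) \<bullet> (id2 G v \<otimes>\<^sub>2 (m \<rhd> ?K3))"
      using assms tens2_vcomp[of "id2 G v" "id2 G v" "m \<rhd> ?K3" "pa P \<lhd> (x \<otimes>\<^sub>1 (y \<otimes>\<^sub>1 z))"]
      by (simp add: elt_assoc_def tens2_id_whisk)
    moreover have "elt_assoc G P v x y \<otimes>\<^sub>2 id2 G z = ((pa P \<lhd> (v \<otimes>\<^sub>1 (x \<otimes>\<^sub>1 y))) \<otimes>\<^sub>2 id2 G z) \<bullet>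
        ((m \<rhd> tsplit G m one (v \<otimes>\<^sub>1 x) y) \<otimes>\<^sub>2 id2 G z)"
      using assms by (simp add: elt_assoc_def tens2_vcomp)
    ultimately show ?thesis unfolding 6[symmetric] using assms by (simp add: elt_assoc_def)
  qed
  finally show ?thesis .
qed

text \<open>Once the comparison cell \<open>?K\<close> has been slid past \<open>pa\<close>, this is
  the unit axiom of \<open>P\<close> restricted along the tensor of \<open>x\<close> and
  \<open>y\<close>.\<close>

lemma elt_triangle:
  assumes "x \<in> Arr G" "y \<in> Arr G" "cod G x = B" "cod G y = B"
  shows "(m \<rhd> (id2 G x \<otimes>\<^sub>2 elt_lunit G P y)) \<bullet> elt_assoc G P x u y = m \<rhd> (elt_runit G P x \<otimes>\<^sub>2 id2 G y)"
    (is "?lhs = ?rhs")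
proof -
  let ?I = "id1 G (unit_obj G)"
  let ?K = "tsplit G u one ?I y" and ?K2 = "tsplit G m one (x \<otimes>\<^sub>1 u) y"
  have 1: "(m \<rhd> (id2 G x \<otimes>\<^sub>2 (m \<rhd> ?K))) \<bullet> (pa P \<lhd> (x \<otimes>\<^sub>1 (u \<otimes>\<^sub>1 y))) =
      (pa P \<lhd> (x \<otimes>\<^sub>1 ((u \<otimes>\<^sub>1 one) \<cdot> y))) \<bullet> ((m \<cdot> (m \<otimes>\<^sub>1 one)) \<rhd> (id2 G x \<otimes>\<^sub>2 ?K))"
    using assms whisk_interchange[of "id2 G x \<otimes>\<^sub>2 ?K" "pa P"] by (simp flip: whisk_whisk(1))
  have K: "tsplit G (one \<otimes>\<^sub>1 u) one x y = id2 G x \<otimes>\<^sub>2 ?K"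
    using assms tsplit_tens[of x ?I y one u one] by simp
  have 2: "tsplit G ((m \<cdot> (one \<otimes>\<^sub>1 u))) one x y = ((m \<otimes>\<^sub>1 one) \<rhd> (id2 G x \<otimes>\<^sub>2 ?K)) \<bullet> ?K2"
  proof -
    show ?thesis
      using assms tsplit_assoc[of x y "one \<otimes>\<^sub>1 u" one m one] by (simp add: K)
  qed
  have 3: "(pr P \<lhd> x) \<otimes>\<^sub>2 id2 G y = ((pr P \<otimes>\<^sub>2 id2 G one) \<lhd> (x \<otimes>\<^sub>1 y)) \<bullet> tsplit G ((m \<cdot> (one \<otimes>\<^sub>1 u))) one x y"
    using assms tsplit_nat[of "id2 G x" "id2 G y" "pr P" "id2 G one"] by (simp flip: rwhisk_def)
  have 4: "id2 G x \<otimes>\<^sub>2 elt_lunit G P y = ((id2 G one \<otimes>\<^sub>2 pl P) \<lhd> (x \<otimes>\<^sub>1 y)) \<bullet> (id2 G x \<otimes>\<^sub>2 (m \<rhd> ?K))"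
    using assms tens2_vcomp[of "id2 G x" "id2 G x" "m \<rhd> ?K" "pl P \<lhd> y"]
    by (simp add: elt_lunit_def tens2_id_whisk)
  have "?lhs =
    (m \<rhd> (id2 G one \<otimes>\<^sub>2 pl P) \<lhd> (x \<otimes>\<^sub>1 y)) \<bullet> (((m \<rhd> (id2 G x \<otimes>\<^sub>2 (m \<rhd> ?K))) \<bullet> (pa P \<lhd> (x \<otimes>\<^sub>1 (u \<otimes>\<^sub>1 y)))) \<bullet> (m \<rhd> ?K2))"
    unfolding 4 using assms by (simp add: elt_assoc_def)
  also have "\<dots> = (((m \<rhd> (id2 G one \<otimes>\<^sub>2 pl P)) \<bullet> (pa P \<lhd> (one \<otimes>\<^sub>1 (u \<otimes>\<^sub>1 one)))) \<lhd> (x \<otimes>\<^sub>1 y)) \<bullet>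
     (m \<rhd> (((m \<otimes>\<^sub>1 one) \<rhd> (id2 G x \<otimes>\<^sub>2 ?K)) \<bullet> ?K2))"
    unfolding 1 using assms by simp
  also have "\<dots> = ?rhs"
    unfolding pmon_triangle 2[symmetric] using assms by (simp add: 3 elt_runit_def)
  finally show ?thesis .
qed

lemma elt_lunit_simps:
  assumes "x \<in> Arr G" "cod G x = B"
  shows "elt_lunit G P x \<in> Cell G" "src G (elt_lunit G P x) = (m \<cdot> (u \<otimes>\<^sub>1 x))"
    "trg G (elt_lunit G P x) = x" "invertible G (elt_lunit G P x)"
  using assms by (simp_all add: elt_lunit_def)

lemma elt_runit_simps:
  assumes "x \<in> Arr G" "cod G x = B"
  shows "elt_runit G P x \<in> Cell G" "src G (elt_runit G P x) = (m \<cdot> (x \<otimes>\<^sub>1 u))"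
    "trg G (elt_runit G P x) = x" "invertible G (elt_runit G P x)"
  using assms by (simp_all add: elt_runit_def)

lemma elt_lunit_nat:
  assumes "a \<in> Cell G" "cod G (src G a) = B"
  shows "elt_lunit G P (trg G a) \<bullet> (m \<rhd> (id2 G u \<otimes>\<^sub>2 a)) = a \<bullet> elt_lunit G P (src G a)"
    (is "?lhs = _")
proof -
  let ?K = "tsplit G u one (id1 G (unit_obj G))"
  have 1: "?K (trg G a) \<bullet> (id2 G u \<otimes>\<^sub>2 a) = ((u \<otimes>\<^sub>1 one) \<rhd> a) \<bullet> ?K (src G a)"
    using assms tsplit_nat[of "id2 G (id1 G (unit_obj G))" a "id2 G u" "id2 G one"] by (simp flip: lwhisk_def)
  have "?lhs = (pl P \<lhd> trg G a) \<bullet> (m \<rhd> (?K (trg G a) \<bullet> (id2 G u \<otimes>\<^sub>2 a)))"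
    using assms by (simp add: elt_lunit_def)
  also have "\<dots> = ((pl P \<lhd> trg G a) \<bullet> ((m \<cdot> (u \<otimes>\<^sub>1 one)) \<rhd> a)) \<bullet> (m \<rhd> ?K (src G a))"
    unfolding 1 using assms by simp
  also have "\<dots> = a \<bullet> elt_lunit G P (src G a)"
    using assms whisk_interchange[of a "pl P", symmetric] by (simp add: elt_lunit_def)
  finally show ?thesis .
qed

lemma elt_runit_nat:
  assumes "a \<in> Cell G" "cod G (src G a) = B"
  shows "elt_runit G P (trg G a) \<bullet> (m \<rhd> (a \<otimes>\<^sub>2 id2 G u)) = a \<bullet> elt_runit G P (src G a)"
proof -
  have "a \<otimes>\<^sub>2 id2 G u = (one \<otimes>\<^sub>1 u) \<rhd> (a \<otimes>\<^sub>2 id2 G (id1 G (unit_obj G)))"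
    using assms by (simp del: tens2_unit)
  then have "a \<otimes>\<^sub>2 id2 G u = (one \<otimes>\<^sub>1 u) \<rhd> a" using assms by simp
  then show ?thesis
    using assms whisk_interchange[of a "pr P", symmetric] by (simp add: elt_runit_def)
qed

sublocale elt: monoidal_fibre G B "slice_tens0 G P" "elt_tens2 G P" u "elt_assoc G P" "elt_lunit G P" "elt_runit G P"
  by unfold_locales
    (simp_all add: slice_tens0_def elt_tens2_def elt_assoc_simps elt_assoc_nat elt_pentagon elt_triangle
      elt_lunit_simps elt_lunit_nat elt_runit_simps elt_runit_nat flip: whisk_vcomp tens2_vcomp)

end

section \<open>The functor induced by a strong monoidal map\<close>

definition elt_psi :: "('o, 'm, 'c) gray \<Rightarrow> ('o, 'm, 'c) pmon \<Rightarrow> 'm \<Rightarrow> 'c \<Rightarrow> 'm \<Rightarrow> 'm \<Rightarrow> 'c"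
  where "elt_psi G Q f \<phi> x y = (\<phi> \<lhd> (x \<otimes>\<^sub>1 y)) \<bullet> (mul Q \<rhd> tsplit G f f x y)"
  for G (structure)

locale strong_map = gray_monoid G
  for G :: "('o, 'm, 'c) gray" (structure) +
  fixes A B :: "('o, 'm, 'c) pmon" and W :: "('m, 'c) monoidal_map"
  assumes pmonA: "pseudomonoid G A" and pmonB: "pseudomonoid G B"
    and strong: "strong_monoidal_map G A B W"

sublocale strong_map \<subseteq> A: pseudomonoid_in G A
  by unfold_locales (rule pmonA)

sublocale strong_map \<subseteq> B: pseudomonoid_in G B
  by unfold_locales (rule pmonB)

context strong_map
begin

abbreviation "w \<equiv> arr W"
abbreviation "r \<equiv> radj W"

lemma strong_simps [simp]:
  "w \<in> Arr G" "dom G w = ob A" "cod G w = ob B"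
  "r \<in> Arr G" "dom G r = ob B" "cod G r = ob A"
  "psi W \<in> Cell G" "src G (psi W) = mul B \<cdot> (w \<otimes>\<^sub>1 w)" "trg G (psi W) = w \<cdot> mul A" "invertible G (psi W)"
  "psi0 W \<in> Cell G" "src G (psi0 W) = uni B" "trg G (psi0 W) = w \<cdot> uni A" "invertible G (psi0 W)"
  using strong
  by (auto simp: strong_monoidal_map_def lax_monoidal_def adjunction_def Let_def mem_hom1 mem_hom2)

lemma adjunction: "adjunction G (ob A) (ob B) w r (adj_unit W) (adj_counit W)"
  using strong by (simp add: strong_monoidal_map_def)

lemma lax_monoidal_W: "lax_monoidal G A B w (psi W) (psi0 W)"
  using strong by (simp add: strong_monoidal_map_def)

text \<open>The associativity axiom of \<open>W\<close> composed with the comparison cell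
  \<open>?K\<close>, which cancels the \<open>tcomp\<close> on the left, so that only
  \<open>tsplit\<close> occurs.\<close>

lemma psi_assoc:
  "(w \<rhd> pa A) \<bullet> ((psi W \<lhd> (mul A \<otimes>\<^sub>1 A.one)) \<bullet> (mul B \<rhd> (psi W \<otimes>\<^sub>2 id2 G w))) =
   (psi W \<lhd> (A.one \<otimes>\<^sub>1 mul A)) \<bullet> ((mul B \<rhd> tsplit G w w A.one (mul A)) \<bullet>
     ((mul B \<rhd> (id2 G w \<otimes>\<^sub>2 psi W)) \<bullet> ((pa B \<lhd> (w \<otimes>\<^sub>1 (w \<otimes>\<^sub>1 w))) \<bullet>
     (mul B \<rhd> tsplit G (mul B) B.one (w \<otimes>\<^sub>1 w) w))))"
    (is "?lhs = _")
proof -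
  let ?K = "mul B \<rhd> tsplit G (mul B) B.one (w \<otimes>\<^sub>1 w) w"
  have 1: "(w \<rhd> pa A) \<bullet> (psi W \<lhd> (mul A \<otimes>\<^sub>R ob A)) \<bullet> (mul B \<rhd> vinv G (tcomp G w w (mul A) (id1 G (ob A))))
        \<bullet> (mul B \<rhd> (psi W \<otimes>\<^sub>2 id2 G w)) \<bullet> (mul B \<rhd> tcomp G (mul B) (id1 G (ob B)) (w \<otimes>\<^sub>1 w) w) =
      (psi W \<lhd> (ob A \<otimes>\<^sub>L mul A)) \<bullet> (mul B \<rhd> vinv G (tcomp G w w (id1 G (ob A)) (mul A)))
        \<bullet> (mul B \<rhd> (id2 G w \<otimes>\<^sub>2 psi W)) \<bullet> (mul B \<rhd> tcomp G (id1 G (ob B)) (mul B) w (w \<otimes>\<^sub>1 w))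
        \<bullet> (pa B \<lhd> (w \<otimes>\<^sub>1 w \<otimes>\<^sub>1 w))" (is "?l = ?r")
    using lax_monoidal_W by (simp add: lax_monoidal_def Let_def)
  have t: "mul A \<otimes>\<^sub>R ob A = mul A \<otimes>\<^sub>1 A.one" "ob A \<otimes>\<^sub>L mul A = A.one \<otimes>\<^sub>1 mul A"
    by (simp_all only: act1_tens1 A.pmon_simps)
  have "?l \<bullet> ?K = ?r \<bullet> ?K" using 1 by (simp only:)
  moreover have "?l \<bullet> ?K = ?lhs"
    unfolding t by (simp flip: whisk_vcomp)
  moreover have "?r \<bullet> ?K = (psi W \<lhd> (A.one \<otimes>\<^sub>1 mul A)) \<bullet> ((mul B \<rhd> tsplit G w w A.one (mul A)) \<bullet>
     ((mul B \<rhd> (id2 G w \<otimes>\<^sub>2 psi W)) \<bullet> ((pa B \<lhd> (w \<otimes>\<^sub>1 (w \<otimes>\<^sub>1 w))) \<bullet> ?K)))"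
    unfolding t by simp
  ultimately show ?thesis by (simp only:)
qed

lemma psi_lunit:
  "(w \<rhd> pl A) \<bullet> ((psi W \<lhd> (uni A \<otimes>\<^sub>1 A.one)) \<bullet> (mul B \<rhd> (psi0 W \<otimes>\<^sub>2 id2 G w))) =
   (pl B \<lhd> w) \<bullet> (mul B \<rhd> tsplit G (uni B) B.one (id1 G (unit_obj G)) w)"
    (is "?lhs = _")
proof -
  let ?K = "mul B \<rhd> tsplit G (uni B) B.one (id1 G (unit_obj G)) w"
  have 1: "(w \<rhd> pl A) \<bullet> (psi W \<lhd> (uni A \<otimes>\<^sub>R ob A)) \<bullet> (mul B \<rhd> vinv G (tcomp G w w (uni A) (id1 G (ob A))))
        \<bullet> (mul B \<rhd> (psi0 W \<otimes>\<^sub>2 id2 G w)) \<bullet> (mul B \<rhd> tcomp G (uni B) (id1 G (ob B)) (id1 G (unit_obj G)) w) = pl B \<lhd> w"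
     (is "?l = ?r")
    using lax_monoidal_W by (simp add: lax_monoidal_def Let_def)
  have t: "uni A \<otimes>\<^sub>R ob A = uni A \<otimes>\<^sub>1 A.one"
    by (simp_all only: act1_tens1 A.pmon_simps)
  have "?l \<bullet> ?K = ?r \<bullet> ?K" using 1 by (simp only:)
  moreover have "?l \<bullet> ?K = ?lhs"
    unfolding t by (simp flip: whisk_vcomp)
  ultimately show ?thesis by (simp only:)
qed

lemma psi_runit:
  "(w \<rhd> pr A) \<bullet> ((psi W \<lhd> (A.one \<otimes>\<^sub>1 uni A)) \<bullet> ((mul B \<rhd> tsplit G w w A.one (uni A)) \<bullet>
     (mul B \<rhd> (id2 G w \<otimes>\<^sub>2 psi0 W)))) = pr B \<lhd> w"
proof -
  have 1: "(w \<rhd> pr A) \<bullet> (psi W \<lhd> (ob A \<otimes>\<^sub>L uni A)) \<bullet> (mul B \<rhd> vinv G (tcomp G w w (id1 G (ob A)) (uni A)))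
        \<bullet> (mul B \<rhd> (id2 G w \<otimes>\<^sub>2 psi0 W)) \<bullet> (mul B \<rhd> tcomp G (id1 G (ob B)) (uni B) w (id1 G (unit_obj G))) = pr B \<lhd> w"
    using lax_monoidal_W by (simp add: lax_monoidal_def Let_def)
  have t: "ob A \<otimes>\<^sub>L uni A = A.one \<otimes>\<^sub>1 uni A"
    by (simp_all only: act1_tens1 A.pmon_simps)
  show ?thesis using 1 unfolding t by simp
qed

abbreviation "ps \<equiv> elt_psi G B w (psi W)"

lemma ps_simps:
  assumes "x \<in> Arr G" "y \<in> Arr G" "cod G x = ob A" "cod G y = ob A"
  shows "ps x y \<in> Cell G" "src G (ps x y) = mul B \<cdot> ((w \<cdot> x) \<otimes>\<^sub>1 (w \<cdot> y))"
    "trg G (ps x y) = w \<cdot> (mul A \<cdot> (x \<otimes>\<^sub>1 y))" "invertible G (ps x y)"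
  using assms by (simp_all add: elt_psi_def)

lemma ps_nat:
  assumes "a \<in> Cell G" "b \<in> Cell G" "cod G (src G a) = ob A" "cod G (src G b) = ob A"
  shows "ps (trg G a) (trg G b) \<bullet> (mul B \<rhd> ((w \<rhd> a) \<otimes>\<^sub>2 (w \<rhd> b))) =
    (w \<cdot> mul A \<rhd> (a \<otimes>\<^sub>2 b)) \<bullet> ps (src G a) (src G b)"
    (is "?lhs = ?rhs")
proof -
  have 1: "tsplit G w w (trg G a) (trg G b) \<bullet> ((w \<rhd> a) \<otimes>\<^sub>2 (w \<rhd> b)) =
      ((w \<otimes>\<^sub>1 w) \<rhd> (a \<otimes>\<^sub>2 b)) \<bullet> tsplit G w w (src G a) (src G b)"
    using assms tsplit_nat[of a b "id2 G w" "id2 G w"] by (simp flip: lwhisk_def)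
  have "?lhs =
     (psi W \<lhd> (trg G a \<otimes>\<^sub>1 trg G b)) \<bullet> (mul B \<rhd> (tsplit G w w (trg G a) (trg G b) \<bullet> ((w \<rhd> a) \<otimes>\<^sub>2 (w \<rhd> b))))"
    using assms by (simp add: elt_psi_def)
  also have "\<dots> = ((psi W \<lhd> (trg G a \<otimes>\<^sub>1 trg G b)) \<bullet> (mul B \<cdot> (w \<otimes>\<^sub>1 w) \<rhd> (a \<otimes>\<^sub>2 b))) \<bullet>
      (mul B \<rhd> tsplit G w w (src G a) (src G b))"
    unfolding 1 using assms by simp
  also have "\<dots> = ?rhs"
    using assms whisk_interchange[of "a \<otimes>\<^sub>2 b" "psi W", symmetric] by (simp add: elt_psi_def)
  finally show ?thesis .
qed

text \<open>The law \<open>psi_assoc\<close> restricted along \<open>?Q\<close>. What surrounds it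
  are comparison cells, brought into position by naturality and by interchange with
  \<open>psi\<close> and \<open>pa\<close>.\<close>

lemma ps_assoc:
  assumes "x \<in> Arr G" "y \<in> Arr G" "z \<in> Arr G" "cod G x = ob A" "cod G y = ob A" "cod G z = ob A"
  shows "(w \<rhd> elt_assoc G A x y z) \<bullet> (ps (mul A \<cdot> (x \<otimes>\<^sub>1 y)) z \<bullet> (mul B \<rhd> (ps x y \<otimes>\<^sub>2 id2 G (w \<cdot> z)))) =
    ps x (mul A \<cdot> (y \<otimes>\<^sub>1 z)) \<bullet> ((mul B \<rhd> (id2 G (w \<cdot> x) \<otimes>\<^sub>2 ps y z)) \<bullet>
      elt_assoc G B (w \<cdot> x) (w \<cdot> y) (w \<cdot> z))"
proof -
  let ?Q = "x \<otimes>\<^sub>1 (y \<otimes>\<^sub>1 z)" and ?p = "mul A" and ?m = "mul B" and ?ww = "w \<otimes>\<^sub>1 w"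
  let ?Kp = "tsplit G ?p A.one (x \<otimes>\<^sub>1 y) z"
  let ?k = "tsplit G ?ww w (x \<otimes>\<^sub>1 y) z \<bullet> (tsplit G w w x y \<otimes>\<^sub>2 id2 G (w \<cdot> z))"
  let ?k' = "tsplit G w ?ww x (y \<otimes>\<^sub>1 z) \<bullet> (id2 G (w \<cdot> x) \<otimes>\<^sub>2 tsplit G w w y z)"
  let ?Km = "tsplit G ?m B.one ((w \<cdot> x) \<otimes>\<^sub>1 (w \<cdot> y)) (w \<cdot> z)"
  \<comment> \<open>Splitting off three copies of \<open>w\<close> gives the same cell whether the
    left or the right pair is split first.\<close>
  have k: "?k = ?k'"
    using assms tsplit_tens[of x y z w w w] by simp
  have 1: "(w \<cdot> ?p \<rhd> ?Kp) \<bullet> (psi W \<lhd> (?p \<cdot> (x \<otimes>\<^sub>1 y)) \<otimes>\<^sub>1 z) =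
     (psi W \<lhd> (?p \<otimes>\<^sub>1 A.one) \<cdot> ?Q) \<bullet> (?m \<cdot> ?ww \<rhd> ?Kp)"
    using assms whisk_interchange[of ?Kp "psi W"] by simp
  have 2: "(?ww \<rhd> ?Kp) \<bullet> tsplit G w w (?p \<cdot> (x \<otimes>\<^sub>1 y)) z = tsplit G (w \<cdot> ?p) w (x \<otimes>\<^sub>1 y) z"
    using assms tsplit_assoc[of "x \<otimes>\<^sub>1 y" z ?p A.one w w] by simp
  have 3: "tsplit G (w \<cdot> ?p) w (x \<otimes>\<^sub>1 y) z \<bullet> ((psi W \<lhd> (x \<otimes>\<^sub>1 y)) \<otimes>\<^sub>2 id2 G (w \<cdot> z)) =
     ((psi W \<otimes>\<^sub>2 id2 G w) \<lhd> ?Q) \<bullet> tsplit G (?m \<cdot> ?ww) w (x \<otimes>\<^sub>1 y) z"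
    using assms tsplit_nat[of "id2 G (x \<otimes>\<^sub>1 y)" "id2 G z" "psi W" "id2 G w"] by (simp flip: rwhisk_def)
  let ?K' = "tsplit G (?m \<cdot> ?ww) w (x \<otimes>\<^sub>1 y) z \<bullet> ((?m \<rhd> tsplit G w w x y) \<otimes>\<^sub>2 id2 G (w \<cdot> z))"
  have 4: "(tsplit G ?m B.one ?ww w \<lhd> ?Q) \<bullet> ?K' = ((?m \<otimes>\<^sub>1 B.one) \<rhd> ?k) \<bullet> ?Km"
  proof -
    have "tsplit G ?m B.one (?ww \<cdot> (x \<otimes>\<^sub>1 y)) (w \<cdot> z) \<bullet> ((?m \<rhd> tsplit G w w x y) \<otimes>\<^sub>2 id2 G (w \<cdot> z)) =
        ((?m \<otimes>\<^sub>1 B.one) \<rhd> (tsplit G w w x y \<otimes>\<^sub>2 id2 G (w \<cdot> z))) \<bullet> ?Km"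
      using assms tsplit_nat[of "tsplit G w w x y" "id2 G (w \<cdot> z)" "id2 G ?m" "id2 G B.one"]
      by (simp flip: lwhisk_def)
    moreover have "(tsplit G ?m B.one ?ww w \<lhd> ?Q) \<bullet> tsplit G (?m \<cdot> ?ww) w (x \<otimes>\<^sub>1 y) z =
       ((?m \<otimes>\<^sub>1 B.one) \<rhd> tsplit G ?ww w (x \<otimes>\<^sub>1 y) z) \<bullet> tsplit G ?m B.one (?ww \<cdot> (x \<otimes>\<^sub>1 y)) (w \<cdot> z)"
      using assms tsplit_assoc[of "x \<otimes>\<^sub>1 y" z ?ww w ?m B.one] by simp
    note vcomp_reassoc[OF this]
    ultimately show ?thesis using assms by simp
  qed
  have 5: "(tsplit G w w A.one ?p \<lhd> ?Q) \<bullet> (((id2 G w \<otimes>\<^sub>2 psi W) \<lhd> ?Q) \<bullet> ((B.one \<otimes>\<^sub>1 ?m) \<rhd> tsplit G w ?ww x (y \<otimes>\<^sub>1 z))) =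
      tsplit G w w x (?p \<cdot> (y \<otimes>\<^sub>1 z)) \<bullet> (id2 G (w \<cdot> x) \<otimes>\<^sub>2 (psi W \<lhd> (y \<otimes>\<^sub>1 z)))"
  proof -
    have "tsplit G w w x (?p \<cdot> (y \<otimes>\<^sub>1 z)) = (tsplit G w w A.one ?p \<lhd> ?Q) \<bullet> tsplit G w (w \<cdot> ?p) x (y \<otimes>\<^sub>1 z)"
      using assms tsplit_assoc[of x "y \<otimes>\<^sub>1 z" A.one ?p w w] by simp
    moreover have "tsplit G w (w \<cdot> ?p) x (y \<otimes>\<^sub>1 z) \<bullet> (id2 G (w \<cdot> x) \<otimes>\<^sub>2 (psi W \<lhd> (y \<otimes>\<^sub>1 z))) =
        ((id2 G w \<otimes>\<^sub>2 psi W) \<lhd> ?Q) \<bullet> tsplit G w (?m \<cdot> ?ww) x (y \<otimes>\<^sub>1 z)"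
      using assms tsplit_nat[of "id2 G x" "id2 G (y \<otimes>\<^sub>1 z)" "id2 G w" "psi W"] by (simp flip: rwhisk_def)
    moreover have "tsplit G w (?m \<cdot> ?ww) x (y \<otimes>\<^sub>1 z) = (B.one \<otimes>\<^sub>1 ?m) \<rhd> tsplit G w ?ww x (y \<otimes>\<^sub>1 z)"
      using assms tsplit_assoc[of x "y \<otimes>\<^sub>1 z" w ?ww B.one ?m] by simp
    ultimately show ?thesis using assms by simp
  qed
  have 6: "(pa B \<lhd> (w \<otimes>\<^sub>1 (w \<otimes>\<^sub>1 w)) \<cdot> ?Q) \<bullet> (?m \<cdot> (?m \<otimes>\<^sub>1 B.one) \<rhd> ?k') =
      (?m \<cdot> (B.one \<otimes>\<^sub>1 ?m) \<rhd> ?k') \<bullet> (pa B \<lhd> ((w \<cdot> x) \<otimes>\<^sub>1 ((w \<cdot> y) \<otimes>\<^sub>1 (w \<cdot> z))))"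
    using assms whisk_interchange[of ?k' "pa B", symmetric] by simp
  have t3: "?m \<cdot> (B.one \<otimes>\<^sub>1 ?m) \<rhd> (id2 G (w \<cdot> x) \<otimes>\<^sub>2 tsplit G w w y z) =
      ?m \<rhd> (id2 G (w \<cdot> x) \<otimes>\<^sub>2 (?m \<rhd> tsplit G w w y z))"
    using assms by (simp flip: whisk_whisk(1))
  have t1: "ps x y \<otimes>\<^sub>2 id2 G (w \<cdot> z) =
     ((psi W \<lhd> (x \<otimes>\<^sub>1 y)) \<otimes>\<^sub>2 id2 G (w \<cdot> z)) \<bullet> ((?m \<rhd> tsplit G w w x y) \<otimes>\<^sub>2 id2 G (w \<cdot> z))"
    using assms by (simp add: elt_psi_def tens2_vcomp)
  have t2: "id2 G (w \<cdot> x) \<otimes>\<^sub>2 ps y z =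
     (id2 G (w \<cdot> x) \<otimes>\<^sub>2 (psi W \<lhd> (y \<otimes>\<^sub>1 z))) \<bullet> (id2 G (w \<cdot> x) \<otimes>\<^sub>2 (?m \<rhd> tsplit G w w y z))"
    using assms by (simp add: elt_psi_def tens2_vcomp)
  have "(w \<rhd> elt_assoc G A x y z) \<bullet> (ps (?p \<cdot> (x \<otimes>\<^sub>1 y)) z \<bullet> (?m \<rhd> (ps x y \<otimes>\<^sub>2 id2 G (w \<cdot> z)))) =
    (w \<rhd> pa A \<lhd> ?Q) \<bullet> (((w \<cdot> ?p \<rhd> ?Kp) \<bullet> (psi W \<lhd> (?p \<cdot> (x \<otimes>\<^sub>1 y)) \<otimes>\<^sub>1 z)) \<bullet>
      ((?m \<rhd> tsplit G w w (?p \<cdot> (x \<otimes>\<^sub>1 y)) z) \<bullet> ((?m \<rhd> ((psi W \<lhd> (x \<otimes>\<^sub>1 y)) \<otimes>\<^sub>2 id2 G (w \<cdot> z))) \<bullet>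
      (?m \<rhd> ((?m \<rhd> tsplit G w w x y) \<otimes>\<^sub>2 id2 G (w \<cdot> z))))))"
    unfolding t1 using assms by (simp add: elt_assoc_def elt_psi_def)
  also have "\<dots> = (w \<rhd> pa A \<lhd> ?Q) \<bullet> ((psi W \<lhd> (?p \<otimes>\<^sub>1 A.one) \<cdot> ?Q) \<bullet>
      ((?m \<rhd> (((?ww \<rhd> ?Kp) \<bullet> tsplit G w w (?p \<cdot> (x \<otimes>\<^sub>1 y)) z) \<bullet> ((psi W \<lhd> (x \<otimes>\<^sub>1 y)) \<otimes>\<^sub>2 id2 G (w \<cdot> z)))) \<bullet>
      (?m \<rhd> ((?m \<rhd> tsplit G w w x y) \<otimes>\<^sub>2 id2 G (w \<cdot> z)))))"
    unfolding 1 using assms by simp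
  also have "\<dots> = (((w \<rhd> pa A) \<bullet> ((psi W \<lhd> (?p \<otimes>\<^sub>1 A.one)) \<bullet> (?m \<rhd> (psi W \<otimes>\<^sub>2 id2 G w)))) \<lhd> ?Q) \<bullet> (?m \<rhd> ?K')"
    unfolding 2 3 using assms by simp
  also have "\<dots> = (psi W \<lhd> (A.one \<otimes>\<^sub>1 ?p) \<cdot> ?Q) \<bullet> ((?m \<rhd> tsplit G w w A.one ?p \<lhd> ?Q) \<bullet>
     ((?m \<rhd> (id2 G w \<otimes>\<^sub>2 psi W) \<lhd> ?Q) \<bullet> ((pa B \<lhd> (w \<otimes>\<^sub>1 (w \<otimes>\<^sub>1 w)) \<cdot> ?Q) \<bullet>
     (?m \<rhd> ((tsplit G ?m B.one ?ww w \<lhd> ?Q) \<bullet> ?K')))))"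
    unfolding psi_assoc using assms by simp
  also have "\<dots> = (psi W \<lhd> (A.one \<otimes>\<^sub>1 ?p) \<cdot> ?Q) \<bullet> ((?m \<rhd> tsplit G w w A.one ?p \<lhd> ?Q) \<bullet>
     ((?m \<rhd> (id2 G w \<otimes>\<^sub>2 psi W) \<lhd> ?Q) \<bullet> (((pa B \<lhd> (w \<otimes>\<^sub>1 (w \<otimes>\<^sub>1 w)) \<cdot> ?Q) \<bullet>
     (?m \<cdot> (?m \<otimes>\<^sub>1 B.one) \<rhd> ?k')) \<bullet> (?m \<rhd> ?Km))))"
    unfolding 4 unfolding k using assms by simp
  also have "\<dots> = (psi W \<lhd> (A.one \<otimes>\<^sub>1 ?p) \<cdot> ?Q) \<bullet> ((?m \<rhd> ((tsplit G w w A.one ?p \<lhd> ?Q) \<bullet>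
     (((id2 G w \<otimes>\<^sub>2 psi W) \<lhd> ?Q) \<bullet> ((B.one \<otimes>\<^sub>1 ?m) \<rhd> tsplit G w ?ww x (y \<otimes>\<^sub>1 z))))) \<bullet>
     ((?m \<rhd> (id2 G (w \<cdot> x) \<otimes>\<^sub>2 (?m \<rhd> tsplit G w w y z))) \<bullet>
      elt_assoc G B (w \<cdot> x) (w \<cdot> y) (w \<cdot> z)))"
    unfolding 6 using assms by (simp add: elt_assoc_def t3)
  also have "\<dots> = ps x (?p \<cdot> (y \<otimes>\<^sub>1 z)) \<bullet> ((?m \<rhd> (id2 G (w \<cdot> x) \<otimes>\<^sub>2 ps y z)) \<bullet>
      elt_assoc G B (w \<cdot> x) (w \<cdot> y) (w \<cdot> z))"
    unfolding 5 t2 using assms by (simp add: elt_assoc_def elt_psi_def)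
  finally show ?thesis .
qed

lemma ps_lunit:
  assumes "x \<in> Arr G" "cod G x = ob A"
  shows "(w \<rhd> elt_lunit G A x) \<bullet> (ps (uni A) x \<bullet> (mul B \<rhd> (psi0 W \<otimes>\<^sub>2 id2 G (w \<cdot> x)))) = elt_lunit G B (w \<cdot> x)"
proof -
  let ?I = "id1 G (unit_obj G)" and ?p = "mul A" and ?m = "mul B" and ?ww = "w \<otimes>\<^sub>1 w"
  let ?K = "tsplit G (uni A) A.one ?I x"
  have 1: "(w \<cdot> ?p \<rhd> ?K) \<bullet> (psi W \<lhd> (uni A \<otimes>\<^sub>1 x)) = (psi W \<lhd> (uni A \<otimes>\<^sub>1 A.one) \<cdot> x) \<bullet> (?m \<cdot> ?ww \<rhd> ?K)"
    using assms whisk_interchange[of ?K "psi W"] by simp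
  have 2: "(?ww \<rhd> ?K) \<bullet> tsplit G w w (uni A) x = tsplit G (w \<cdot> uni A) w ?I x"
    using assms tsplit_assoc[of ?I x "uni A" A.one w w] by simp
  have 3: "tsplit G (w \<cdot> uni A) w ?I x \<bullet> (psi0 W \<otimes>\<^sub>2 id2 G (w \<cdot> x)) =
     ((psi0 W \<otimes>\<^sub>2 id2 G w) \<lhd> x) \<bullet> tsplit G (uni B) w ?I x"
    using assms tsplit_nat[of "id2 G ?I" "id2 G x" "psi0 W" "id2 G w"] by (simp flip: rwhisk_def)
  have 4: "(tsplit G (uni B) B.one ?I w \<lhd> x) \<bullet> tsplit G (uni B) w ?I x = tsplit G (uni B) B.one ?I (w \<cdot> x)"
    using assms tsplit_assoc[of ?I x ?I w "uni B" B.one] by simp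
  have "(w \<rhd> elt_lunit G A x) \<bullet> (ps (uni A) x \<bullet> (?m \<rhd> (psi0 W \<otimes>\<^sub>2 id2 G (w \<cdot> x)))) =
      (w \<rhd> pl A \<lhd> x) \<bullet> (((w \<cdot> ?p \<rhd> ?K) \<bullet> (psi W \<lhd> (uni A \<otimes>\<^sub>1 x))) \<bullet>
       ((?m \<rhd> tsplit G w w (uni A) x) \<bullet> (?m \<rhd> (psi0 W \<otimes>\<^sub>2 id2 G (w \<cdot> x)))))"
    using assms by (simp add: elt_lunit_def elt_psi_def)
  also have "\<dots> = (w \<rhd> pl A \<lhd> x) \<bullet> ((psi W \<lhd> (uni A \<otimes>\<^sub>1 A.one) \<cdot> x) \<bullet>
      (?m \<rhd> (((?ww \<rhd> ?K) \<bullet> tsplit G w w (uni A) x) \<bullet> (psi0 W \<otimes>\<^sub>2 id2 G (w \<cdot> x)))))"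
    unfolding 1 using assms by simp
  also have "\<dots> = (((w \<rhd> pl A) \<bullet> ((psi W \<lhd> (uni A \<otimes>\<^sub>1 A.one)) \<bullet> (?m \<rhd> (psi0 W \<otimes>\<^sub>2 id2 G w)))) \<lhd> x) \<bullet>
      (?m \<rhd> tsplit G (uni B) w ?I x)"
    unfolding 2 3 using assms by simp
  also have "\<dots> = (pl B \<lhd> w \<cdot> x) \<bullet> (?m \<rhd> ((tsplit G (uni B) B.one ?I w \<lhd> x) \<bullet> tsplit G (uni B) w ?I x))"
    unfolding psi_lunit using assms by simp
  also have "\<dots> = elt_lunit G B (w \<cdot> x)"
    unfolding 4 using assms by (simp add: elt_lunit_def)
  finally show ?thesis .
qed

lemma ps_runit:
  assumes "x \<in> Arr G" "cod G x = ob A"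
  shows "(w \<rhd> elt_runit G A x) \<bullet> (ps x (uni A) \<bullet> (mul B \<rhd> (id2 G (w \<cdot> x) \<otimes>\<^sub>2 psi0 W))) = elt_runit G B (w \<cdot> x)"
    (is "?lhs = _")
proof -
  let ?I = "id1 G (unit_obj G)"
  have 1: "tsplit G w w x (uni A) = tsplit G w w A.one (uni A) \<lhd> x"
    using assms tsplit_assoc[of x ?I A.one "uni A" w w] tsplit_assoc[of x ?I w w A.one "uni A"] by simp
  have 2: "id2 G (w \<cdot> x) \<otimes>\<^sub>2 psi0 W = (id2 G w \<otimes>\<^sub>2 psi0 W) \<lhd> x"
    using assms tens2_whisk_strict(2)[of "id2 G w" "psi0 W" x "unit_obj G"] by simp
  have "?lhs =
    ((w \<rhd> pr A) \<bullet> ((psi W \<lhd> (A.one \<otimes>\<^sub>1 uni A)) \<bullet> ((mul B \<rhd> tsplit G w w A.one (uni A)) \<bullet>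
     (mul B \<rhd> (id2 G w \<otimes>\<^sub>2 psi0 W))))) \<lhd> x"
    unfolding elt_psi_def 1 2 using assms by (simp add: elt_runit_def)
  then show ?thesis unfolding psi_runit using assms by (simp add: elt_runit_def)
qed

sublocale madj: monoidal_adjunction G
  "ob A" "slice_tens0 G A" "elt_tens2 G A" "uni A" "elt_assoc G A" "elt_lunit G A" "elt_runit G A"
  "ob B" "slice_tens0 G B" "elt_tens2 G B" "uni B" "elt_assoc G B" "elt_lunit G B" "elt_runit G B"
  w r "adj_unit W" "adj_counit W" ps "psi0 W"
  by unfold_locales
    (use ps_nat in \<open>simp_all add: slice_tens0_def elt_tens2_def adjunction ps_simps ps_assoc ps_lunit ps_runit\<close>)

end

section \<open>Reindexing\<close>

text \<open>Precomposition is compatible with \<open>\<odot>\<close> only up to this 2-cell.\<close>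

definition elt_split :: "('o, 'm, 'c) gray \<Rightarrow> ('o, 'm, 'c) pmon \<Rightarrow> 'm \<Rightarrow> 'm \<Rightarrow> 'm \<Rightarrow> 'm \<Rightarrow> 'c"
  where "elt_split G P x y f g = mul P \<rhd> tsplit G x y f g"
  for G (structure)

context pseudomonoid_in
begin

abbreviation "T \<equiv> slice_tens0 G P"
abbreviation "T2 \<equiv> elt_tens2 G P"

lemma slice_tens0_simps [simp]:
  assumes "x \<in> Arr G" "y \<in> Arr G" "cod G x = B" "cod G y = B"
  shows "dom G (T x y) = dom G x \<otimes>\<^sub>0 dom G y"
    "\<lbrakk>X = dom G y; cod G f = dom G x; f \<in> Arr G\<rbrakk> \<Longrightarrow> T x y \<cdot> (f \<otimes>\<^sub>1 id1 G X) = T (x \<cdot> f) y"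
    "\<lbrakk>X = dom G y; dom G x = cod G f \<otimes>\<^sub>0 cod G g; f \<in> Arr G; g \<in> Arr G\<rbrakk> \<Longrightarrow>
      T x y \<cdot> (f \<otimes>\<^sub>1 (g \<otimes>\<^sub>1 id1 G X)) = T (x \<cdot> (f \<otimes>\<^sub>1 g)) y"
  using assms by (simp_all add: slice_tens0_def)

lemma slice_tens0_assoc [simp]:
  assumes "X = dom G y" "cod G f = dom G x" "x \<in> Arr G" "y \<in> Arr G" "cod G x = B" "cod G y = B"
    "f \<in> Arr G" "h \<in> Arr G" "cod G h = dom G f \<otimes>\<^sub>0 X"
  shows "T x y \<cdot> ((f \<otimes>\<^sub>1 id1 G X) \<cdot> h) = T (x \<cdot> f) y \<cdot> h"
  using assms by (simp flip: comp1_assoc')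

lemma slice_tens0_one [simp]:
  assumes "y \<in> Arr G" "cod G y = B" "f \<in> Arr G" "cod G f = dom G y"
  shows "T one y \<cdot> (one \<otimes>\<^sub>1 f) = T one (y \<cdot> f)"
  using assms by (simp_all add: slice_tens0_def)

lemma elt_tens2_simps [simp]:
  assumes "a \<in> Cell G" "b \<in> Cell G" "cod G (src G a) = B" "cod G (src G b) = B"
  shows "\<lbrakk>f \<in> Arr G; cod G f = dom G (src G a); X = dom G (src G b)\<rbrakk> \<Longrightarrow>
      T2 a b \<lhd> (f \<otimes>\<^sub>1 id1 G X) = T2 (a \<lhd> f) b"
    "\<lbrakk>f \<in> Arr G; g \<in> Arr G; dom G (src G a) = cod G f \<otimes>\<^sub>0 cod G g; X = dom G (src G b)\<rbrakk> \<Longrightarrow>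
      T2 a b \<lhd> (f \<otimes>\<^sub>1 (g \<otimes>\<^sub>1 id1 G X)) = T2 (a \<lhd> (f \<otimes>\<^sub>1 g)) b"
proof -
  show "T2 a b \<lhd> (f \<otimes>\<^sub>1 id1 G X) = T2 (a \<lhd> f) b"
    if "f \<in> Arr G" "cod G f = dom G (src G a)" "X = dom G (src G b)"
    using assms that by (simp add: elt_tens2_def)
  show "T2 a b \<lhd> (f \<otimes>\<^sub>1 (g \<otimes>\<^sub>1 id1 G X)) = T2 (a \<lhd> (f \<otimes>\<^sub>1 g)) b"
    if "f \<in> Arr G" "g \<in> Arr G" "dom G (src G a) = cod G f \<otimes>\<^sub>0 cod G g" "X = dom G (src G b)"
    using assms that tens2_whisk_strict(2)[of a b "f \<otimes>\<^sub>1 g" X] by (simp add: elt_tens2_def)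
qed

lemma elt_tens2_one [simp]:
  assumes "b \<in> Cell G" "cod G (src G b) = B" "f \<in> Arr G" "cod G f = dom G (src G b)"
  shows "T2 (id2 G one) b \<lhd> (one \<otimes>\<^sub>1 f) = T2 (id2 G one) (b \<lhd> f)"
  using assms by (simp add: elt_tens2_def tens2_id_whisk)

lemma elt_split_simps [simp]:
  assumes "x \<in> Arr G" "y \<in> Arr G" "cod G x = B" "cod G y = B"
    "f \<in> Arr G" "g \<in> Arr G" "cod G f = dom G x" "cod G g = dom G y"
  shows "elt_split G P x y f g \<in> Cell G" "src G (elt_split G P x y f g) = T (x \<cdot> f) (y \<cdot> g)"
    "trg G (elt_split G P x y f g) = T x y \<cdot> (f \<otimes>\<^sub>1 g)" "invertible G (elt_split G P x y f g)"
  using assms by (simp_all add: elt_split_def slice_tens0_def)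

lemma elt_split_strict [simp]:
  assumes "x \<in> Arr G" "y \<in> Arr G" "cod G x = B" "cod G y = B" "f \<in> Arr G" "cod G f = dom G x"
  shows "X = dom G y \<Longrightarrow> elt_split G P x y f (id1 G X) = id2 G (T (x \<cdot> f) y)"
    "\<lbrakk>g \<in> Arr G; cod G g = dom G y; x = one\<rbrakk> \<Longrightarrow> elt_split G P x y f g = id2 G (T f (y \<cdot> g))"
  using assms by (simp_all add: elt_split_def slice_tens0_def)

lemma elt_split_nat:
  assumes "a \<in> Cell G" "b \<in> Cell G" "cod G (src G a) = B" "cod G (src G b) = B"
    "f \<in> Arr G" "g \<in> Arr G" "cod G f = dom G (src G a)" "cod G g = dom G (src G b)"
  shows "elt_split G P (trg G a) (trg G b) f g \<bullet> T2 (a \<lhd> f) (b \<lhd> g) =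
    (T2 a b \<lhd> (f \<otimes>\<^sub>1 g)) \<bullet> elt_split G P (src G a) (src G b) f g"
proof -
  have "tsplit G (trg G a) (trg G b) f g \<bullet> ((a \<lhd> f) \<otimes>\<^sub>2 (b \<lhd> g)) =
      ((a \<otimes>\<^sub>2 b) \<lhd> (f \<otimes>\<^sub>1 g)) \<bullet> tsplit G (src G a) (src G b) f g"
    using assms tsplit_nat[of "id2 G f" "id2 G g" a b] by (simp flip: rwhisk_def)
  from arg_cong[OF this, of "\<lambda>t. mul P \<rhd> t"] show ?thesis
    using assms by (simp add: elt_split_def elt_tens2_def)
qed

text \<open>The first factor of a tensor acts first, so a 1-cell placed before it crosses nothing
  and no comparison cell arises.\<close>

lemma elt_assoc_left:
  assumes "x \<in> Arr G" "y \<in> Arr G" "z \<in> Arr G" "cod G x = B" "cod G y = B" "cod G z = B"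
    "f \<in> Arr G" "cod G f = dom G x" "X = dom G y \<otimes>\<^sub>0 dom G z"
  shows "elt_assoc G P x y z \<lhd> (f \<otimes>\<^sub>1 id1 G X) = elt_assoc G P (x \<cdot> f) y z"
proof -
  have "tsplit G m one (x \<otimes>\<^sub>1 y) z \<lhd> (f \<otimes>\<^sub>1 id1 G (dom G y \<otimes>\<^sub>0 dom G z)) = tsplit G m one ((x \<cdot> f) \<otimes>\<^sub>1 y) z"
    using assms tsplit_assoc[of "f \<otimes>\<^sub>1 id1 G (dom G y)" "id1 G (dom G z)" "x \<otimes>\<^sub>1 y" z m one] by simp
  then show ?thesis using assms by (simp add: elt_assoc_def)
qed

text \<open>Reindexing the middle factor has to cross \<open>x\<close>, so both sides carry a
  comparison cell; \<open>tsplit_tens\<close> identifies the two.\<close>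

lemma elt_assoc_mid:
  assumes "x \<in> Arr G" "y \<in> Arr G" "z \<in> Arr G" "cod G x = B" "cod G y = B" "cod G z = B"
    "f \<in> Arr G" "cod G f = dom G y" "X = dom G x" "Z = dom G z"
  shows "(elt_assoc G P x y z \<lhd> (id1 G X \<otimes>\<^sub>1 (f \<otimes>\<^sub>1 id1 G Z))) \<bullet>
      T2 (elt_split G P x y (id1 G X) f) (id2 G z) =
    elt_split G P x (T y z) (id1 G X) (f \<otimes>\<^sub>1 id1 G Z) \<bullet> elt_assoc G P x (y \<cdot> f) z"
proof -
  let ?X = "id1 G (dom G x)" and ?Z = "id1 G (dom G z)"
  let ?q = "?X \<otimes>\<^sub>1 (f \<otimes>\<^sub>1 ?Z)" and ?K = "tsplit G x y ?X f"
  have 1: "tsplit G m one ((x \<otimes>\<^sub>1 y) \<cdot> (?X \<otimes>\<^sub>1 f)) z \<bullet> ((m \<rhd> ?K) \<otimes>\<^sub>2 id2 G z) =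
      ((m \<otimes>\<^sub>1 one) \<rhd> (?K \<otimes>\<^sub>2 id2 G z)) \<bullet> tsplit G m one (x \<otimes>\<^sub>1 (y \<cdot> f)) z"
    using assms tsplit_nat[of ?K "id2 G z" "id2 G m" "id2 G one"] by (simp flip: lwhisk_def)
  have 2: "tsplit G m one (x \<otimes>\<^sub>1 y) z \<lhd> ?q = tsplit G m one ((x \<otimes>\<^sub>1 y) \<cdot> (?X \<otimes>\<^sub>1 f)) z"
    using assms tsplit_assoc[of "?X \<otimes>\<^sub>1 f" ?Z "x \<otimes>\<^sub>1 y" z m one] by simp
  have 3: "?K \<otimes>\<^sub>2 id2 G z = tsplit G x (y \<otimes>\<^sub>1 z) ?X (f \<otimes>\<^sub>1 ?Z)"
    using assms tsplit_tens[of ?X f ?Z x y z] by simp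
  have 4: "tsplit G x (T y z) ?X (f \<otimes>\<^sub>1 ?Z) = (one \<otimes>\<^sub>1 m) \<rhd> tsplit G x (y \<otimes>\<^sub>1 z) ?X (f \<otimes>\<^sub>1 ?Z)"
    using assms tsplit_assoc[of ?X "f \<otimes>\<^sub>1 ?Z" x "y \<otimes>\<^sub>1 z" one m] by (simp add: slice_tens0_def)
  have 5: "(pa P \<lhd> (x \<otimes>\<^sub>1 (y \<otimes>\<^sub>1 z)) \<cdot> ?q) \<bullet> (m \<cdot> (m \<otimes>\<^sub>1 one) \<rhd> (?K \<otimes>\<^sub>2 id2 G z)) =
      (m \<cdot> (one \<otimes>\<^sub>1 m) \<rhd> (?K \<otimes>\<^sub>2 id2 G z)) \<bullet> (pa P \<lhd> (x \<otimes>\<^sub>1 ((y \<cdot> f) \<otimes>\<^sub>1 z)))"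
    using assms whisk_interchange[of "?K \<otimes>\<^sub>2 id2 G z" "pa P", symmetric] by (simp add: 3)
  have "(elt_assoc G P x y z \<lhd> ?q) \<bullet> T2 (m \<rhd> ?K) (id2 G z) =
     (pa P \<lhd> (x \<otimes>\<^sub>1 (y \<otimes>\<^sub>1 z)) \<cdot> ?q) \<bullet> (m \<rhd> ((tsplit G m one (x \<otimes>\<^sub>1 y) z \<lhd> ?q) \<bullet> ((m \<rhd> ?K) \<otimes>\<^sub>2 id2 G z)))"
    using assms by (simp add: elt_assoc_def elt_tens2_def)
  also have "\<dots> = ((pa P \<lhd> (x \<otimes>\<^sub>1 (y \<otimes>\<^sub>1 z)) \<cdot> ?q) \<bullet> (m \<cdot> (m \<otimes>\<^sub>1 one) \<rhd> (?K \<otimes>\<^sub>2 id2 G z))) \<bullet>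
      (m \<rhd> tsplit G m one (x \<otimes>\<^sub>1 (y \<cdot> f)) z)"
    unfolding 2 1 using assms by (simp add: 3)
  also have "\<dots> = (m \<rhd> tsplit G x (T y z) ?X (f \<otimes>\<^sub>1 ?Z)) \<bullet> elt_assoc G P x (y \<cdot> f) z"
    unfolding 5 unfolding 4 3 using assms by (simp add: elt_assoc_def)
  finally show ?thesis using assms(9,10) by (simp add: elt_split_def)
qed

end

context strong_map
begin

text \<open>By \<open>tsplit_assoc\<close> it does not matter in which order \<open>w\<close> and
  the reindexing 1-cells are split off; interchange with \<open>psi\<close> does the rest.\<close>

lemma ps_reindex:
  assumes "f \<in> Arr G" "g \<in> Arr G" "cod G f = ob A" "cod G g = ob A"
    "x \<in> Arr G" "y \<in> Arr G" "cod G x = dom G f" "cod G y = dom G g"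
  shows "(ps f g \<lhd> (x \<otimes>\<^sub>1 y)) \<bullet> elt_split G B (w \<cdot> f) (w \<cdot> g) x y =
    (w \<rhd> elt_split G A f g x y) \<bullet> ps (f \<cdot> x) (g \<cdot> y)"
proof -
  let ?m = "mul B" and ?K = "tsplit G f g x y"
  have "(ps f g \<lhd> (x \<otimes>\<^sub>1 y)) \<bullet> (?m \<rhd> tsplit G (w \<cdot> f) (w \<cdot> g) x y) =
      (psi W \<lhd> (f \<otimes>\<^sub>1 g) \<cdot> (x \<otimes>\<^sub>1 y)) \<bullet>
       (?m \<rhd> ((tsplit G w w f g \<lhd> (x \<otimes>\<^sub>1 y)) \<bullet> tsplit G (w \<cdot> f) (w \<cdot> g) x y))"
    using assms by (simp add: elt_psi_def)
  also have "\<dots> = ((psi W \<lhd> (f \<otimes>\<^sub>1 g) \<cdot> (x \<otimes>\<^sub>1 y)) \<bullet> (?m \<cdot> (w \<otimes>\<^sub>1 w) \<rhd> ?K)) \<bullet>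
      (?m \<rhd> tsplit G w w (f \<cdot> x) (g \<cdot> y))"
    using assms tsplit_assoc[of x y f g w w] by simp
  also have "\<dots> = (w \<cdot> mul A \<rhd> ?K) \<bullet> ps (f \<cdot> x) (g \<cdot> y)"
    using assms whisk_interchange[of ?K "psi W", symmetric] by (simp add: elt_psi_def)
  finally show ?thesis using assms by (simp add: elt_split_def)
qed

lemma ps_left:
  assumes "x \<in> Arr G" "y \<in> Arr G" "cod G x = ob A" "cod G y = ob A"
    "f \<in> Arr G" "cod G f = dom G x" "X = dom G y"
  shows "ps x y \<lhd> (f \<otimes>\<^sub>1 id1 G X) = ps (x \<cdot> f) y"
    "vinv G (ps x y) \<lhd> (f \<otimes>\<^sub>1 id1 G X) = vinv G (ps (x \<cdot> f) y)"
proof -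
  have "ps x y \<lhd> (f \<otimes>\<^sub>1 id1 G X) =
      (ps x y \<lhd> (f \<otimes>\<^sub>1 id1 G X)) \<bullet> elt_split G B (w \<cdot> x) (w \<cdot> y) f (id1 G X)"
    using assms by simp
  also have "\<dots> = (w \<rhd> elt_split G A x y f (id1 G X)) \<bullet> ps (x \<cdot> f) (y \<cdot> id1 G X)"
    by (rule ps_reindex) (use assms in simp_all)
  also have "\<dots> = ps (x \<cdot> f) y" using assms by simp
  finally show 1: "ps x y \<lhd> (f \<otimes>\<^sub>1 id1 G X) = ps (x \<cdot> f) y" .
  have "vinv G (ps x y \<lhd> (f \<otimes>\<^sub>1 id1 G X)) = vinv G (ps x y) \<lhd> (f \<otimes>\<^sub>1 id1 G X)"
    using assms by simp
  then show "vinv G (ps x y) \<lhd> (f \<otimes>\<^sub>1 id1 G X) = vinv G (ps (x \<cdot> f) y)"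
    by (simp add: 1)
qed

text \<open>With \<open>A.one\<close> in the first slot the comparison cell over \<open>A\<close> is
  an identity; the one over \<open>B\<close> remains, because \<open>f\<close> has to cross
  \<open>w\<close>.\<close>

lemma ips_right:
  assumes "y \<in> Arr G" "cod G y = ob A" "f \<in> Arr G" "cod G f = dom G y"
  shows "vinv G (ps A.one y) \<lhd> (A.one \<otimes>\<^sub>1 f) =
    elt_split G B w (w \<cdot> y) A.one f \<bullet> vinv G (ps A.one (y \<cdot> f))"
    (is "_ = ?rhs")
proof -
  have "(ps A.one y \<lhd> (A.one \<otimes>\<^sub>1 f)) \<bullet> elt_split G B (w \<cdot> A.one) (w \<cdot> y) A.one f =
      (w \<rhd> elt_split G A A.one y A.one f) \<bullet> ps (A.one \<cdot> A.one) (y \<cdot> f)"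
    by (rule ps_reindex) (use assms in simp_all)
  also have "\<dots> = ps A.one (y \<cdot> f)" using assms by simp
  finally have "(ps A.one y \<lhd> (A.one \<otimes>\<^sub>1 f)) \<bullet> elt_split G B w (w \<cdot> y) A.one f = ps A.one (y \<cdot> f)"
    by simp
  then have "?rhs = vinv G (ps A.one y \<lhd> (A.one \<otimes>\<^sub>1 f))"
    by (rule vinv_move) (use assms in simp_all)
  then show ?thesis using assms by simp
qed

lemma act_assoc_left:
  assumes "a \<in> Arr G" "b \<in> Arr G" "y \<in> Arr G" "cod G a = ob A" "cod G b = ob A" "cod G y = ob B"
    "f \<in> Arr G" "cod G f = dom G a" "X = dom G b \<otimes>\<^sub>0 dom G y"
  shows "madj.act_assoc a b y \<lhd> (f \<otimes>\<^sub>1 id1 G X) = madj.act_assoc (a \<cdot> f) b y"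
proof -
  have "B.T2 (vinv G (ps a b)) (id2 G y) \<lhd> (f \<otimes>\<^sub>1 (id1 G (dom G b) \<otimes>\<^sub>1 id1 G (dom G y))) =
      B.T2 (vinv G (ps (a \<cdot> f) b)) (id2 G y)"
    using assms ps_left(2)[of a b f "dom G b"] by (simp del: tens1_id)
  then show ?thesis
    using assms by (simp add: madj.act_assoc_def B.elt_assoc_left)
qed

lemma act_assoc_mid:
  assumes "b \<in> Arr G" "y \<in> Arr G" "cod G b = ob A" "cod G y = ob B"
    "f \<in> Arr G" "cod G f = dom G b" "Y = dom G y"
  shows "madj.act_assoc A.one b y \<lhd> (A.one \<otimes>\<^sub>1 (f \<otimes>\<^sub>1 id1 G Y)) =
    elt_split G B w (B.T (w \<cdot> b) y) A.one (f \<otimes>\<^sub>1 id1 G Y) \<bullet> madj.act_assoc A.one (b \<cdot> f) y"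
    (is "?lhs = ?rhs")
proof -
  have mid: "(elt_assoc G B w (w \<cdot> b) y \<lhd> (A.one \<otimes>\<^sub>1 (f \<otimes>\<^sub>1 id1 G Y))) \<bullet>
      B.T2 (elt_split G B w (w \<cdot> b) A.one f) (id2 G y) =
     elt_split G B w (B.T (w \<cdot> b) y) A.one (f \<otimes>\<^sub>1 id1 G Y) \<bullet> elt_assoc G B w (w \<cdot> b \<cdot> f) y"
    by (rule B.elt_assoc_mid) (use assms in simp_all)
  have "?lhs =
     (elt_assoc G B w (w \<cdot> b) y \<lhd> (A.one \<otimes>\<^sub>1 (f \<otimes>\<^sub>1 id1 G Y))) \<bullet>
     B.T2 (elt_split G B w (w \<cdot> b) A.one f \<bullet> vinv G (ps A.one (b \<cdot> f))) (id2 G y)"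
    using assms ips_right[OF assms(1,3,5,6)] by (simp add: madj.act_assoc_def)
  also have "\<dots> = ((elt_assoc G B w (w \<cdot> b) y \<lhd> (A.one \<otimes>\<^sub>1 (f \<otimes>\<^sub>1 id1 G Y))) \<bullet>
     B.T2 (elt_split G B w (w \<cdot> b) A.one f) (id2 G y)) \<bullet>
     B.T2 (vinv G (ps A.one (b \<cdot> f))) (id2 G y)"
    using assms by (simp add: B.elt.T2_vcomp)
  also have "\<dots> = ?rhs"
    unfolding mid using assms by (simp add: madj.act_assoc_def)
  finally show ?thesis .
qed

lemma proj_left_left:
  assumes "a \<in> Arr G" "y \<in> Arr G" "cod G a = ob A" "cod G y = ob B"
    "f \<in> Arr G" "cod G f = dom G a" "Y = dom G y"
  shows "madj.proj_left a y \<lhd> (f \<otimes>\<^sub>1 id1 G Y) = madj.proj_left (a \<cdot> f) y"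
proof -
  have 1: "vinv G (ps a (r \<cdot> y)) \<lhd> (f \<otimes>\<^sub>1 id1 G Y) = vinv G (ps (a \<cdot> f) (r \<cdot> y))"
    by (rule ps_left(2)) (use assms in simp_all)
  show ?thesis using assms by (simp add: madj.proj_left_def madj.mate_def 1 1[unfolded assms(7)])
qed

text \<open>Reindexing \<open>y\<close> by \<open>f\<close> has to cross \<open>w\<close>, hence the
  \<open>elt_split\<close>. Its inverse stands in the zigzag law \<open>triangle\<close>, and the
  two are matched when the projection cell is inverted.\<close>

lemma proj_left_right:
  assumes "y \<in> Arr G" "cod G y = ob B" "f \<in> Arr G" "cod G f = dom G y"
  shows "madj.proj_left A.one y \<lhd> (A.one \<otimes>\<^sub>1 f) =
    (r \<rhd> elt_split G B w y A.one f) \<bullet> madj.proj_left A.one (y \<cdot> f)"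
    (is "?lhs = ?rhs")
proof -
  have 1: "elt_split G B w y A.one f \<bullet> B.T2 (id2 G w \<lhd> A.one) (adj_counit W \<lhd> y \<lhd> f) =
      (B.T2 (id2 G w) (adj_counit W \<lhd> y) \<lhd> (A.one \<otimes>\<^sub>1 f)) \<bullet> elt_split G B w (w \<cdot> (r \<cdot> y)) A.one f"
  proof -
    have "elt_split G B (trg G (id2 G w)) (trg G (adj_counit W \<lhd> y)) A.one f \<bullet>
        B.T2 (id2 G w \<lhd> A.one) (adj_counit W \<lhd> y \<lhd> f) =
      (B.T2 (id2 G w) (adj_counit W \<lhd> y) \<lhd> (A.one \<otimes>\<^sub>1 f)) \<bullet>
        elt_split G B (src G (id2 G w)) (src G (adj_counit W \<lhd> y)) A.one f"
      by (rule B.elt_split_nat) (use assms in simp_all)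
    then show ?thesis using assms by simp
  qed
  have 2: "vinv G (ps A.one (r \<cdot> y)) \<lhd> (A.one \<otimes>\<^sub>1 f) =
      elt_split G B w (w \<cdot> (r \<cdot> y)) A.one f \<bullet> vinv G (ps A.one (r \<cdot> y \<cdot> f))"
    by (rule ips_right) (use assms in simp_all)
  have "?rhs =
    (r \<rhd> ((elt_split G B w y A.one f \<bullet> B.T2 (id2 G w \<lhd> A.one) (adj_counit W \<lhd> y \<lhd> f)) \<bullet>
      vinv G (ps A.one (r \<cdot> (y \<cdot> f))))) \<bullet> (adj_unit W \<lhd> A.T A.one (r \<cdot> (y \<cdot> f)))"
    using assms by (simp add: madj.proj_left_def madj.mate_def)
  also have "\<dots> = ?lhs"
    unfolding 1 using assms by (simp add: madj.proj_left_def madj.mate_def 2)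
  finally show ?thesis by simp
qed

end

section \<open>Duals\<close>

text \<open>The pairs \<open>(nn, nu)\<close> and \<open>(ee, ep)\<close> are the unit and counit
  1-cells of the bidual in the lax slice. Slice 2-cells point against their 1-cells, so the unit
  carries the evaluation \<open>nu\<close> and the counit the coevaluation \<open>ep\<close>. The
  composite in the last assumption is the 2-cell part of \<open>snake_x\<close>, written out because
  its ingredients are named only below.\<close>

locale left_dual = pseudomonoid_in G P
  for G :: "('o, 'm, 'c) gray" (structure) and P +
  fixes d nn ee :: 'm and nu ep :: 'c
  assumes dual_simps [simp]: "d \<in> Arr G" "cod G d = B"
    "nn \<in> Arr G" "dom G nn = unit_obj G" "cod G nn = dom G d \<otimes>\<^sub>0 B"
    "ee \<in> Arr G" "dom G ee = B \<otimes>\<^sub>0 dom G d" "cod G ee = unit_obj G"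
    "nu \<in> Cell G" "src G nu = T d one \<cdot> nn" "trg G nu = u"
    "ep \<in> Cell G" "src G ep = u \<cdot> ee" "trg G ep = T one d"
    and zigzag_invertible: "invertible G (elt_runit G P one \<bullet> (T2 (id2 G one) nu \<bullet>
      ((elt_assoc G P one d one \<bullet> (T2 ep (id2 G one) \<bullet>
        (vinv G (elt_lunit G P one) \<lhd> (ee \<otimes>\<^sub>1 one)))) \<lhd> (one \<otimes>\<^sub>1 nn))))"
begin

text \<open>The natural 2-cells \<open>x \<rightarrow> a \<odot> (d \<odot> x)\<close> and \<open>d \<odot> (a \<odot> x) \<rightarrow> x\<close> for \<open>a = one\<close>, where \<open>x\<close> in the first and
  \<open>d \<odot> (a \<odot> x)\<close> in the second are precomposed with the counit \<open>ee\<close> and the unit \<open>nn\<close> of the bidual.\<close>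

definition coev :: "'m \<Rightarrow> 'c"
  where "coev x = elt_assoc G P one d x \<bullet> (T2 ep (id2 G x) \<bullet>
    (vinv G (elt_lunit G P x) \<lhd> (ee \<otimes>\<^sub>1 id1 G (dom G x))))"

definition ev :: "'m \<Rightarrow> 'c"
  where "ev x = elt_lunit G P x \<bullet> (T2 nu (id2 G x) \<bullet>
    (vinv G (elt_assoc G P d one x) \<lhd> (nn \<otimes>\<^sub>1 id1 G (dom G x))))"

text \<open>The composite \<open>a -> a (d a) -> a\<close> at \<open>a = one\<close>. Its source is
  not \<open>one\<close> but \<open>(ee B)(B nn)\<close>, which is why it cannot be required to be
  an identity.\<close>

definition zigzag :: 'c
  where "zigzag = elt_runit G P one \<bullet> (T2 (id2 G one) nu \<bullet> (coev one \<lhd> (one \<otimes>\<^sub>1 nn)))"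

lemma coev_simps [simp]:
  assumes "x \<in> Arr G" "cod G x = B"
  shows "coev x \<in> Cell G" "src G (coev x) = x \<cdot> (ee \<otimes>\<^sub>1 id1 G (dom G x))" "trg G (coev x) = T one (T d x)"
  using assms by (simp_all add: coev_def)

lemma ev_simps [simp]:
  assumes "x \<in> Arr G" "cod G x = B"
  shows "ev x \<in> Cell G" "src G (ev x) = T d (T one x) \<cdot> (nn \<otimes>\<^sub>1 id1 G (dom G x))" "trg G (ev x) = x"
  using assms by (simp_all add: ev_def)

lemma zigzag_simps [simp]:
  "zigzag \<in> Cell G" "src G zigzag = (ee \<otimes>\<^sub>1 one) \<cdot> (one \<otimes>\<^sub>1 nn)" "trg G zigzag = one" "invertible G zigzag"
  using zigzag_invertible by (simp_all add: zigzag_def coev_def)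

lemma coev_nat:
  assumes "b \<in> Cell G" "cod G (src G b) = B"
  shows "coev (trg G b) \<bullet> (b \<lhd> (ee \<otimes>\<^sub>1 id1 G (dom G (src G b)))) =
    T2 (id2 G one) (T2 (id2 G d) b) \<bullet> coev (src G b)"
proof -
  let ?x = "src G b" and ?y = "trg G b"
  let ?e = "ee \<otimes>\<^sub>1 id1 G (dom G ?x)"
  have l: "vinv G (elt_lunit G P ?y) \<bullet> b = T2 (id2 G u) b \<bullet> vinv G (elt_lunit G P ?x)"
    by (rule vinv_square[OF elt.la_nat[OF assms]]) (use assms in simp_all)
  have al: "elt_assoc G P one d ?y \<bullet> T2 (T2 (id2 G one) (id2 G d)) b =
      T2 (id2 G one) (T2 (id2 G d) b) \<bullet> elt_assoc G P one d ?x"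
    using elt.al_nat[of "id2 G one" "id2 G d" b] by (simp add: assms)
  have "coev ?y \<bullet> (b \<lhd> ?e) = elt_assoc G P one d ?y \<bullet> (T2 ep (id2 G ?y) \<bullet> ((vinv G (elt_lunit G P ?y) \<bullet> b) \<lhd> ?e))"
    using assms by (simp add: coev_def)
  also have "\<dots> = elt_assoc G P one d ?y \<bullet> (T2 ep b \<bullet> (vinv G (elt_lunit G P ?x) \<lhd> ?e))"
    unfolding l using assms by (simp add: elt.T2_merge)
  also have "\<dots> = elt_assoc G P one d ?y \<bullet> T2 (T2 (id2 G one) (id2 G d)) b \<bullet>
      (T2 ep (id2 G ?x) \<bullet> (vinv G (elt_lunit G P ?x) \<lhd> ?e))"
    using assms by (simp add: elt.T2_merge)
  also have "\<dots> = T2 (id2 G one) (T2 (id2 G d) b) \<bullet> coev ?x"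
    unfolding al using assms by (simp add: coev_def)
  finally show ?thesis .
qed

end

section \<open>Duality transported along a strong monoidal map\<close>

locale strong_dual = strong_map G A B W + D: left_dual G A d nn ee nu ep
  for G :: "('o, 'm, 'c) gray" (structure) and A B W d nn ee nu ep
begin

definition act_coev :: "'m \<Rightarrow> 'c"
  where "act_coev y = madj.act_assoc A.one d y \<bullet> (B.T2 (w \<rhd> ep) (id2 G y) \<bullet>
    (vinv G (madj.act_unit y) \<lhd> (ee \<otimes>\<^sub>1 id1 G (dom G y))))"

definition act_ev :: "'m \<Rightarrow> 'c"
  where "act_ev y = madj.act_unit y \<bullet> (B.T2 (w \<rhd> nu) (id2 G y) \<bullet>
    (vinv G (madj.act_assoc d A.one y) \<lhd> (nn \<otimes>\<^sub>1 id1 G (dom G y))))"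

lemma act_coev_simps [simp]:
  assumes "y \<in> Arr G" "cod G y = ob B"
  shows "act_coev y \<in> Cell G" "src G (act_coev y) = y \<cdot> (ee \<otimes>\<^sub>1 id1 G (dom G y))" "trg G (act_coev y) = B.T w (B.T (w \<cdot> d) y)"
  using assms by (simp_all add: act_coev_def)

lemma act_ev_simps [simp]:
  assumes "y \<in> Arr G" "cod G y = ob B"
  shows "act_ev y \<in> Cell G" "src G (act_ev y) = B.T (w \<cdot> d) (B.T w y) \<cdot> (nn \<otimes>\<^sub>1 id1 G (dom G y))" "trg G (act_ev y) = y"
  using assms by (simp_all add: act_ev_def)

text \<open>Since \<open>w\<close> is \<open>w\<close> applied to the generic element, the pentagon
  of the action lets the coevaluation be formed in \<open>A\<close> first and then act on
  \<open>y\<close>.\<close>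

lemma act_coev_T:
  assumes "y \<in> Arr G" "cod G y = ob B"
  shows "act_coev (B.T w y) = B.T2 (id2 G w) (madj.act_assoc d A.one y) \<bullet>
    (madj.act_assoc A.one (A.T d A.one) y \<bullet> B.T2 (w \<rhd> D.coev A.one) (id2 G y))"
    (is "_ = ?rhs")
proof -
  let ?l = "elt_lunit G A A.one" and ?e = "ee \<otimes>\<^sub>1 id1 G (ob A \<otimes>\<^sub>0 dom G y)"
  have e: "ee \<otimes>\<^sub>1 id1 G (ob A \<otimes>\<^sub>0 dom G y) = ee \<otimes>\<^sub>1 (A.one \<otimes>\<^sub>1 id1 G (dom G y))"
    using assms by simp
  have "madj.act_unit (B.T w y) \<bullet> madj.act_assoc (uni A) A.one y = B.T2 (w \<rhd> ?l) (id2 G y)"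
    using madj.act_unit_act_assoc[of A.one y] assms by simp
  then have "madj.act_assoc (uni A) A.one y \<bullet> vinv G (B.T2 (w \<rhd> ?l) (id2 G y)) = vinv G (madj.act_unit (B.T w y))"
    by (rule vinv_move) (use assms in simp_all)
  then have l: "vinv G (madj.act_unit (B.T w y)) = madj.act_assoc (uni A) A.one y \<bullet> B.T2 (w \<rhd> vinv G ?l) (id2 G y)"
    using assms by simp
  have bl: "madj.act_assoc (uni A) A.one y \<lhd> ?e = madj.act_assoc (uni A \<cdot> ee) A.one y"
    by (rule act_assoc_left) (use assms in simp_all)
  have tl: "B.T2 (w \<rhd> vinv G ?l) (id2 G y) \<lhd> ?e = B.T2 (w \<rhd> vinv G ?l \<lhd> (ee \<otimes>\<^sub>1 A.one)) (id2 G y)"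
    unfolding e using assms by (simp del: tens1_id)
  have bn: "madj.act_assoc (A.T A.one d) A.one y \<bullet> B.T2 (w \<rhd> A.T2 ep (id2 G A.one)) (id2 G y) =
      B.T2 (w \<rhd> ep) (id2 G (B.T w y)) \<bullet> madj.act_assoc (uni A \<cdot> ee) A.one y"
    using madj.act_assoc_nat[of ep "id2 G A.one" "id2 G y"] assms by simp
  have pent: "madj.act_assoc A.one d (B.T w y) \<bullet> madj.act_assoc (A.T A.one d) A.one y =
     B.T2 (id2 G w) (madj.act_assoc d A.one y) \<bullet> (madj.act_assoc A.one (A.T d A.one) y \<bullet>
      B.T2 (w \<rhd> elt_assoc G A A.one d A.one) (id2 G y))"
    using madj.act_assoc_pentagon[of A.one d A.one y] assms by simp
  have "act_coev (B.T w y) = madj.act_assoc A.one d (B.T w y) \<bullet> ((B.T2 (w \<rhd> ep) (id2 G (B.T w y)) \<bullet>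
     madj.act_assoc (uni A \<cdot> ee) A.one y) \<bullet> B.T2 (w \<rhd> vinv G ?l \<lhd> (ee \<otimes>\<^sub>1 A.one)) (id2 G y))"
    using assms bl tl by (simp add: act_coev_def l)
  also have "\<dots> = (madj.act_assoc A.one d (B.T w y) \<bullet> madj.act_assoc (A.T A.one d) A.one y) \<bullet>
      (B.T2 (w \<rhd> A.T2 ep (id2 G A.one)) (id2 G y) \<bullet> B.T2 (w \<rhd> vinv G ?l \<lhd> (ee \<otimes>\<^sub>1 A.one)) (id2 G y))"
    unfolding bn[symmetric] using assms by simp
  also have "\<dots> = ?rhs"
    unfolding pent using assms by (simp add: D.coev_def B.elt.T2_merge)
  finally show ?thesis .
qed

text \<open>By \<open>act_coev_T\<close> the coevaluation comes from \<open>A\<close>; naturality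
  and the triangle law of the action bring the evaluation there too, so the composite is the zigzag
  of \<open>A\<close> acting on \<open>y\<close>. The inverse \<open>elt_split\<close> moves the
  reindexing by \<open>nn\<close> past \<open>w\<close>.\<close>

lemma triangle:
  assumes "y \<in> Arr G" "cod G y = ob B" "Y = dom G y"
  shows "B.T2 (id2 G w) (act_ev y) \<bullet>
    (vinv G (elt_split G B w (B.T (w \<cdot> d) (B.T w y)) A.one (nn \<otimes>\<^sub>1 id1 G Y)) \<bullet>
      (act_coev (B.T w y) \<lhd> (A.one \<otimes>\<^sub>1 (nn \<otimes>\<^sub>1 id1 G Y)))) = B.T2 (w \<rhd> D.zigzag) (id2 G y)"
proof -
  let ?f = "nn \<otimes>\<^sub>1 id1 G (dom G y)"
  let ?q = "A.one \<otimes>\<^sub>1 ?f"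
  let ?S = "elt_split G B w (B.T (w \<cdot> d) (B.T w y)) A.one ?f"
  let ?S' = "elt_split G B w (B.T (w \<cdot> A.T d A.one) y) A.one ?f"
  let ?b = "madj.act_assoc d A.one y" and ?b' = "madj.act_assoc A.one (A.T d A.one \<cdot> nn) y"
  let ?t = "B.T2 (w \<rhd> D.coev A.one \<lhd> (A.one \<otimes>\<^sub>1 nn)) (id2 G y)"
  have 1: "(B.T2 (id2 G w) ?b \<lhd> ?q) \<bullet> ?S' = ?S \<bullet> B.T2 (id2 G w) (?b \<lhd> ?f)"
  proof -
    have "elt_split G B (trg G (id2 G w)) (trg G ?b) A.one ?f \<bullet> B.T2 (id2 G w \<lhd> A.one) (?b \<lhd> ?f) =
       (B.T2 (id2 G w) ?b \<lhd> ?q) \<bullet> elt_split G B (src G (id2 G w)) (src G ?b) A.one ?f"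
      by (rule B.elt_split_nat) (use assms in simp_all)
    then show ?thesis using assms by simp
  qed
  have 2: "madj.act_assoc A.one (A.T d A.one) y \<lhd> ?q = ?S' \<bullet> ?b'"
    by (rule act_assoc_mid) (use assms in simp_all)
  have 3: "B.T2 (w \<rhd> D.coev A.one) (id2 G y) \<lhd> ?q = ?t"
    using assms by simp
  have 4: "madj.act_assoc A.one (uni A) y \<bullet> B.T2 (w \<rhd> A.T2 (id2 G A.one) nu) (id2 G y) =
      B.T2 (id2 G w) (B.T2 (w \<rhd> nu) (id2 G y)) \<bullet> ?b'"
    using madj.act_assoc_nat[of "id2 G A.one" nu "id2 G y"] assms by simp
  have 5: "B.T2 (id2 G w) (madj.act_unit y) \<bullet> madj.act_assoc A.one (uni A) y = B.T2 (w \<rhd> elt_runit G A A.one) (id2 G y)"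
    using madj.act_assoc_triangle[of A.one y] assms by simp
  have "act_coev (B.T w y) \<lhd> ?q = ((B.T2 (id2 G w) ?b \<lhd> ?q) \<bullet> ?S') \<bullet> (?b' \<bullet> ?t)"
    unfolding act_coev_T[OF assms(1,2)] using assms by (simp add: 2)
  also have "\<dots> = ?S \<bullet> (B.T2 (id2 G w) (?b \<lhd> ?f) \<bullet> (?b' \<bullet> ?t))"
    unfolding 1 using assms by simp
  finally have "B.T2 (id2 G w) (act_ev y) \<bullet> (vinv G ?S \<bullet> (act_coev (B.T w y) \<lhd> ?q)) =
     B.T2 (id2 G w) (act_ev y) \<bullet> (B.T2 (id2 G w) (?b \<lhd> ?f) \<bullet> (?b' \<bullet> ?t))"
    using assms by simp
  also have "\<dots> = B.T2 (id2 G w) (madj.act_unit y) \<bullet> ((B.T2 (id2 G w) (B.T2 (w \<rhd> nu) (id2 G y)) \<bullet> ?b') \<bullet> ?t)"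
  proof -
    \<comment> \<open>The \<open>act_assoc\<close> produced by \<open>act_coev_T\<close> cancels the
      inverse one inside \<open>act_ev\<close>.\<close>
    have "act_ev y \<bullet> (?b \<lhd> ?f) = madj.act_unit y \<bullet> (B.T2 (w \<rhd> nu) (id2 G y) \<bullet> ((vinv G ?b \<bullet> ?b) \<lhd> ?f))"
      using assms by (simp add: act_ev_def del: vinv_simps(4,5) flip: whisk_vcomp)
    then have "act_ev y \<bullet> (?b \<lhd> ?f) = madj.act_unit y \<bullet> B.T2 (w \<rhd> nu) (id2 G y)" using assms by simp
    then show ?thesis using assms by (simp add: B.elt.T2_merge)
  qed
  also have "\<dots> = (B.T2 (id2 G w) (madj.act_unit y) \<bullet> madj.act_assoc A.one (uni A) y) \<bullet>
      (B.T2 (w \<rhd> A.T2 (id2 G A.one) nu) (id2 G y) \<bullet> ?t)"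
    unfolding 4[symmetric] using assms by simp
  also have "\<dots> = B.T2 (w \<rhd> D.zigzag) (id2 G y)"
    unfolding 5 using assms by (simp add: D.zigzag_def B.elt.T2_merge)
  finally show ?thesis using assms(3) by simp
qed

text \<open>The coevaluation is built from an associator, a tensored cell and an inverse unit cell.
  Projection cells pass through each of them: by the module law, by naturality and by the module
  unit law.\<close>

lemma act_coev_proj_left:
  assumes "y \<in> Arr G" "cod G y = ob B"
  shows "madj.proj_left A.one (B.T (w \<cdot> d) y) \<bullet> (A.T2 (id2 G A.one) (madj.proj_left d y) \<bullet> D.coev (r \<cdot> y)) = r \<rhd> act_coev y"
    (is "?lhs = _")
proof -
  let ?e = "ee \<otimes>\<^sub>1 id1 G (dom G y)" and ?l = "vinv G (elt_lunit G A (r \<cdot> y))"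
  have 1: "madj.proj_left A.one (B.T (w \<cdot> d) y) \<bullet> (A.T2 (id2 G A.one) (madj.proj_left d y) \<bullet> elt_assoc G A A.one d (r \<cdot> y)) =
      (r \<rhd> madj.act_assoc A.one d y) \<bullet> madj.proj_left (A.T A.one d) y"
    using madj.proj_left_act_assoc[of A.one d y] assms by simp
  have 2: "madj.proj_left (A.T A.one d) y \<bullet> A.T2 ep (id2 G (r \<cdot> y)) =
      (r \<rhd> B.T2 (w \<rhd> ep) (id2 G y)) \<bullet> madj.proj_left (uni A \<cdot> ee) y"
    using madj.proj_left_nat[of ep "id2 G y"] assms by simp
  have 3: "madj.proj_left (uni A) y \<lhd> ?e = madj.proj_left (uni A \<cdot> ee) y"
    by (rule proj_left_left) (use assms in simp_all)
  have "(r \<rhd> madj.act_unit y) \<bullet> madj.proj_left (uni A) y = elt_lunit G A (r \<cdot> y)"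
    using madj.proj_left_act_unit[of y] assms by simp
  then have "madj.proj_left (uni A) y \<bullet> ?l = vinv G (r \<rhd> madj.act_unit y)"
    by (rule vinv_move) (use assms in simp_all)
  then have 4: "madj.proj_left (uni A) y \<bullet> ?l = r \<rhd> vinv G (madj.act_unit y)"
    using assms by simp
  have "?lhs =
     (madj.proj_left A.one (B.T (w \<cdot> d) y) \<bullet> (A.T2 (id2 G A.one) (madj.proj_left d y) \<bullet> elt_assoc G A A.one d (r \<cdot> y))) \<bullet>
     (A.T2 ep (id2 G (r \<cdot> y)) \<bullet> (?l \<lhd> ?e))"
    using assms by (simp add: D.coev_def)
  also have "\<dots> = (r \<rhd> madj.act_assoc A.one d y) \<bullet> ((madj.proj_left (A.T A.one d) y \<bullet> A.T2 ep (id2 G (r \<cdot> y))) \<bullet> (?l \<lhd> ?e))"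
    unfolding 1 using assms by simp
  also have "\<dots> = (r \<rhd> madj.act_assoc A.one d y) \<bullet> ((r \<rhd> B.T2 (w \<rhd> ep) (id2 G y)) \<bullet> ((madj.proj_left (uni A) y \<bullet> ?l) \<lhd> ?e))"
    unfolding 2 using assms by (simp add: 3)
  also have "\<dots> = r \<rhd> act_coev y"
    unfolding 4 using assms by (simp add: act_coev_def)
  finally show ?thesis .
qed

text \<open>The same passage for the evaluation, with the module law read backwards because the
  inverse associator occurs.\<close>

lemma act_ev_proj_left:
  assumes "y \<in> Arr G" "cod G y = ob B"
  shows "(r \<rhd> act_ev y) \<bullet> ((madj.proj_left d (B.T w y) \<bullet> A.T2 (id2 G d) (madj.proj_left A.one y)) \<lhd> (nn \<otimes>\<^sub>1 id1 G (dom G y))) =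
    D.ev (r \<cdot> y)"
proof -
  let ?f = "nn \<otimes>\<^sub>1 id1 G (dom G y)" and ?b = "madj.act_assoc d A.one y"
  let ?a = "elt_assoc G A d A.one (r \<cdot> y)"
  let ?h = "madj.proj_left d (B.T w y) \<bullet> A.T2 (id2 G d) (madj.proj_left A.one y)"
  have 1: "(r \<rhd> ?b) \<bullet> madj.proj_left (A.T d A.one) y = ?h \<bullet> ?a"
    using madj.proj_left_act_assoc[of d A.one y] assms by simp
  have 2: "(r \<rhd> vinv G ?b) \<bullet> ?h = madj.proj_left (A.T d A.one) y \<bullet> vinv G ?a"
  proof -
    have "vinv G (r \<rhd> ?b) \<bullet> ?h = madj.proj_left (A.T d A.one) y \<bullet> vinv G ?a"
      by (rule vinv_square[OF 1]) (use assms in simp_all)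
    then show ?thesis using assms by simp
  qed
  have 3: "madj.proj_left (A.T d A.one) y \<lhd> ?f = madj.proj_left (A.T d A.one \<cdot> nn) y"
    by (rule proj_left_left) (use assms in simp_all)
  have 4: "madj.proj_left (uni A) y \<bullet> A.T2 nu (id2 G (r \<cdot> y)) =
      (r \<rhd> B.T2 (w \<rhd> nu) (id2 G y)) \<bullet> madj.proj_left (A.T d A.one \<cdot> nn) y"
    using madj.proj_left_nat[of nu "id2 G y"] assms by simp
  have 5: "(r \<rhd> madj.act_unit y) \<bullet> madj.proj_left (uni A) y = elt_lunit G A (r \<cdot> y)"
    using madj.proj_left_act_unit[of y] assms by simp
  have "(r \<rhd> act_ev y) \<bullet> (?h \<lhd> ?f) = (r \<rhd> madj.act_unit y) \<bullet> ((r \<rhd> B.T2 (w \<rhd> nu) (id2 G y)) \<bullet>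
      (((r \<rhd> vinv G ?b) \<bullet> ?h) \<lhd> ?f))"
    using assms by (simp add: act_ev_def)
  also have "\<dots> = (r \<rhd> madj.act_unit y) \<bullet> (((r \<rhd> B.T2 (w \<rhd> nu) (id2 G y)) \<bullet> madj.proj_left (A.T d A.one \<cdot> nn) y) \<bullet>
      (vinv G ?a \<lhd> ?f))"
    unfolding 2 using assms by (simp add: 3)
  also have "\<dots> = ((r \<rhd> madj.act_unit y) \<bullet> madj.proj_left (uni A) y) \<bullet> (A.T2 nu (id2 G (r \<cdot> y)) \<bullet> (vinv G ?a \<lhd> ?f))"
    unfolding 4[symmetric] using assms by simp
  also have "\<dots> = D.ev (r \<cdot> y)"
    unfolding 5 using assms by (simp add: D.ev_def)
  finally show ?thesis .
qed

end

section \<open>The identity map, and the dual supplied by left autonomy\<close>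

definition id_map :: "('o, 'm, 'c) gray \<Rightarrow> ('o, 'm, 'c) pmon \<Rightarrow> ('m, 'c) monoidal_map"
  where "id_map G P = \<lparr>arr = id1 G (ob P), radj = id1 G (ob P), adj_unit = id2 G (id1 G (ob P)),
    adj_counit = id2 G (id1 G (ob P)), psi = id2 G (mul P), psi0 = id2 G (uni P)\<rparr>"

context pseudomonoid_in
begin

lemma strong_map_id_map: "strong_map G P P (id_map G P)"
proof
  have t: "m \<otimes>\<^sub>R B = m \<otimes>\<^sub>1 one" "B \<otimes>\<^sub>L m = one \<otimes>\<^sub>1 m" "u \<otimes>\<^sub>R B = u \<otimes>\<^sub>1 one" "B \<otimes>\<^sub>L u = one \<otimes>\<^sub>1 u"
    by (simp_all only: act1_tens1 pmon_simps)
  have "lax_monoidal G P P one (id2 G m) (id2 G u)"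
    unfolding lax_monoidal_def Let_def t by (simp add: mem_hom1 mem_hom2)
  then show "strong_monoidal_map G P P (id_map G P)"
    by (simp add: strong_monoidal_map_def id_map_def adjunction_def mem_hom1 mem_hom2)
qed (rule pseudomonoid)+

lemma T_whisk:
  assumes "x \<in> Arr G" "y \<in> Arr G" "cod G x = B" "cod G y = B" "a \<in> Cell G" "cod G (src G a) = dom G x" "X = dom G y"
  shows "T x y \<rhd> (a \<otimes>\<^sub>2 id2 G (id1 G X)) = T2 (x \<rhd> a) (id2 G y)"
  using assms by (simp add: slice_tens0_def elt_tens2_def tens2_id_whisk flip: whisk_whisk(1))

text \<open>A coherence 1-cell of the lax slice carries a 2-cell pointing the opposite way, so the
  cells of the slice and those of the fibre are mutually inverse.\<close>

lemma vinv_assoc_cell: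
  assumes "x \<in> Arr G" "y \<in> Arr G" "z \<in> Arr G" "cod G x = B" "cod G y = B" "cod G z = B"
  shows "vinv G (assoc_cell G P x y z) = elt_assoc G P x y z"
  using assms by (simp add: assoc_cell_def elt_assoc_def Let_def)

lemma unit_cells:
  assumes "x \<in> Arr G" "cod G x = B"
  shows "lunit_cell G P x = vinv G (elt_lunit G P x)" "vinv G (runit_cell G P x) = elt_runit G P x"
  using assms by (simp_all add: lunit_cell_def runit_cell_def elt_lunit_def elt_runit_def)

text \<open>A slice 2-cell \<open>\<zeta>\<close> from the snake to \<open>slice_id\<close>
  satisfies \<open>id2 \<bullet> \<zeta> = snd (snake_x ...)\<close>. So the 2-cell part of the
  snake is \<open>\<zeta>\<close> itself, and therefore invertible.\<close>

lemma left_autonomousE: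
  assumes "left_autonomous G P"
  obtains d nn ee nu ep where "left_dual G P d nn ee nu ep"
proof -
  from assms obtain d where "slice_right_bidual G P one d"
    unfolding left_autonomous_def by blast
  then obtain n e \<theta> \<zeta> where d: "d \<in> slice_obj G P"
    and n: "n \<in> slice_hom1 G u (T d one)" and e: "e \<in> slice_hom1 G (T one d) u"
    and z: "\<zeta> \<in> slice_hom2 G one (snake_x G P one d n e) (slice_id G one)" and iz: "invertible G \<zeta>"
    unfolding slice_right_bidual_def by blast
  obtain nn nu where n': "n = (nn, nu)" by (cases n)
  obtain ee ep where e': "e = (ee, ep)" by (cases e)
  have [simp]: "d \<in> Arr G" "cod G d = B" using d by (auto simp: slice_obj_def)
  have [simp]: "nn \<in> Arr G" "dom G nn = unit_obj G" "cod G nn = dom G d \<otimes>\<^sub>0 B"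
    "nu \<in> Cell G" "src G nu = T d one \<cdot> nn" "trg G nu = u"
    using n by (auto simp: n' slice_hom1_def mem_hom1 mem_hom2)
  have [simp]: "ee \<in> Arr G" "dom G ee = B \<otimes>\<^sub>0 dom G d" "cod G ee = unit_obj G"
    "ep \<in> Cell G" "src G ep = u \<cdot> ee" "trg G ep = T one d"
    using e by (auto simp: e' slice_hom1_def mem_hom1 mem_hom2)
  let ?zigzag = "elt_runit G P one \<bullet> (T2 (id2 G one) nu \<bullet>
      ((elt_assoc G P one d one \<bullet> (T2 ep (id2 G one) \<bullet>
        (vinv G (elt_lunit G P one) \<lhd> (ee \<otimes>\<^sub>1 one)))) \<lhd> (one \<otimes>\<^sub>1 nn)))"
  have "snd (snake_x G P one d n e) = ?zigzag"
    by (simp add: snake_x_def slice_comp_def slice_tens1_def slice_id_def slice_lunit_def slice_assoc_inv_def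
        slice_runit_inv_def n' e' vinv_assoc_cell unit_cells elt_tens2_def[symmetric] slice_tens0_def[symmetric])
  moreover have "snd (snake_x G P one d n e) = \<zeta>"
  proof -
    have [simp]: "\<zeta> \<in> Cell G" "trg G \<zeta> = one" and *: "id2 G one \<bullet> (one \<rhd> \<zeta>) = snd (snake_x G P one d n e)"
      using z by (simp_all add: slice_hom2_def slice_id_def mem_hom2)
    have "cod G (src G \<zeta>) = B" using cell_arrs(4)[of \<zeta>] by simp
    with * show ?thesis by simp
  qed
  ultimately have "?zigzag = \<zeta>" by simp
  with iz have "left_dual G P d nn ee nu ep"
    by unfold_locales (simp_all del: whisk_vcomp)
  then show ?thesis by (rule that)
qed

end

context left_dual
begin

text \<open>The law \<open>triangle\<close> for the identity map: the action becomes the tensor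
  product of the fibre, and the comparison cell crosses only \<open>one\<close>, so it is an
  identity.\<close>

lemma triangle_id:
  assumes "x \<in> Arr G" "cod G x = B" "X = dom G x"
  shows "T2 (id2 G one) (ev x) \<bullet> (coev (T one x) \<lhd> (one \<otimes>\<^sub>1 (nn \<otimes>\<^sub>1 id1 G X))) = T2 zigzag (id2 G x)"
proof -
  interpret I: strong_dual G P P "id_map G P" d nn ee nu ep
    by (intro strong_dual.intro strong_map_id_map left_dual_axioms)
  have a: "arr (id_map G P) = one" "psi (id_map G P) = id2 G m" "psi0 (id_map G P) = id2 G u"
    by (simp_all add: id_map_def)
  have ps: "elt_psi G P one (id2 G m) y z = id2 G (T y z)"
    if "y \<in> Arr G" "z \<in> Arr G" "cod G y = B" "cod G z = B" for y z
    using that by (simp add: elt_psi_def slice_tens0_def)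
  have act_assoc: "I.madj.act_assoc y z x = elt_assoc G P y z x"
    if "y \<in> Arr G" "z \<in> Arr G" "x \<in> Arr G" "cod G y = B" "cod G z = B" "cod G x = B" for y z x
    unfolding I.madj.act_assoc_def unfolding a using that by (simp add: ps)
  have act_unit: "I.madj.act_unit y = elt_lunit G P y" if "y \<in> Arr G" "cod G y = B" for y
    unfolding I.madj.act_unit_def unfolding a using that by simp
  have tc: "I.act_coev y = coev y" if "y \<in> Arr G" "cod G y = B" for y
    unfolding I.act_coev_def coev_def unfolding a using that by (simp add: act_assoc[unfolded a] act_unit[unfolded a])
  have nc: "I.act_ev y = ev y" if "y \<in> Arr G" "cod G y = B" for y
    unfolding I.act_ev_def ev_def unfolding a using that by (simp add: act_assoc[unfolded a] act_unit[unfolded a])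
  show ?thesis
    using I.triangle[OF assms] unfolding a using assms by (simp add: tc nc)
qed

end

section \<open>Inverting the first projection cell at the generic elements\<close>

context strong_dual
begin

text \<open>Moving the projection cell \<open>?h\<close> through the candidate inverse, by
  naturality, reindexing and \<open>act_coev_proj_left\<close>, turns coevaluation and evaluation
  into those of the action. Then \<open>triangle\<close> produces the zigzag, which meets its
  inverse.\<close>

lemma act_coev_proj_left_zigzag:
  "madj.proj_left A.one B.one \<bullet> (A.T2 (id2 G A.one) (r \<rhd> act_ev B.one) \<bullet>
     (((A.T2 (id2 G A.one) (madj.proj_left d (B.T w B.one)) \<bullet> D.coev (r \<cdot> B.T w B.one)) \<lhd>
       (A.one \<otimes>\<^sub>1 (nn \<otimes>\<^sub>1 B.one))) \<bullet> (r \<cdot> B.T w B.one \<rhd> (vinv G D.zigzag \<otimes>\<^sub>2 id2 G B.one)))) =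
    id2 G (r \<cdot> B.T w B.one)" (is "?h \<bullet> (?N \<bullet> ((?t \<lhd> ?q) \<bullet> ?x)) = _")
proof -
  let ?z = "B.T w B.one" and ?f = "nn \<otimes>\<^sub>1 B.one"
  let ?z' = "B.T (w \<cdot> d) ?z"
  let ?S = "elt_split G B w ?z' A.one ?f"
  let ?h' = "madj.proj_left A.one (?z' \<cdot> ?f)"
  have e: "((ee \<otimes>\<^sub>1 A.one) \<cdot> (A.one \<otimes>\<^sub>1 nn)) \<otimes>\<^sub>1 B.one = (ee \<otimes>\<^sub>1 id1 G (ob A \<otimes>\<^sub>0 ob B)) \<cdot> ?q"
    by (simp add: tens1_def)
  have 1: "?h \<bullet> ?N = (r \<rhd> B.T2 (id2 G w) (act_ev B.one)) \<bullet> ?h'"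
  proof -
    have "madj.proj_left (trg G (id2 G A.one)) (trg G (act_ev B.one)) \<bullet> ?N =
        (r \<rhd> B.T2 (w \<rhd> id2 G A.one) (act_ev B.one)) \<bullet> madj.proj_left (src G (id2 G A.one)) (src G (act_ev B.one))"
      by (rule madj.proj_left_nat) simp_all
    then show ?thesis by simp
  qed
  have "madj.proj_left A.one ?z' \<lhd> ?q = (r \<rhd> ?S) \<bullet> ?h'"
    by (rule proj_left_right) simp_all
  then have "(r \<rhd> vinv G ?S) \<bullet> (madj.proj_left A.one ?z' \<lhd> ?q) = vinv G (r \<rhd> ?S) \<bullet> ((r \<rhd> ?S) \<bullet> ?h')"
    by simp
  also have "\<dots> = ?h'" by (rule vinv_cancel(1)) simp_all
  finally have 2: "(r \<rhd> vinv G ?S) \<bullet> (madj.proj_left A.one ?z' \<lhd> ?q) = ?h'" .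
  have 3: "madj.proj_left A.one ?z' \<bullet> ?t = r \<rhd> act_coev ?z"
    by (rule act_coev_proj_left) simp_all
  have 4: "B.T2 (id2 G w) (act_ev B.one) \<bullet> (vinv G ?S \<bullet> (act_coev ?z \<lhd> ?q)) = B.T2 (w \<rhd> D.zigzag) (id2 G B.one)"
    by (rule triangle) simp_all
  have 5: "?z \<rhd> (vinv G D.zigzag \<otimes>\<^sub>2 id2 G B.one) = B.T2 (w \<rhd> vinv G D.zigzag) (id2 G B.one)"
    by (rule B.T_whisk) simp_all
  have "?h \<bullet> (?N \<bullet> ((?t \<lhd> ?q) \<bullet> ?x)) = (?h \<bullet> ?N) \<bullet> ((?t \<lhd> ?q) \<bullet> ?x)"
    by (simp add: e)
  also have "\<dots> = (r \<rhd> B.T2 (id2 G w) (act_ev B.one)) \<bullet> ((r \<rhd> vinv G ?S) \<bullet> (((madj.proj_left A.one ?z' \<bullet> ?t) \<lhd> ?q) \<bullet> ?x))"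
    unfolding 1 unfolding 2[symmetric] by (simp add: e)
  also have "\<dots> = r \<rhd> ((B.T2 (id2 G w) (act_ev B.one) \<bullet> (vinv G ?S \<bullet> (act_coev ?z \<lhd> ?q))) \<bullet>
      (?z \<rhd> (vinv G D.zigzag \<otimes>\<^sub>2 id2 G B.one)))"
    unfolding 3 by (simp add: e)
  also have "\<dots> = id2 G (r \<cdot> ?z)"
    unfolding 4 5 by (simp add: B.elt.T2_merge flip: whisk_vcomp)
  finally show ?thesis .
qed

text \<open>Here \<open>?h\<close> comes first and passes the inverse zigzag and the coevaluation by
  interchange and \<open>coev_nat\<close>; \<open>act_ev_proj_left\<close> then absorbs both
  projection cells into the evaluation of \<open>A\<close>, where \<open>triangle_id\<close>
  applies.\<close>

lemma act_ev_proj_left_zigzag: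
  "(A.T2 (id2 G A.one) (r \<rhd> act_ev B.one) \<bullet>
     (((A.T2 (id2 G A.one) (madj.proj_left d (B.T w B.one)) \<bullet> D.coev (r \<cdot> B.T w B.one)) \<lhd>
       (A.one \<otimes>\<^sub>1 (nn \<otimes>\<^sub>1 B.one))) \<bullet> (r \<cdot> B.T w B.one \<rhd> (vinv G D.zigzag \<otimes>\<^sub>2 id2 G B.one)))) \<bullet> madj.proj_left A.one B.one =
    id2 G (A.T A.one r)" (is "(?N \<bullet> (((?d \<bullet> ?T) \<lhd> ?q) \<bullet> ?x)) \<bullet> ?h = _")
proof -
  let ?z = "B.T w B.one" and ?f = "nn \<otimes>\<^sub>1 B.one" and ?v = "vinv G D.zigzag \<otimes>\<^sub>2 id2 G B.one"
  let ?e = "ee \<otimes>\<^sub>1 id1 G (ob A \<otimes>\<^sub>0 ob B)" and ?T' = "D.coev (A.T A.one r)"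
  let ?i = "A.T2 (id2 G A.one)"
  have e: "((ee \<otimes>\<^sub>1 A.one) \<cdot> (A.one \<otimes>\<^sub>1 nn)) \<otimes>\<^sub>1 B.one = ?e \<cdot> ?q"
    by (simp add: tens1_def)
  have 1: "?x \<bullet> ?h = (?h \<lhd> ?e \<cdot> ?q) \<bullet> (A.T A.one r \<rhd> ?v)"
  proof -
    have "(trg G ?h \<rhd> ?v) \<bullet> (?h \<lhd> src G ?v) = (?h \<lhd> trg G ?v) \<bullet> (src G ?h \<rhd> ?v)"
      by (rule whisk_interchange) simp_all
    then show ?thesis by (simp add: e)
  qed
  have 2: "?T \<bullet> (?h \<lhd> ?e) = ?i (A.T2 (id2 G d) ?h) \<bullet> ?T'"
  proof -
    have "D.coev (trg G ?h) \<bullet> (?h \<lhd> (ee \<otimes>\<^sub>1 id1 G (dom G (src G ?h)))) =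
        ?i (A.T2 (id2 G d) ?h) \<bullet> D.coev (src G ?h)"
      by (rule D.coev_nat) simp_all
    then show ?thesis by simp
  qed
  have 3: "(r \<rhd> act_ev B.one) \<bullet> ((madj.proj_left d ?z \<bullet> A.T2 (id2 G d) ?h) \<lhd> ?f) = D.ev r"
  proof -
    have "(r \<rhd> act_ev B.one) \<bullet> ((madj.proj_left d ?z \<bullet> A.T2 (id2 G d) ?h) \<lhd> (nn \<otimes>\<^sub>1 id1 G (dom G B.one))) =
        D.ev (r \<cdot> B.one)"
      by (rule act_ev_proj_left) simp_all
    then show ?thesis by simp
  qed
  have 4: "?i (D.ev r) \<bullet> (?T' \<lhd> ?q) = A.T2 D.zigzag (id2 G r)"
    by (rule D.triangle_id) simp_all
  have 5: "A.T A.one r \<rhd> ?v = A.T2 (A.one \<rhd> vinv G D.zigzag) (id2 G r)"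
    by (rule A.T_whisk) simp_all
  have "(?N \<bullet> (((?d \<bullet> ?T) \<lhd> ?q) \<bullet> ?x)) \<bullet> ?h = ?N \<bullet> (((?d \<bullet> ?T) \<lhd> ?q) \<bullet> (?x \<bullet> ?h))"
    by (simp add: e)
  also have "\<dots> = ?N \<bullet> ((?d \<lhd> ?q) \<bullet> (((?T \<bullet> (?h \<lhd> ?e)) \<lhd> ?q) \<bullet> (A.T A.one r \<rhd> ?v)))"
    unfolding 1 by (simp add: e)
  also have "\<dots> = ?i ((r \<rhd> act_ev B.one) \<bullet> ((madj.proj_left d ?z \<bullet> A.T2 (id2 G d) ?h) \<lhd> ?f)) \<bullet>
      ((?T' \<lhd> ?q) \<bullet> (A.T A.one r \<rhd> ?v))"
    unfolding 2 by (simp add: e A.elt.T2_merge)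
  also have "\<dots> = (?i (D.ev r) \<bullet> (?T' \<lhd> ?q)) \<bullet> (A.T A.one r \<rhd> ?v)"
    unfolding 3 by (simp add: e)
  also have "\<dots> = id2 G (A.T A.one r)"
    unfolding 4 5 by (simp add: A.elt.T2_merge)
  finally show ?thesis .
qed

theorem invertible_proj_left: "invertible G (madj.proj_left A.one B.one)"
proof (rule invertibleI, rule inverse_cellsI)
  have e: "((ee \<otimes>\<^sub>1 A.one) \<cdot> (A.one \<otimes>\<^sub>1 nn)) \<otimes>\<^sub>1 B.one = (ee \<otimes>\<^sub>1 id1 G (ob A \<otimes>\<^sub>0 ob B)) \<cdot> (A.one \<otimes>\<^sub>1 (nn \<otimes>\<^sub>1 B.one))"
    by (simp add: tens1_def)
  \<comment> \<open>The innermost factor, the inverse zigzag, leads from \<open>r (w y)\<close> at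
    \<open>y = B.one\<close> to its precomposite with \<open>(ee A)(A nn)\<close> tensored with
    \<open>B\<close>, where the coevaluation reindexed along \<open>nn\<close> starts. Coevaluation,
    projection at \<open>d\<close> and evaluation follow.\<close>
  let ?k = "A.T2 (id2 G A.one) (r \<rhd> act_ev B.one) \<bullet>
     (((A.T2 (id2 G A.one) (madj.proj_left d (B.T w B.one)) \<bullet> D.coev (r \<cdot> B.T w B.one)) \<lhd>
       (A.one \<otimes>\<^sub>1 (nn \<otimes>\<^sub>1 B.one))) \<bullet> (r \<cdot> B.T w B.one \<rhd> (vinv G D.zigzag \<otimes>\<^sub>2 id2 G B.one)))"
  show "?k \<in> Cell G" "src G ?k = trg G (madj.proj_left A.one B.one)" "trg G ?k = src G (madj.proj_left A.one B.one)"
    by (simp_all add: e)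
  show "?k \<bullet> madj.proj_left A.one B.one = id2 G (src G (madj.proj_left A.one B.one))"
    using act_ev_proj_left_zigzag by simp
  show "madj.proj_left A.one B.one \<bullet> ?k = id2 G (trg G (madj.proj_left A.one B.one))"
    using act_coev_proj_left_zigzag by simp
qed simp

end

context strong_map
begin

theorem left_autonomous_invertible_proj_left:
  assumes "left_autonomous G A"
  shows "invertible G (madj.proj_left A.one B.one)"
proof -
  obtain d nn ee nu ep where "left_dual G A d nn ee nu ep"
    by (rule A.left_autonomousE[OF assms])
  then interpret D: left_dual G A d nn ee nu ep .
  interpret E: strong_dual G A B W d nn ee nu ep by unfold_locales
  show ?thesis by (rule E.invertible_proj_left)
qed

end

section \<open>The induced comonad\<close>

context strong_map
begin

abbreviation "\<epsilon> \<equiv> adj_counit W"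
abbreviation "\<eta> \<equiv> adj_unit W"

lemma ips_reindex:
  assumes "f \<in> Arr G" "g \<in> Arr G" "cod G f = ob A" "cod G g = ob A"
    "x \<in> Arr G" "y \<in> Arr G" "cod G x = dom G f" "cod G y = dom G g"
  shows "(vinv G (ps f g) \<lhd> (x \<otimes>\<^sub>1 y)) \<bullet> (w \<rhd> elt_split G A f g x y) =
    elt_split G B (w \<cdot> f) (w \<cdot> g) x y \<bullet> vinv G (ps (f \<cdot> x) (g \<cdot> y))"
proof -
  have "vinv G (ps f g \<lhd> (x \<otimes>\<^sub>1 y)) \<bullet> (w \<rhd> elt_split G A f g x y) =
    elt_split G B (w \<cdot> f) (w \<cdot> g) x y \<bullet> vinv G (ps (f \<cdot> x) (g \<cdot> y))"
    by (rule vinv_square[OF ps_reindex[OF assms]]) (use assms in simp_all)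
  then show ?thesis using assms by simp
qed

text \<open>One computation for all mates of a tensor of two cells after an inverse
  \<open>ps\<close>: \<open>a = b = \<epsilon>\<close> gives \<open>radj_mul\<close>, and
  \<open>\<epsilon>\<close> with an identity gives \<open>proj_right\<close>.\<close>

lemma mate_reindex:
  assumes "f \<in> Arr G" "g \<in> Arr G" "cod G f = ob A" "cod G g = ob A"
    "x \<in> Arr G" "y \<in> Arr G" "cod G x = dom G f" "cod G y = dom G g"
    and a: "a \<in> Cell G" "src G a = w \<cdot> f" "trg G a = f'" and b: "b \<in> Cell G" "src G b = w \<cdot> g" "trg G b = g'"
  shows "(madj.mate (A.T f g) (B.T2 a b \<bullet> vinv G (ps f g)) \<lhd> (x \<otimes>\<^sub>1 y)) \<bullet> elt_split G A f g x y =
    (r \<rhd> elt_split G B f' g' x y) \<bullet>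
      madj.mate (A.T (f \<cdot> x) (g \<cdot> y)) (B.T2 (a \<lhd> x) (b \<lhd> y) \<bullet> vinv G (ps (f \<cdot> x) (g \<cdot> y)))"
    (is "_ = ?rhs")
proof -
  let ?S = "elt_split G A f g x y"
  have ty: "f' \<in> Arr G" "g' \<in> Arr G" "dom G f' = dom G f" "dom G g' = dom G g" "cod G f' = ob B" "cod G g' = ob B"
    using cell_arrs[OF a(1)] cell_arrs[OF b(1)] assms(1-4) a(2,3) b(2,3) by simp_all
  have 1: "(\<eta> \<lhd> A.T f g \<cdot> (x \<otimes>\<^sub>1 y)) \<bullet> ?S = (r \<cdot> w \<rhd> ?S) \<bullet> (\<eta> \<lhd> A.T (f \<cdot> x) (g \<cdot> y))"
  proof -
    have "(\<eta> \<lhd> trg G ?S) \<bullet> ?S = (r \<cdot> w \<rhd> ?S) \<bullet> (\<eta> \<lhd> src G ?S)"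
      by (rule madj.eta_nat) (use assms in simp_all)
    then show ?thesis using assms by simp
  qed
  have 2: "elt_split G B f' g' x y \<bullet> B.T2 (a \<lhd> x) (b \<lhd> y) =
      (B.T2 a b \<lhd> (x \<otimes>\<^sub>1 y)) \<bullet> elt_split G B (w \<cdot> f) (w \<cdot> g) x y"
  proof -
    have "elt_split G B (trg G a) (trg G b) x y \<bullet> B.T2 (a \<lhd> x) (b \<lhd> y) =
      (B.T2 a b \<lhd> (x \<otimes>\<^sub>1 y)) \<bullet> elt_split G B (src G a) (src G b) x y"
      by (rule B.elt_split_nat) (use assms in simp_all)
    then show ?thesis by (simp add: a b)
  qed
  have "(madj.mate (A.T f g) (B.T2 a b \<bullet> vinv G (ps f g)) \<lhd> (x \<otimes>\<^sub>1 y)) \<bullet> ?S =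
    (r \<rhd> B.T2 a b \<lhd> (x \<otimes>\<^sub>1 y)) \<bullet> ((r \<rhd> vinv G (ps f g) \<lhd> (x \<otimes>\<^sub>1 y)) \<bullet> ((\<eta> \<lhd> A.T f g \<cdot> (x \<otimes>\<^sub>1 y)) \<bullet> ?S))"
    using assms ty by (simp add: madj.mate_def)
  also have "\<dots> = (r \<rhd> B.T2 a b \<lhd> (x \<otimes>\<^sub>1 y)) \<bullet> ((r \<rhd> ((vinv G (ps f g) \<lhd> (x \<otimes>\<^sub>1 y)) \<bullet> (w \<rhd> ?S))) \<bullet>
      (\<eta> \<lhd> A.T (f \<cdot> x) (g \<cdot> y)))"
    unfolding 1 using assms ty by simp
  also have "\<dots> = (r \<rhd> (((B.T2 a b \<lhd> (x \<otimes>\<^sub>1 y)) \<bullet> elt_split G B (w \<cdot> f) (w \<cdot> g) x y) \<bullet>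
      vinv G (ps (f \<cdot> x) (g \<cdot> y)))) \<bullet> (\<eta> \<lhd> A.T (f \<cdot> x) (g \<cdot> y))"
    unfolding ips_reindex[OF assms(1-8)] using assms ty by simp
  also have "\<dots> = ?rhs"
    unfolding 2[symmetric] using assms ty by (simp add: madj.mate_def)
  finally show ?thesis .
qed

text \<open>The family is recovered from its value at generic elements. Through this and
  \<open>cmul_one\<close> the elementwise calculus speaks about the single 2-cells of the induced
  comonad.\<close>

lemma radj_mul_one:
  assumes "x \<in> Arr G" "y \<in> Arr G" "cod G x = ob B" "cod G y = ob B"
  shows "(madj.radj_mul B.one B.one \<lhd> (x \<otimes>\<^sub>1 y)) \<bullet> elt_split G A r r x y = madj.radj_mul x y"
proof -
  have "(madj.mate (A.T r r) (B.T2 \<epsilon> \<epsilon> \<bullet> vinv G (ps r r)) \<lhd> (x \<otimes>\<^sub>1 y)) \<bullet> elt_split G A r r x y =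
    (r \<rhd> elt_split G B B.one B.one x y) \<bullet>
      madj.mate (A.T (r \<cdot> x) (r \<cdot> y)) (B.T2 (\<epsilon> \<lhd> x) (\<epsilon> \<lhd> y) \<bullet> vinv G (ps (r \<cdot> x) (r \<cdot> y)))"
    by (rule mate_reindex) (use assms in simp_all)
  then show ?thesis using assms by (simp add: madj.radj_mul_def)
qed

lemma cmul_one:
  assumes "x \<in> Arr G" "y \<in> Arr G" "cod G x = ob B" "cod G y = ob B"
  shows "(madj.cmul B.one B.one \<lhd> (x \<otimes>\<^sub>1 y)) \<bullet> elt_split G B (w \<cdot> r) (w \<cdot> r) x y = madj.cmul x y"
    (is "?lhs = _")
proof -
  have 1: "(ps r r \<lhd> (x \<otimes>\<^sub>1 y)) \<bullet> elt_split G B (w \<cdot> r) (w \<cdot> r) x y =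
      (w \<rhd> elt_split G A r r x y) \<bullet> ps (r \<cdot> x) (r \<cdot> y)"
    by (rule ps_reindex) (use assms in simp_all)
  have "?lhs =
     (w \<rhd> madj.radj_mul B.one B.one \<lhd> (x \<otimes>\<^sub>1 y)) \<bullet> ((ps r r \<lhd> (x \<otimes>\<^sub>1 y)) \<bullet> elt_split G B (w \<cdot> r) (w \<cdot> r) x y)"
    using assms by (simp add: madj.cmul_def)
  also have "\<dots> = (w \<rhd> ((madj.radj_mul B.one B.one \<lhd> (x \<otimes>\<^sub>1 y)) \<bullet> elt_split G A r r x y)) \<bullet> ps (r \<cdot> x) (r \<cdot> y)"
    unfolding 1 using assms by simp
  also have "\<dots> = madj.cmul x y"
    unfolding radj_mul_one[OF assms] using assms by (simp add: madj.cmul_def)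
  finally show ?thesis .
qed

lemma proj_right_right:
  "(madj.proj_right B.one A.one \<lhd> (B.one \<otimes>\<^sub>1 r)) \<bullet> elt_split G A r A.one B.one r = madj.proj_right B.one r"
proof -
  have "(madj.mate (A.T r A.one) (B.T2 \<epsilon> (id2 G w) \<bullet> vinv G (ps r A.one)) \<lhd> (B.one \<otimes>\<^sub>1 r)) \<bullet>
      elt_split G A r A.one B.one r =
    (r \<rhd> elt_split G B B.one w B.one r) \<bullet>
      madj.mate (A.T (r \<cdot> B.one) (A.one \<cdot> r)) (B.T2 (\<epsilon> \<lhd> B.one) (id2 G w \<lhd> r) \<bullet> vinv G (ps (r \<cdot> B.one) (A.one \<cdot> r)))"
    by (rule mate_reindex) simp_all
  then show ?thesis by (simp add: madj.proj_right_def)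
qed

section \<open>The induced comonad and its fusion cells\<close>

abbreviation "c \<equiv> w \<cdot> r"
abbreviation "\<delta> \<equiv> w \<rhd> \<eta> \<lhd> r"
abbreviation "\<phi> \<equiv> madj.cmul B.one B.one"

lemma radj_mult_eq: "radj_mult G A B W = madj.radj_mul B.one B.one"
  by (simp add: radj_mult_def madj.radj_mul_def madj.mate_def Let_def elt_psi_def elt_tens2_def slice_tens0_def)

lemma radj_unit_eq: "radj_unit G A W = madj.radj_uni"
  by (simp add: radj_unit_def madj.radj_uni_def madj.mate_def)

lemma induced_comonad_simps:
  "carr (induced_comonad G A B W) = c" "cdelta (induced_comonad G A B W) = \<delta>"
  "ccounit (induced_comonad G A B W) = \<epsilon>" "cphi (induced_comonad G A B W) = \<phi>"
  "cphi0 (induced_comonad G A B W) = madj.cuni"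
proof -
  have "comp_mult G B w (psi W) r (madj.radj_mul B.one B.one) = \<phi>"
    by (simp add: comp_mult_def madj.cmul_def elt_psi_def slice_tens0_def)
  then show "cphi (induced_comonad G A B W) = \<phi>"
    by (simp add: induced_comonad_def radj_mult_eq)
qed (simp_all add: induced_comonad_def radj_unit_eq comp_unit_def madj.cuni_def)

lemma T_one [simp]: "B.T B.one B.one = mul B"
  by (simp add: slice_tens0_def)

text \<open>The definitions of a lax monoidal 1-cell, of \<open>comp_mult\<close> and of the fusion
  cells all contain this restriction of the structure cell followed by a comparison; it is the
  elementwise structure at other 1-cells.\<close>

lemma cmul_one_split:
  assumes "x \<in> Arr G" "y \<in> Arr G" "cod G x = ob B" "cod G y = ob B"
  shows "(\<phi> \<lhd> (x \<otimes>\<^sub>1 y)) \<bullet> (mul B \<rhd> vinv G (tcomp G c c x y)) = madj.cmul x y"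
  using cmul_one[OF assms] assms by (simp add: elt_split_def)

text \<open>The elementwise laws of \<open>cmul\<close> at \<open>B.one\<close>. The comparison cell
  that they contain on the right belongs, inverted, on the left of the axiom; composing with the
  inverse \<open>?K'\<close>, or \<open>?k'\<close> for the left unit law, moves it there.\<close>

lemma lax_monoidal_c: "lax_monoidal G B B c \<phi> madj.cuni"
proof -
  let ?m = "mul B" and ?u = "uni B"
  have t: "?m \<otimes>\<^sub>R ob B = ?m \<otimes>\<^sub>1 B.one" "ob B \<otimes>\<^sub>L ?m = B.one \<otimes>\<^sub>1 ?m"
    "?u \<otimes>\<^sub>R ob B = ?u \<otimes>\<^sub>1 B.one" "ob B \<otimes>\<^sub>L ?u = B.one \<otimes>\<^sub>1 ?u"
    by (simp_all only: act1_tens1 B.pmon_simps)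
  let ?K = "?m \<rhd> tsplit G ?m B.one (c \<otimes>\<^sub>1 c) c" and ?K' = "?m \<rhd> tcomp G ?m B.one (c \<otimes>\<^sub>1 c) c"
  have tT: "?m \<cdot> (x \<otimes>\<^sub>1 y) = B.T x y" "?m \<rhd> (a \<otimes>\<^sub>2 b) = B.T2 a b" for x y a b
    by (simp_all add: slice_tens0_def elt_tens2_def)
  have a1: "elt_assoc G B B.one B.one B.one = pa B"
    by (simp add: elt_assoc_def)
  have a2: "elt_assoc G B c c c = (pa B \<lhd> (c \<otimes>\<^sub>1 c \<otimes>\<^sub>1 c)) \<bullet> ?K"
    by (simp add: elt_assoc_def)
  have l1: "elt_lunit G B B.one = pl B" "elt_runit G B B.one = pr B"
    by (simp_all add: elt_lunit_def elt_runit_def)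
  have A: "(c \<rhd> pa B) \<bullet> (madj.cmul ?m B.one \<bullet> B.T2 \<phi> (id2 G c)) =
      madj.cmul B.one ?m \<bullet> (B.T2 (id2 G c) \<phi> \<bullet> ((pa B \<lhd> (c \<otimes>\<^sub>1 c \<otimes>\<^sub>1 c)) \<bullet> ?K))"
    using madj.cmul_assoc[of B.one B.one B.one] by (simp add: a1 a2)
  have p: "madj.cmul ?m B.one = (\<phi> \<lhd> (?m \<otimes>\<^sub>1 B.one)) \<bullet> (?m \<rhd> vinv G (tcomp G c c ?m B.one))"
    "madj.cmul B.one ?m = (\<phi> \<lhd> (B.one \<otimes>\<^sub>1 ?m)) \<bullet> (?m \<rhd> vinv G (tcomp G c c B.one ?m))"
    "madj.cmul ?u B.one = (\<phi> \<lhd> (?u \<otimes>\<^sub>1 B.one)) \<bullet> (?m \<rhd> vinv G (tcomp G c c ?u B.one))"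
    "madj.cmul B.one ?u = (\<phi> \<lhd> (B.one \<otimes>\<^sub>1 ?u)) \<bullet> (?m \<rhd> vinv G (tcomp G c c B.one ?u))"
    by (rule cmul_one_split[symmetric]; simp)+
  have KK: "?K \<bullet> ?K' = id2 G (?m \<cdot> (?m \<otimes>\<^sub>1 B.one) \<cdot> (c \<otimes>\<^sub>1 (c \<otimes>\<^sub>1 c)))"
    by (simp flip: whisk_vcomp)
  have 1: "(c \<rhd> pa B) \<bullet> madj.cmul ?m B.one \<bullet> (?m \<rhd> (\<phi> \<otimes>\<^sub>2 id2 G c)) \<bullet> ?K' =
      madj.cmul B.one ?m \<bullet> (?m \<rhd> (id2 G c \<otimes>\<^sub>2 \<phi>)) \<bullet> (?m \<rhd> tcomp G B.one ?m c (c \<otimes>\<^sub>1 c)) \<bullet>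
        (pa B \<lhd> (c \<otimes>\<^sub>1 c \<otimes>\<^sub>1 c))"
  proof -
    have "((c \<rhd> pa B) \<bullet> (madj.cmul ?m B.one \<bullet> B.T2 \<phi> (id2 G c))) \<bullet> ?K' =
        (madj.cmul B.one ?m \<bullet> (B.T2 (id2 G c) \<phi> \<bullet> (pa B \<lhd> (c \<otimes>\<^sub>1 c \<otimes>\<^sub>1 c)))) \<bullet> (?K \<bullet> ?K')"
      unfolding A by (simp add: slice_tens0_def)
    then show ?thesis unfolding KK by (simp add: elt_tens2_def slice_tens0_def)
  qed
  have 2: "(c \<rhd> pl B) \<bullet> madj.cmul ?u B.one \<bullet> (?m \<rhd> (madj.cuni \<otimes>\<^sub>2 id2 G c)) \<bullet>
      (?m \<rhd> tcomp G ?u B.one (id1 G (unit_obj G)) c) = pl B \<lhd> c"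
  proof -
    let ?k = "?m \<rhd> tsplit G ?u B.one (id1 G (unit_obj G)) c" and ?k' = "?m \<rhd> tcomp G ?u B.one (id1 G (unit_obj G)) c"
    have F: "(c \<rhd> pl B) \<bullet> (madj.cmul ?u B.one \<bullet> B.T2 madj.cuni (id2 G c)) = (pl B \<lhd> c) \<bullet> ?k"
      using madj.cmul_la[of B.one] by (simp add: l1) (simp add: elt_lunit_def)
    have kk: "?k \<bullet> ?k' = id2 G (?m \<cdot> (?u \<otimes>\<^sub>1 B.one) \<cdot> c)"
      by (simp flip: whisk_vcomp)
    have "((c \<rhd> pl B) \<bullet> (madj.cmul ?u B.one \<bullet> B.T2 madj.cuni (id2 G c))) \<bullet> ?k' = (pl B \<lhd> c) \<bullet> (?k \<bullet> ?k')"
      unfolding F by simp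
    then show ?thesis unfolding kk by (simp add: elt_tens2_def slice_tens0_def)
  qed
  have 3: "(c \<rhd> pr B) \<bullet> madj.cmul B.one ?u \<bullet> (?m \<rhd> (id2 G c \<otimes>\<^sub>2 madj.cuni)) \<bullet>
      (?m \<rhd> tcomp G B.one ?u c (id1 G (unit_obj G))) = pr B \<lhd> c"
    using madj.cmul_ro[of B.one] by (simp add: l1 elt_runit_def elt_tens2_def slice_tens0_def)
  show ?thesis
    unfolding lax_monoidal_def Let_def t
    using 1[unfolded p] 2[unfolded p] 3[unfolded p] by (simp add: mem_hom1 mem_hom2 slice_tens0_def)
qed

lemma comonad_c: "comonad G (ob B) c \<delta> \<epsilon>"
proof -
  have 1: "(\<eta> \<lhd> r \<cdot> w \<cdot> r) \<bullet> (\<eta> \<lhd> r) = (r \<cdot> w \<rhd> \<eta> \<lhd> r) \<bullet> (\<eta> \<lhd> r)"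
  proof -
    have "(\<eta> \<lhd> trg G (\<eta> \<lhd> r)) \<bullet> (\<eta> \<lhd> r) = (r \<cdot> w \<rhd> (\<eta> \<lhd> r)) \<bullet> (\<eta> \<lhd> src G (\<eta> \<lhd> r))"
      by (rule madj.eta_nat) simp_all
    then show ?thesis by simp
  qed
  have 2: "w \<rhd> ((r \<rhd> \<epsilon>) \<bullet> (\<eta> \<lhd> r)) = id2 G c" "((\<epsilon> \<lhd> w) \<bullet> (w \<rhd> \<eta>)) \<lhd> r = id2 G c"
    using adjunction by (simp_all add: adjunction_def)
  have "w \<rhd> ((\<eta> \<lhd> r \<cdot> w \<cdot> r) \<bullet> (\<eta> \<lhd> r)) = w \<rhd> ((r \<cdot> w \<rhd> \<eta> \<lhd> r) \<bullet> (\<eta> \<lhd> r))"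
    unfolding 1 ..
  then show ?thesis using 2 by (simp add: comonad_def mem_hom1 mem_hom2)
qed

lemma monoidal_comonad_c: "monoidal_comonad G B (induced_comonad G A B W)"
proof -
  have 1: "comp_mult G B c \<phi> c \<phi> = (c \<rhd> \<phi>) \<bullet> madj.cmul c c"
  proof -
    have "(\<phi> \<lhd> (c \<otimes>\<^sub>1 c)) \<bullet> (mul B \<rhd> vinv G (tcomp G c c c c)) = madj.cmul c c"
      by (rule cmul_one_split) simp_all
    then show ?thesis by (simp add: comp_mult_def slice_tens0_def)
  qed
  have "monoidal_cell G B B c \<phi> madj.cuni (c \<cdot> c) (comp_mult G B c \<phi> c \<phi>) (comp_unit G c madj.cuni madj.cuni) \<delta>"
    using madj.delta_monoidal[of B.one B.one] madj.delta_monoidal_unit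
    by (simp add: monoidal_cell_def mem_hom2 1 comp_unit_def elt_tens2_def slice_tens0_def)
  moreover have "monoidal_cell G B B c \<phi> madj.cuni B.one (id2 G (mul B)) (id2 G (uni B)) \<epsilon>"
    using madj.eps_monoidal[of B.one B.one] madj.eps_monoidal_unit
    by (simp add: monoidal_cell_def mem_hom2 elt_tens2_def)
  ultimately show ?thesis
    by (simp add: monoidal_comonad_def induced_comonad_simps Let_def comonad_c lax_monoidal_c)
qed

text \<open>Reindexing the first factor along \<open>r\<close> is strict, so the generic projection
  cell restricts to the one at \<open>r\<close> without any comparison cell.\<close>

lemma fusion_2_eq:
  "fusion_2 G B (induced_comonad G A B W) = (w \<rhd> madj.proj_left A.one B.one \<lhd> (r \<otimes>\<^sub>1 B.one)) \<bullet> ps r r"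
proof -
  have 1: "(\<phi> \<lhd> (c \<otimes>\<^sub>1 B.one)) \<bullet> (mul B \<rhd> vinv G (tcomp G c c c B.one)) = madj.cmul c B.one"
    by (rule cmul_one_split) simp_all
  have 2: "madj.proj_left A.one B.one \<lhd> (r \<otimes>\<^sub>1 B.one) = madj.proj_left (A.one \<cdot> r) B.one"
    by (rule proj_left_left) simp_all
  have "madj.cmul c B.one \<bullet> B.T2 \<delta> (id2 G c) = (w \<rhd> madj.proj_left r B.one) \<bullet> ps r r"
    using madj.fusion_proj_left[of B.one B.one] by simp
  then show ?thesis
    unfolding fusion_2_def Let_def induced_comonad_simps 1 by (simp add: 2 elt_tens2_def)
qed

text \<open>Here \<open>r\<close> reindexes the second factor, which costs an invertible
  \<open>elt_split\<close>; invertibility still passes from the generic projection cell.\<close>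

lemma fusion_1_eq: "fusion_1 G B (induced_comonad G A B W) =
    (w \<rhd> ((madj.proj_right B.one A.one \<lhd> (B.one \<otimes>\<^sub>1 r)) \<bullet> elt_split G A r A.one B.one r)) \<bullet> ps r r"
proof -
  have 1: "(\<phi> \<lhd> (B.one \<otimes>\<^sub>1 c)) \<bullet> (mul B \<rhd> vinv G (tcomp G c c B.one c)) = madj.cmul B.one c"
    by (rule cmul_one_split) simp_all
  have "madj.cmul B.one c \<bullet> B.T2 (id2 G c) \<delta> = (w \<rhd> madj.proj_right B.one r) \<bullet> ps r r"
    using madj.fusion_proj_right[of B.one B.one] by simp
  then show ?thesis
    unfolding proj_right_right fusion_1_def Let_def induced_comonad_simps 1 by (simp add: elt_tens2_def)
qed

theorem invertible_fusion_2:
  assumes "invertible G (madj.proj_left A.one B.one)"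
  shows "invertible G (fusion_2 G B (induced_comonad G A B W))"
  unfolding fusion_2_eq by (simp add: assms)

theorem invertible_fusion_1:
  assumes "invertible G (madj.proj_right B.one A.one)"
  shows "invertible G (fusion_1 G B (induced_comonad G A B W))"
proof -
  have "invertible G ((madj.proj_right B.one A.one \<lhd> (B.one \<otimes>\<^sub>1 r)) \<bullet> elt_split G A r A.one B.one r)"
    by (intro invertible_vcomp invertible_whisk assms) simp_all
  then show ?thesis unfolding fusion_1_eq proj_right_right by (intro invertible_vcomp invertible_whisk) simp_all
qed

end

section \<open>Reversing the tensor product\<close>

lemma reverse_simps [simp]:
  "Obj (reverse G) = Obj G" "Arr (reverse G) = Arr G" "Cell (reverse G) = Cell G"
  "dom (reverse G) = dom G" "cod (reverse G) = cod G" "src (reverse G) = src G" "trg (reverse G) = trg G"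
  "id1 (reverse G) = id1 G" "id2 (reverse G) = id2 G" "comp1 (reverse G) = comp1 G"
  "vcomp (reverse G) = vcomp G" "hcomp (reverse G) = hcomp G" "unit_obj (reverse G) = unit_obj G"
  "tens0 (reverse G) X Y = tens0 G Y X" "lact1 (reverse G) X f = ract1 G f X" "ract1 (reverse G) f X = lact1 G X f"
  "lact2 (reverse G) X a = ract2 G a X" "ract2 (reverse G) a X = lact2 G X a"
  "gi (reverse G) f g = vinv G (gi G g f)"
  by (simp_all add: reverse_def)

lemma reverse_derived_simps [simp]:
  "hom1 (reverse G) = hom1 G" "hom2 (reverse G) = hom2 G" "lwhisk (reverse G) = lwhisk G"
  "rwhisk (reverse G) = rwhisk G" "inverse_cells (reverse G) = inverse_cells G"
  "invertible (reverse G) = invertible G" "vinv (reverse G) = vinv G" "iso2 (reverse G) = iso2 G"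
  "adjunction (reverse G) = adjunction G"
proof -
  show a: "hom1 (reverse G) = hom1 G" "hom2 (reverse G) = hom2 G" "lwhisk (reverse G) = lwhisk G"
    "rwhisk (reverse G) = rwhisk G"
    by (simp_all add: fun_eq_iff hom1_def hom2_def lwhisk_def rwhisk_def)
  show b: "inverse_cells (reverse G) = inverse_cells G"
    by (simp add: fun_eq_iff inverse_cells_def a)
  show c: "invertible (reverse G) = invertible G" "vinv (reverse G) = vinv G"
    by (simp_all add: fun_eq_iff invertible_def vinv_def b)
  show "iso2 (reverse G) = iso2 G" "adjunction (reverse G) = adjunction G"
    by (simp_all add: fun_eq_iff iso2_def adjunction_def a c)
qed

lemma reverse_pmon_simps [simp]:
  "ob (reverse_pmon G P) = ob P" "mul (reverse_pmon G P) = mul P" "uni (reverse_pmon G P) = uni P"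
  "pa (reverse_pmon G P) = vinv G (pa P)" "pl (reverse_pmon G P) = pr P" "pr (reverse_pmon G P) = pl P"
  by (simp_all add: reverse_pmon_def)

context gray_monoid
begin

lemma two_category_reverse: "two_category (reverse G)"
  using two_category_axioms unfolding two_category_def reverse_simps reverse_derived_simps .

text \<open>Reversal replaces the interchange cells by inverses, so their naturality square has to
  be read backwards. The other axioms are mirror images of those of \<open>G\<close>.\<close>

lemma gray_monoid_reverse: "gray_monoid (reverse G)"
proof (intro gray_monoid.intro two_category_reverse gray_monoid_axioms.intro)
  show "gi (reverse G) f' g' \<bullet>\<^bsub>reverse G\<^esub> ((lact2 (reverse G) A' b) \<star>\<^bsub>reverse G\<^esub> (ract2 (reverse G) a B)) =
    ((ract2 (reverse G) a B') \<star>\<^bsub>reverse G\<^esub> (lact2 (reverse G) A b)) \<bullet>\<^bsub>reverse G\<^esub> gi (reverse G) f g"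
    if "f \<in> hom1 (reverse G) A A'" "g \<in> hom1 (reverse G) B B'" "a \<in> hom2 (reverse G) f f'"
      "b \<in> hom2 (reverse G) g g'" for f A A' g B B' a f' b g'
  proof -
    have t: "a \<in> Cell G" "b \<in> Cell G" "f = src G a" "f' = trg G a" "g = src G b" "g' = trg G b"
      "A = dom G f" "A' = cod G f" "B = dom G g" "B' = cod G g"
      using that by (auto simp: mem_hom1 mem_hom2)
    have "vinv G (gi G (trg G b) (trg G a)) \<bullet> ((b \<otimes>\<^sub>R\<^sub>2 cod G (src G a)) \<star> (dom G (src G b) \<otimes>\<^sub>L\<^sub>2 a)) =
        ((cod G (src G b) \<otimes>\<^sub>L\<^sub>2 a) \<star> (b \<otimes>\<^sub>R\<^sub>2 dom G (src G a))) \<bullet> vinv G (gi G (src G b) (src G a))"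
      by (rule vinv_square[OF gi_nat]) (use t in simp_all)
    then show ?thesis by (simp add: t)
  qed
qed (auto simp: mem_hom1 mem_hom2 iso2_def)

end

context pseudomonoid_in
begin

lemma pseudomonoid_reverse: "pseudomonoid (reverse G) (reverse_pmon G P)"
proof -
  have 1: "(pa P \<lhd> ((B \<otimes>\<^sub>0 B) \<otimes>\<^sub>L m)) \<bullet> (m \<rhd> gi G m m) \<bullet> (pa P \<lhd> (m \<otimes>\<^sub>R (B \<otimes>\<^sub>0 B))) =
      (m \<rhd> (B \<otimes>\<^sub>L\<^sub>2 pa P)) \<bullet> (pa P \<lhd> (B \<otimes>\<^sub>L (m \<otimes>\<^sub>R B))) \<bullet> (m \<rhd> (pa P \<otimes>\<^sub>R\<^sub>2 B))" (is "?a = ?b")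
    and 2: "(m \<rhd> (B \<otimes>\<^sub>L\<^sub>2 pl P)) \<bullet> (pa P \<lhd> (B \<otimes>\<^sub>L (u \<otimes>\<^sub>R B))) = m \<rhd> (pr P \<otimes>\<^sub>R\<^sub>2 B)"
    and t: "pa P \<in> iso2 G (m \<cdot> (m \<otimes>\<^sub>R B)) (m \<cdot> (B \<otimes>\<^sub>L m))" "pl P \<in> iso2 G (m \<cdot> (u \<otimes>\<^sub>R B)) one"
      "pr P \<in> iso2 G (m \<cdot> (B \<otimes>\<^sub>L u)) one"
    using pseudomonoid by (simp_all add: pseudomonoid_def Let_def)
  \<comment> \<open>The tensor of 1-cells composes its factors in the other order after reversal, so
    the calculation stays with the actions of objects; the rules that express these sources through
    \<open>tens1\<close> are switched off. The pentagon is then mirrored by inverting both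
    sides.\<close>
  have s [simp]: "src G (pa P) = m \<cdot> (m \<otimes>\<^sub>R B)" "trg G (pa P) = m \<cdot> (B \<otimes>\<^sub>L m)"
    "src G (pl P) = m \<cdot> (u \<otimes>\<^sub>R B)" "src G (pr P) = m \<cdot> (B \<otimes>\<^sub>L u)"
    using t by (auto simp: iso2_def mem_hom2)
  have "vinv G ?a = vinv G ?b" unfolding 1 ..
  then have 3: "(vinv G (pa P) \<lhd> (m \<otimes>\<^sub>R (B \<otimes>\<^sub>0 B))) \<bullet> (m \<rhd> vinv G (gi G m m)) \<bullet> (vinv G (pa P) \<lhd> ((B \<otimes>\<^sub>0 B) \<otimes>\<^sub>L m)) =
     (m \<rhd> (vinv G (pa P) \<otimes>\<^sub>R\<^sub>2 B)) \<bullet> (vinv G (pa P) \<lhd> ((B \<otimes>\<^sub>L m) \<otimes>\<^sub>R B)) \<bullet> (m \<rhd> (B \<otimes>\<^sub>L\<^sub>2 vinv G (pa P)))"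
    by (simp del: pmon_simps(9,10))
  have 4: "(m \<rhd> (pr P \<otimes>\<^sub>R\<^sub>2 B)) \<bullet> (vinv G (pa P) \<lhd> ((B \<otimes>\<^sub>L u) \<otimes>\<^sub>R B)) = m \<rhd> (B \<otimes>\<^sub>L\<^sub>2 pl P)"
  proof -
    let ?Y = "(B \<otimes>\<^sub>L u) \<otimes>\<^sub>R B"
    have "(pa P \<lhd> ?Y) \<bullet> (vinv G (pa P) \<lhd> ?Y) = id2 G (trg G (pa P) \<cdot> ?Y)"
      by (simp flip: whisk_vcomp)
    moreover have "((m \<rhd> (B \<otimes>\<^sub>L\<^sub>2 pl P)) \<bullet> (pa P \<lhd> (B \<otimes>\<^sub>L (u \<otimes>\<^sub>R B)))) \<bullet> (vinv G (pa P) \<lhd> ?Y) =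
        (m \<rhd> (pr P \<otimes>\<^sub>R\<^sub>2 B)) \<bullet> (vinv G (pa P) \<lhd> ?Y)"
      unfolding 2 ..
    ultimately show ?thesis by (simp del: pmon_simps(9,10,13,17))
  qed
  show ?thesis
    unfolding pseudomonoid_def Let_def
    using 3 4 by (simp add: iso2_def mem_hom1 mem_hom2 del: pmon_simps(9,10,13,17))
qed

end

section \<open>The strong monoidal map of the reversed Gray monoid\<close>

context strong_map
begin

text \<open>The reversed tensor of \<open>w\<close> with itself is the target, not the source, of
  the interchange cell \<open>gi w w\<close>; its inverse gives \<open>psi\<close> the source
  required after reversal.\<close>

definition rev_map :: "('m, 'c) monoidal_map"
  where "rev_map = W\<lparr>psi := psi W \<bullet> (mul B \<rhd> vinv G (gi G w w))\<rparr>"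

abbreviation "AA \<equiv> ob A"
abbreviation "BB \<equiv> ob B"
abbreviation "m \<equiv> mul B"
abbreviation "p \<equiv> mul A"
abbreviation "j \<equiv> uni A"
abbreviation "u \<equiv> uni B"
abbreviation "\<psi> \<equiv> psi W"
abbreviation "\<psi>\<^sub>0 \<equiv> psi0 W"
abbreviation "g \<equiv> gi G w w"
abbreviation "\<psi>' \<equiv> \<psi> \<bullet> (m \<rhd> vinv G g)"

text \<open>The half twist \<open>?s\<close> relates the two orders of composing \<open>w \<otimes> w \<otimes> w\<close>; it is the same computed
  from either end, and both sides of the axiom in the reversed Gray monoid are those of the
  original axiom up to \<open>?s\<close>.\<close>

lemma rev_assoc:
  "(w \<rhd> vinv G (pa A)) \<bullet> ((\<psi>' \<lhd> (AA \<otimes>\<^sub>L p)) \<bullet> ((m \<cdot> (w \<otimes>\<^sub>R BB) \<rhd> (AA \<otimes>\<^sub>L\<^sub>2 \<psi>')) \<bullet>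
     (m \<rhd> gi G w m \<lhd> (AA \<otimes>\<^sub>L ((w \<otimes>\<^sub>R BB) \<cdot> (AA \<otimes>\<^sub>L w)))))) =
   (\<psi>' \<lhd> (p \<otimes>\<^sub>R AA)) \<bullet> ((m \<cdot> (w \<otimes>\<^sub>R BB) \<rhd> vinv G (gi G p w)) \<bullet>
     ((m \<rhd> (\<psi>' \<otimes>\<^sub>R\<^sub>2 BB) \<lhd> ((AA \<otimes>\<^sub>0 AA) \<otimes>\<^sub>L w)) \<bullet>
      (vinv G (pa B) \<lhd> (((w \<otimes>\<^sub>R BB) \<cdot> (AA \<otimes>\<^sub>L w)) \<otimes>\<^sub>R BB) \<cdot> ((AA \<otimes>\<^sub>0 AA) \<otimes>\<^sub>L w))))" (is "?L = ?R")
proof -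
  let ?f = "w \<otimes>\<^sub>1 w" and ?f' = "(w \<otimes>\<^sub>R BB) \<cdot> (AA \<otimes>\<^sub>L w)" and ?w3 = "(w \<otimes>\<^sub>R AA) \<otimes>\<^sub>R AA"
  let ?fff = "(BB \<otimes>\<^sub>L (BB \<otimes>\<^sub>L w)) \<cdot> (?f \<otimes>\<^sub>R AA)" and ?AAw = "AA \<otimes>\<^sub>L (AA \<otimes>\<^sub>L w)"
  let ?s = "((g \<otimes>\<^sub>R\<^sub>2 BB) \<lhd> ?AAw) \<bullet> gi G ?f w"
  let ?Bw = "BB \<otimes>\<^sub>L w" and ?wB = "w \<otimes>\<^sub>R BB"
  have s: "?s = (((w \<otimes>\<^sub>R BB) \<otimes>\<^sub>R BB) \<rhd> (AA \<otimes>\<^sub>L\<^sub>2 g)) \<bullet> gi G w ?f"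
    using gi_nat[of "id2 G w" g] by (simp add: tens1_def flip: lwhisk_def rwhisk_def)
  \<comment> \<open>\<open>E1\<close> and \<open>E2\<close> are naturality of the interchange cells
    against \<open>\<psi>\<close> in the first and in the second argument, read backwards.\<close>
  have E1: "vinv G (gi G (w \<cdot> p) w) \<bullet> ((\<psi> \<otimes>\<^sub>R\<^sub>2 BB) \<lhd> ?AAw) = (?Bw \<rhd> (\<psi> \<otimes>\<^sub>R\<^sub>2 AA)) \<bullet> vinv G (gi G (m \<cdot> ?f) w)"
  proof (rule vinv_square)
    show "gi G (w \<cdot> p) w \<bullet> (?Bw \<rhd> (\<psi> \<otimes>\<^sub>R\<^sub>2 AA)) = ((\<psi> \<otimes>\<^sub>R\<^sub>2 BB) \<lhd> ?AAw) \<bullet> gi G (m \<cdot> ?f) w"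
      using gi_nat[of \<psi> "id2 G w"] by (simp add: tens1_def flip: lwhisk_def rwhisk_def)
  qed (simp_all add: tens1_def)
  have E2: "vinv G (g \<lhd> (AA \<otimes>\<^sub>L p)) \<bullet> (?wB \<rhd> (AA \<otimes>\<^sub>L\<^sub>2 \<psi>)) =
     ((?Bw \<rhd> gi G w p) \<bullet> ((BB \<otimes>\<^sub>L\<^sub>2 \<psi>) \<lhd> ?w3)) \<bullet> vinv G (gi G w (m \<cdot> ?f))"
  proof (rule vinv_square)
    show "(g \<lhd> (AA \<otimes>\<^sub>L p)) \<bullet> ((?Bw \<rhd> gi G w p) \<bullet> ((BB \<otimes>\<^sub>L\<^sub>2 \<psi>) \<lhd> ?w3)) = (?wB \<rhd> (AA \<otimes>\<^sub>L\<^sub>2 \<psi>)) \<bullet> gi G w (m \<cdot> ?f)"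
      using gi_nat[of "id2 G w" \<psi>] by (simp add: tens1_def flip: lwhisk_def rwhisk_def)
  qed (simp_all add: tens1_def)
  \<comment> \<open>The original axiom with \<open>pa A\<close> and the comparison cell on the right
    carried to the other sides as inverses.\<close>
  have O: "(w \<rhd> vinv G (pa A)) \<bullet> ((\<psi> \<lhd> (AA \<otimes>\<^sub>L p)) \<bullet> ((m \<cdot> ?Bw \<rhd> gi G w p) \<bullet> (m \<rhd> (BB \<otimes>\<^sub>L\<^sub>2 \<psi>) \<lhd> ?w3))) =
      ((\<psi> \<lhd> (p \<otimes>\<^sub>R AA)) \<bullet> (m \<cdot> ?Bw \<rhd> (\<psi> \<otimes>\<^sub>R\<^sub>2 AA))) \<bullet>
        vinv G ((pa B \<lhd> ?fff) \<bullet> (m \<rhd> gi G m w \<lhd> (?f \<otimes>\<^sub>R AA)))"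
  proof -
    have "(w \<rhd> pa A) \<bullet> ((\<psi> \<lhd> (p \<otimes>\<^sub>R AA)) \<bullet> (m \<cdot> ?Bw \<rhd> (\<psi> \<otimes>\<^sub>R\<^sub>2 AA))) =
       ((\<psi> \<lhd> (AA \<otimes>\<^sub>L p)) \<bullet> ((m \<cdot> ?Bw \<rhd> gi G w p) \<bullet> (m \<rhd> (BB \<otimes>\<^sub>L\<^sub>2 \<psi>) \<lhd> ?w3))) \<bullet>
        ((pa B \<lhd> ?fff) \<bullet> (m \<rhd> gi G m w \<lhd> (?f \<otimes>\<^sub>R AA)))"
      using psi_assoc by (simp add: tsplit_def tens1_def tens2_def flip: lwhisk_def rwhisk_def)
    then have "vinv G (w \<rhd> pa A) \<bullet> ((\<psi> \<lhd> (AA \<otimes>\<^sub>L p)) \<bullet> ((m \<cdot> ?Bw \<rhd> gi G w p) \<bullet> (m \<rhd> (BB \<otimes>\<^sub>L\<^sub>2 \<psi>) \<lhd> ?w3))) =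
      ((\<psi> \<lhd> (p \<otimes>\<^sub>R AA)) \<bullet> (m \<cdot> ?Bw \<rhd> (\<psi> \<otimes>\<^sub>R\<^sub>2 AA))) \<bullet>
        vinv G ((pa B \<lhd> ?fff) \<bullet> (m \<rhd> gi G m w \<lhd> (?f \<otimes>\<^sub>R AA)))"
      by (rule vinv_square) (simp_all add: tens1_def)
    then show ?thesis by (simp add: tens1_def)
  qed
  \<comment> \<open>\<open>i1\<close> takes the inverse interchange cell past \<open>gi w m\<close>,
    so that it can be assembled into the inverse of \<open>?s\<close>; \<open>i2\<close> takes the
    whole inverse twist past the inverse of \<open>pa B\<close>.\<close>
  have i1: "((w \<otimes>\<^sub>R BB) \<cdot> (AA \<otimes>\<^sub>L m) \<rhd> (AA \<otimes>\<^sub>L\<^sub>2 vinv G g)) \<bullet> (gi G w m \<lhd> (AA \<otimes>\<^sub>L ?f')) =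
      (gi G w m \<lhd> (AA \<otimes>\<^sub>L ?f)) \<bullet> ((BB \<otimes>\<^sub>L m) \<cdot> ((w \<otimes>\<^sub>R BB) \<otimes>\<^sub>R BB) \<rhd> (AA \<otimes>\<^sub>L\<^sub>2 vinv G g))"
    using whisk_interchange[of "AA \<otimes>\<^sub>L\<^sub>2 vinv G g" "gi G w m"] by (simp add: tens1_def)
  have i2: "(m \<cdot> (m \<otimes>\<^sub>R BB) \<rhd> vinv G ?s) \<bullet> (vinv G (pa B) \<lhd> (?f' \<otimes>\<^sub>R BB) \<cdot> ?AAw) =
      (vinv G (pa B) \<lhd> ?fff) \<bullet> (m \<cdot> (BB \<otimes>\<^sub>L m) \<rhd> vinv G ?s)"
    using whisk_interchange[of "vinv G ?s" "vinv G (pa B)"] by (simp add: tens1_def)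
  have "?L = (w \<rhd> vinv G (pa A)) \<bullet> ((\<psi> \<lhd> (AA \<otimes>\<^sub>L p)) \<bullet>
      (m \<rhd> ((vinv G (g \<lhd> (AA \<otimes>\<^sub>L p)) \<bullet> (?wB \<rhd> (AA \<otimes>\<^sub>L\<^sub>2 \<psi>))) \<bullet>
        (((w \<otimes>\<^sub>R BB) \<cdot> (AA \<otimes>\<^sub>L m) \<rhd> (AA \<otimes>\<^sub>L\<^sub>2 vinv G g)) \<bullet> (gi G w m \<lhd> (AA \<otimes>\<^sub>L ?f'))))))"
    by (simp add: tens1_def)
  also have "\<dots> = (w \<rhd> vinv G (pa A)) \<bullet> ((\<psi> \<lhd> (AA \<otimes>\<^sub>L p)) \<bullet>
      (m \<rhd> (((?Bw \<rhd> gi G w p) \<bullet> ((BB \<otimes>\<^sub>L\<^sub>2 \<psi>) \<lhd> ?w3)) \<bullet>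
        (((BB \<otimes>\<^sub>L m) \<rhd> vinv G (gi G w ?f)) \<bullet> (vinv G (gi G w m \<lhd> (AA \<otimes>\<^sub>L ?f)) \<bullet>
        ((gi G w m \<lhd> (AA \<otimes>\<^sub>L ?f)) \<bullet> ((BB \<otimes>\<^sub>L m) \<cdot> ((w \<otimes>\<^sub>R BB) \<otimes>\<^sub>R BB) \<rhd> (AA \<otimes>\<^sub>L\<^sub>2 vinv G g))))))))"
    unfolding E2 i1 by (simp add: tens1_def)
  also have "\<dots> = ((w \<rhd> vinv G (pa A)) \<bullet> ((\<psi> \<lhd> (AA \<otimes>\<^sub>L p)) \<bullet> ((m \<cdot> ?Bw \<rhd> gi G w p) \<bullet> (m \<rhd> (BB \<otimes>\<^sub>L\<^sub>2 \<psi>) \<lhd> ?w3)))) \<bullet>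
      (m \<cdot> (BB \<otimes>\<^sub>L m) \<rhd> vinv G ?s)"
    unfolding s by (subst vinv_cancel(1)) (simp_all add: tens1_def)
  also have "\<dots> = (\<psi> \<lhd> (p \<otimes>\<^sub>R AA)) \<bullet> ((m \<cdot> ?Bw \<rhd> (\<psi> \<otimes>\<^sub>R\<^sub>2 AA)) \<bullet> ((m \<rhd> vinv G (gi G m w) \<lhd> (?f \<otimes>\<^sub>R AA)) \<bullet>
      ((m \<cdot> (m \<otimes>\<^sub>R BB) \<rhd> vinv G ?s) \<bullet> (vinv G (pa B) \<lhd> (?f' \<otimes>\<^sub>R BB) \<cdot> ?AAw))))"
    unfolding O i2 by (simp add: tens1_def)
  also have "\<dots> = (\<psi> \<lhd> (p \<otimes>\<^sub>R AA)) \<bullet> ((m \<rhd> ((vinv G (gi G (w \<cdot> p) w) \<bullet> ((\<psi> \<otimes>\<^sub>R\<^sub>2 BB) \<lhd> ?AAw)) \<bullet>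
      ((m \<otimes>\<^sub>R BB) \<rhd> (vinv G g \<otimes>\<^sub>R\<^sub>2 BB) \<lhd> ?AAw))) \<bullet> (vinv G (pa B) \<lhd> (?f' \<otimes>\<^sub>R BB) \<cdot> ?AAw))"
    unfolding E1 by (simp add: tens1_def)
  also have "\<dots> = ?R"
    by (simp add: tens1_def)
  finally show ?thesis .
qed

end

context strong_map
begin

text \<open>The mirror image of the right unit law of \<open>W\<close>: naturality against
  \<open>\<psi>\<^sub>0\<close> makes the interchange cells from \<open>\<psi>'\<close> and from the
  comparison cancel.\<close>

lemma rev_lunit:
  "(w \<rhd> pr A) \<bullet> ((\<psi>' \<lhd> (AA \<otimes>\<^sub>L j)) \<bullet> ((m \<cdot> (w \<otimes>\<^sub>R BB) \<rhd> (AA \<otimes>\<^sub>L\<^sub>2 \<psi>\<^sub>0)) \<bullet> (m \<rhd> gi G w u))) = pr B \<lhd> w"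
  (is "?L = _")
proof -
  let ?Bw = "BB \<otimes>\<^sub>L w" and ?wB = "w \<otimes>\<^sub>R BB"
  have U: "vinv G (g \<lhd> (AA \<otimes>\<^sub>L j)) \<bullet> (?wB \<rhd> (AA \<otimes>\<^sub>L\<^sub>2 \<psi>\<^sub>0)) =
     ((?Bw \<rhd> gi G w j) \<bullet> ((BB \<otimes>\<^sub>L\<^sub>2 \<psi>\<^sub>0) \<lhd> w)) \<bullet> vinv G (gi G w u)"
  proof (rule vinv_square)
    show "(g \<lhd> (AA \<otimes>\<^sub>L j)) \<bullet> ((?Bw \<rhd> gi G w j) \<bullet> ((BB \<otimes>\<^sub>L\<^sub>2 \<psi>\<^sub>0) \<lhd> w)) = (?wB \<rhd> (AA \<otimes>\<^sub>L\<^sub>2 \<psi>\<^sub>0)) \<bullet> gi G w u"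
      using gi_nat[of "id2 G w" \<psi>\<^sub>0] by (simp flip: lwhisk_def rwhisk_def)
  qed simp_all
  have O: "(w \<rhd> pr A) \<bullet> ((\<psi> \<lhd> (AA \<otimes>\<^sub>L j)) \<bullet> ((m \<cdot> ?Bw \<rhd> gi G w j) \<bullet> (m \<rhd> (BB \<otimes>\<^sub>L\<^sub>2 \<psi>\<^sub>0) \<lhd> w))) = pr B \<lhd> w"
    using psi_runit by (simp add: tsplit_def tens1_def tens2_def flip: lwhisk_def rwhisk_def)
  have "?L = (w \<rhd> pr A) \<bullet> ((\<psi> \<lhd> (AA \<otimes>\<^sub>L j)) \<bullet>
      (m \<rhd> ((vinv G (g \<lhd> (AA \<otimes>\<^sub>L j)) \<bullet> (?wB \<rhd> (AA \<otimes>\<^sub>L\<^sub>2 \<psi>\<^sub>0))) \<bullet> gi G w u)))"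
    by (simp add: tens1_def)
  also have "\<dots> = (w \<rhd> pr A) \<bullet> ((\<psi> \<lhd> (AA \<otimes>\<^sub>L j)) \<bullet> ((m \<cdot> ?Bw \<rhd> gi G w j) \<bullet> (m \<rhd> (BB \<otimes>\<^sub>L\<^sub>2 \<psi>\<^sub>0) \<lhd> w)))"
    unfolding U by (simp add: tens1_def)
  finally show ?thesis unfolding O .
qed

lemma rev_runit:
  "(w \<rhd> pl A) \<bullet> ((\<psi>' \<lhd> (j \<otimes>\<^sub>R AA)) \<bullet> ((m \<cdot> (w \<otimes>\<^sub>R BB) \<rhd> vinv G (gi G j w)) \<bullet> (m \<rhd> (\<psi>\<^sub>0 \<otimes>\<^sub>R\<^sub>2 BB) \<lhd> w))) = pl B \<lhd> w"
  (is "?L = _")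
proof -
  let ?Bw = "BB \<otimes>\<^sub>L w" and ?wB = "w \<otimes>\<^sub>R BB"
  have U: "vinv G (gi G (w \<cdot> j) w) \<bullet> ((\<psi>\<^sub>0 \<otimes>\<^sub>R\<^sub>2 BB) \<lhd> w) = (?Bw \<rhd> (\<psi>\<^sub>0 \<otimes>\<^sub>R\<^sub>2 AA)) \<bullet> vinv G (gi G u w)"
  proof (rule vinv_square)
    show "gi G (w \<cdot> j) w \<bullet> (?Bw \<rhd> (\<psi>\<^sub>0 \<otimes>\<^sub>R\<^sub>2 AA)) = ((\<psi>\<^sub>0 \<otimes>\<^sub>R\<^sub>2 BB) \<lhd> w) \<bullet> gi G u w"
      using gi_nat[of \<psi>\<^sub>0 "id2 G w"] by (simp flip: lwhisk_def rwhisk_def)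
  qed simp_all
  have O: "(w \<rhd> pl A) \<bullet> ((\<psi> \<lhd> (j \<otimes>\<^sub>R AA)) \<bullet> (m \<cdot> ?Bw \<rhd> (\<psi>\<^sub>0 \<otimes>\<^sub>R\<^sub>2 AA))) = (pl B \<lhd> w) \<bullet> (m \<rhd> gi G u w)"
    using psi_lunit by (simp add: tsplit_def tens1_def tens2_def flip: lwhisk_def rwhisk_def)
  have k: "(m \<rhd> gi G u w) \<bullet> (m \<rhd> vinv G (gi G u w)) = id2 G (m \<cdot> ((u \<otimes>\<^sub>R BB) \<cdot> w))"
    by (simp flip: whisk_vcomp)
  have "?L = (w \<rhd> pl A) \<bullet> ((\<psi> \<lhd> (j \<otimes>\<^sub>R AA)) \<bullet> (m \<rhd> (vinv G (gi G (w \<cdot> j) w) \<bullet> ((\<psi>\<^sub>0 \<otimes>\<^sub>R\<^sub>2 BB) \<lhd> w))))"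
    by (simp add: tens1_def)
  also have "\<dots> = ((w \<rhd> pl A) \<bullet> ((\<psi> \<lhd> (j \<otimes>\<^sub>R AA)) \<bullet> (m \<cdot> ?Bw \<rhd> (\<psi>\<^sub>0 \<otimes>\<^sub>R\<^sub>2 AA)))) \<bullet> (m \<rhd> vinv G (gi G u w))"
    unfolding U by (simp add: tens1_def)
  also have "\<dots> = (pl B \<lhd> w) \<bullet> ((m \<rhd> gi G u w) \<bullet> (m \<rhd> vinv G (gi G u w)))"
    unfolding O by (simp add: tens1_def)
  also have "\<dots> = pl B \<lhd> w"
    unfolding k by (simp add: tens1_def)
  finally show ?thesis .
qed

lemma lax_monoidal_rev: "lax_monoidal (reverse G) (reverse_pmon G A) (reverse_pmon G B) w \<psi>' \<psi>\<^sub>0"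
proof -
  have [simp]: "gi (reverse G) f h = vinv G (gi G h f)" for f h by simp
  have t: "tens1 (reverse G) f h = (h \<otimes>\<^sub>R cod G f) \<cdot> (dom G h \<otimes>\<^sub>L f)" for f h
    by (simp add: tens1_def)
  have t2: "tens2 (reverse G) a b = (b \<otimes>\<^sub>R\<^sub>2 cod G (src G a)) \<star> (dom G (src G b) \<otimes>\<^sub>L\<^sub>2 a)" for a b
    by (simp add: tens2_def)
  have tc: "tcomp (reverse G) f' h' f h = (h' \<otimes>\<^sub>R cod G f') \<rhd> vinv G (vinv G (gi G h f')) \<lhd> (dom G h \<otimes>\<^sub>L f)" for f' h' f h
    by (simp add: tcomp_def)
  have w: "w \<in> hom1 G AA BB" and p: "\<psi>' \<in> hom2 G (m \<cdot> ((w \<otimes>\<^sub>R BB) \<cdot> (AA \<otimes>\<^sub>L w))) (w \<cdot> p)"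
    and p0: "\<psi>\<^sub>0 \<in> hom2 G u (w \<cdot> j)"
    by (simp_all add: mem_hom1 mem_hom2 tens1_def)
  show ?thesis
    unfolding lax_monoidal_def Let_def reverse_simps reverse_derived_simps reverse_pmon_simps t t2 tc
    using w p p0 rev_assoc rev_lunit rev_runit by (simp add: tens1_def flip: lwhisk_def rwhisk_def)
qed

lemma strong_map_reverse: "strong_map (reverse G) (reverse_pmon G A) (reverse_pmon G B) rev_map"
proof (intro strong_map.intro strong_map_axioms.intro gray_monoid_reverse A.pseudomonoid_reverse B.pseudomonoid_reverse)
  have "invertible G \<psi>'" by (simp add: tens1_def)
  then show "strong_monoidal_map (reverse G) (reverse_pmon G A) (reverse_pmon G B) rev_map"
    using lax_monoidal_rev adjunction by (simp add: strong_monoidal_map_def rev_map_def)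
qed

text \<open>Expanded into operations whose behaviour under reversal is known, so that the
  invertibility result can be instantiated in the reversed Gray monoid and read back in
  \<open>G\<close>.\<close>

lemma proj_left_one_one:
  "madj.proj_left A.one B.one = (r \<rhd> (m \<rhd> (id2 G w \<otimes>\<^sub>2 \<epsilon>))) \<bullet> ((r \<rhd> (m \<rhd> tcomp G w w A.one r)) \<bullet>
    ((r \<rhd> vinv G \<psi> \<lhd> (A.one \<otimes>\<^sub>1 r)) \<bullet> (\<eta> \<lhd> p \<cdot> (A.one \<otimes>\<^sub>1 r))))"
  by (simp add: madj.proj_left_def madj.mate_def elt_psi_def elt_tens2_def slice_tens0_def)

lemma left_autonomous_invertible:
  assumes "left_autonomous G A"
  shows "invertible G ((r \<rhd> (m \<rhd> (id2 G w \<otimes>\<^sub>2 \<epsilon>))) \<bullet> ((r \<rhd> (m \<rhd> tcomp G w w A.one r)) \<bullet>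
    ((r \<rhd> vinv G \<psi> \<lhd> (A.one \<otimes>\<^sub>1 r)) \<bullet> (\<eta> \<lhd> p \<cdot> (A.one \<otimes>\<^sub>1 r)))))"
  using left_autonomous_invertible_proj_left[OF assms] unfolding proj_left_one_one .

text \<open>The first projection cell of the reversed data differs from the second one of
  \<open>G\<close> only by interchange cells, coming from the corrected \<open>psi\<close> and from
  the comparison cell.\<close>

lemma right_autonomous_invertible_proj_right:
  assumes "right_autonomous G A"
  shows "invertible G (madj.proj_right B.one A.one)"
proof -
  let ?wB = "w \<otimes>\<^sub>R BB" and ?Bw = "BB \<otimes>\<^sub>L w"
  have L: "left_autonomous (reverse G) (reverse_pmon G A)"
    using assms by (simp add: right_autonomous_def)
  \<comment> \<open>These interchange cells form the one of the pair \<open>w r\<close> and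
    \<open>w\<close>; naturality against \<open>\<epsilon>\<close> trades it for the interchange
    cell of an identity, which is trivial.\<close>
  have 1: "((\<epsilon> \<otimes>\<^sub>R\<^sub>2 BB) \<lhd> ?Bw) \<bullet> ((?wB \<rhd> gi G r w) \<bullet> (g \<lhd> (r \<otimes>\<^sub>R AA))) = ?Bw \<rhd> (\<epsilon> \<otimes>\<^sub>R\<^sub>2 AA)"
    using gi_nat[of \<epsilon> "id2 G w", symmetric] by (simp flip: lwhisk_def rwhisk_def)
  have "invertible G ((r \<cdot> m \<rhd> (((\<epsilon> \<otimes>\<^sub>R\<^sub>2 BB) \<lhd> ?Bw) \<bullet> ((?wB \<rhd> gi G r w) \<bullet> (g \<lhd> (r \<otimes>\<^sub>R AA))))) \<bullet>
      ((r \<rhd> vinv G \<psi> \<lhd> (r \<otimes>\<^sub>R AA)) \<bullet> (\<eta> \<lhd> p \<cdot> (r \<otimes>\<^sub>R AA))))"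
    using strong_map.left_autonomous_invertible[OF strong_map_reverse L]
    by (simp add: rev_map_def tens1_def tens2_def tcomp_def flip: lwhisk_def rwhisk_def)
  moreover have "madj.proj_right B.one A.one = (r \<cdot> m \<rhd> ?Bw \<rhd> (\<epsilon> \<otimes>\<^sub>R\<^sub>2 AA)) \<bullet>
      ((r \<rhd> vinv G \<psi> \<lhd> (r \<otimes>\<^sub>R AA)) \<bullet> (\<eta> \<lhd> p \<cdot> (r \<otimes>\<^sub>R AA)))"
    by (simp add: madj.proj_right_def madj.mate_def elt_psi_def elt_tens2_def slice_tens0_def tens1_def tens2_def
        flip: lwhisk_def rwhisk_def)
  ultimately show ?thesis unfolding 1 by simp
qed

end

theorem theorem9p5p1:
  fixes G :: "('o, 'm, 'c) gray"
    and A B :: "('o, 'm, 'c) pmon"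
    and w :: "('m, 'c) monoidal_map"
  assumes "gray_monoid G"
    and "map_pseudomonoid G A" and "autonomous G A"
    and "map_pseudomonoid G B" and "autonomous G B"
    and "strong_monoidal_map G A B w"
  shows "hopf_monoidal_comonad G B (induced_comonad G A B w)"
proof -
  interpret strong_map G A B w
    using assms by (intro strong_map.intro strong_map_axioms.intro) (simp_all add: map_pseudomonoid_def)
  have "left_autonomous G A" "right_autonomous G A"
    using assms(3) by (simp_all add: autonomous_def)
  then show ?thesis
    unfolding hopf_monoidal_comonad_def
    by (intro conjI monoidal_comonad_c invertible_fusion_1 invertible_fusion_2
        left_autonomous_invertible_proj_left right_autonomous_invertible_proj_right)
qed

end
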